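(* Let $f,g\in L^p(\Omega)$ with $p\ge1$ and let $u,v$ be the solutions of $$X^*(A(x)Xu)=f,\quad X^*(A(x)Xv)=g\ \text{ in }\Omega,\qquad u=v=0\ \text{ on }\partial\Omega .$$ Then there exists a constant $C=C(Q,\Omega,p,\alpha)$ (the family $X$ being fixed) such that: \begin{itemize} \item if $p>\frac Q2$, then $\|u-v\|_{L^\infty(\Omega)}\le C\|f-g\|_{L^p(\Omega)}$ and $\|u-v\|_{W^{1,2}_0(\Omega,X)}\le C\|f-g\|_{L^p(\Omega)}$; \item if $\frac{2Q}{Q+2}\le p<\frac Q2$, then $\|u-v\|_{L^{p^{**}}(\Omega)}\le C\|f-g\|_{L^p(\Omega)}$ and $\|u-v\|_{W^{1,2}_0(\Omega,X)}\le C\|f-g\|_{L^p(\Omega)}$; \item if $1<p<\frac{2Q}{Q+2}$, then $\|u-v\|_{W^{1,p^*}_0(\Omega,X)}\le C\|f-g\|_{L^p(\Omega)}$; \item if $p=1$, then $\|u-v\|_{\mathbf M^{1^{**}}(\Omega)}\le C\|f-g\|_{L^1(\Omega)}$ and $\|Xu-Xv\|_{\mathbf M^{1^*}(\Omega)}\le C\|f-g\|_{L^1(\Omega)}$. \end{itemize} Here $p^*=\frac{pQ}{Q-p}$ and $p^{**}=\frac{pQ}{Q-2p}$, so $1^*=\frac Q{Q-1}$ and $1^{**}=\frac Q{Q-2}$.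
   Context: Setting. $N\ge2$, $\Omega\subset\mathbb R^N$ is open and bounded, and $X=\{X_1,\dots,X_m\}$ is a fixed family of locally Lipschitz vector fields on $\mathbb R^N$, $X_j=\sum_{k=1}^N c_{jk}\partial_{x_k}$; for $u\in C^1$, $Xu=(X_1u,\dots,X_mu)$ is the $X$-gradient. An absolutely continuous path $\gamma:[0,T]\to\mathbb R^N$ is $X$-subunit if $\dot\gamma(t)=\sum_{j}\theta_j(t)X_j(\gamma(t))$ with $\sum_j\theta_j^2(t)\le1$ for a.e. $t$. It is assumed that any two points of $\Omega$ are joined by an $X$-subunit path in $\Omega$; $d_X(x,y)$ is the infimum of all $T>0$ for which there is an $X$-subunit $\gamma:[0,T]\to\mathbb R^N$ with $\gamma(0)=x$, $\gamma(T)=y$; $B_r$ denotes a $d_X$-ball of radius $r$ and $B_{cr}$ the concentric ball of radius $cr$. Standing assumptions: (i) $|y-x|\to0$ implies $d_X(x,y)\to0$; (ii) $(\Omega,d_X,\mathcal L^N)$ is doubling: there is $Q>2$ with $0<\mathcal L^N(B_{2r})\le2^Q\mathcal L^N(B_r)$; (iii) there are $C_P,\nu>0$ such that $\frac1{|B_r|}\int_{B_r}|u-u_r|\,dx\le C_P\,r\,\frac1{|B_{\nu r}|}\int_{B_{\nu r}}|Xu|\,dx$ for every $d_X$-ball $B_r$ and $u\in C^1(\overline{B_{\nu r}})$, with $u_r=\frac1{|B_r|}\int_{B_r}u\,dx$. $W^{1,p}_0(\Omega,X)$ is the closure of $C^\infty_c(\Omega)$ under the norm $\|u\|_{W^{1,p}_0(\Omega,X)}=\|Xu\|_{L^p(\Omega)}$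 (with $Xu$ the $L^p$-limit of the $X$-gradients of approximating functions). Known fact (Sobolev inequality): for $1\le p<Q$ there is a constant $\mathcal S_p$ with $\|u\|_{L^{p^*}(\Omega)}\le\mathcal S_p\|Xu\|_{L^p(\Omega)}$ for all $u\in W^{1,p}_0(\Omega,X)$, $p^*=\frac{pQ}{Q-p}$. $A:\Omega\to\mathbb R^{m\times m}$ is measurable with bounded entries (not necessarily symmetric) and there are $0<\alpha<\beta$ with $\alpha|\eta|^2\le A(x)\eta\cdot\eta\le\beta|\eta|^2$ for all $\eta\in\mathbb R^m$. $X^*$ is the formal adjoint: $\langle X^*F,v\rangle=\int_\Omega F\cdot Xv$. Solutions. If $f\in L^{\frac{2Q}{Q+2}}(\Omega)$, "the solution" of $X^*(AXu)=f$ in $\Omega$, $u=0$ on $\partial\Omega$, is the weak solution: the unique (Lax–Milgram) $u\in W^{1,2}_0(\Omega,X)$ with $\int_\Omega A\,Xu\cdot Xw=\int_\Omega f\,w$ for all $w\in W^{1,2}_0(\Omega,X)$. If $f$ is only in $L^1(\Omega)$, "the solution" is the solution found by approximation: with $f_n=\max\{-n,\min\{f,n\}\}$ and $u_n$ the weak solution with datum $f_n$, it is the limit $u$ of (a subsequence of) $(u_n)_n$, weakly in $W^{1,q}_0(\Omega,X)$ for every $1<q<\frac Q{Q-1}$ and strongly in $L^s(\Omega)$ for every $1\le s<\frac Q{Q-2}$; it exists and is unique, and does not change if $(f_n)$ is replaced by any other sequence in $L^{\frac{2Q}{Q+2}}(\Omega)$ converging to $f$ in $L^1(\Omega)$. Marcinkiewicz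 space. For $1\le p<\infty$, $\mathbf M^p(\Omega)$ is the set of measurable $w$ on $\Omega$ for which there is $C_w\ge0$ with $|\{|w|\ge\lambda\}|\le C_w\lambda^{-p}$ for all $\lambda>0$; with $C_w$ optimal, $\|w\|_{\mathbf M^p(\Omega)}=C_w^{1/p}$ (for vector-valued $w$, $|w|$ is the Euclidean norm). *)

theory Defs
  imports "HOL-Analysis.Analysis" "HOL-Probability.Essential_Supremum"
begin

text \<open>
  Functions on \<open>\<Omega>\<close> are total functions on the ambient space of which only the restriction to \<open>\<Omega>\<close>,
  up to null sets, matters. A family \<open>X\<close> of vector fields is given by \<open>X j x = (c\<^sub>j\<^sub>1(x), \<dots>, c\<^sub>j\<^sub>N(x))\<close>.
\<close>

section \<open>Lebesgue and Marcinkiewicz spaces\<close>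

definition Lp :: "'a::euclidean_space set \<Rightarrow> ereal \<Rightarrow> ('a \<Rightarrow> 'b::euclidean_space) set" where
  "Lp \<Omega> p = {f \<in> borel_measurable (lebesgue_on \<Omega>).
     if p = \<infinity> then esssup (lebesgue_on \<Omega>) (\<lambda>x. ereal (norm (f x))) < \<infinity>
     else integrable (lebesgue_on \<Omega>) (\<lambda>x. norm (f x) powr real_of_ereal p)}"

text \<open>Meaningful only for members of \<open>Lp \<Omega> p\<close>.\<close>

definition Lp_norm :: "'a::euclidean_space set \<Rightarrow> ereal \<Rightarrow> ('a \<Rightarrow> 'b::euclidean_space) \<Rightarrow> real" where
  "Lp_norm \<Omega> p f =
     (if p = \<infinity> then real_of_ereal (esssup (lebesgue_on \<Omega>) (\<lambda>x. ereal (norm (f x))))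
      else (LINT x|lebesgue_on \<Omega>. norm (f x) powr real_of_ereal p) powr (1 / real_of_ereal p))"

definition Lp_tendsto ::
    "'a::euclidean_space set \<Rightarrow> ereal \<Rightarrow> (nat \<Rightarrow> 'a \<Rightarrow> 'b::euclidean_space) \<Rightarrow> ('a \<Rightarrow> 'b) \<Rightarrow> bool" where
  "Lp_tendsto \<Omega> p F f \<longleftrightarrow> (\<forall>n. F n \<in> Lp \<Omega> p) \<and> f \<in> Lp \<Omega> p \<and>
     (\<lambda>n. Lp_norm \<Omega> p (\<lambda>x. F n x - f x)) \<longlonglongrightarrow> 0"

definition Marcinkiewicz_consts ::
    "'a::euclidean_space set \<Rightarrow> real \<Rightarrow> ('a \<Rightarrow> 'b::euclidean_space) \<Rightarrow> real set" where
  "Marcinkiewicz_consts \<Omega> p w =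
     {C. C \<ge> 0 \<and> (\<forall>t>0. measure lebesgue {x \<in> \<Omega>. norm (w x) \<ge> t} \<le> C * t powr (- p))}"

definition Marcinkiewicz ::
    "'a::euclidean_space set \<Rightarrow> real \<Rightarrow> ('a \<Rightarrow> 'b::euclidean_space) set" where
  "Marcinkiewicz \<Omega> p =
     {w \<in> borel_measurable (lebesgue_on \<Omega>). Marcinkiewicz_consts \<Omega> p w \<noteq> {}}"

definition Marcinkiewicz_norm ::
    "'a::euclidean_space set \<Rightarrow> real \<Rightarrow> ('a \<Rightarrow> 'b::euclidean_space) \<Rightarrow> real" where
  "Marcinkiewicz_norm \<Omega> p w = Inf (Marcinkiewicz_consts \<Omega> p w) powr (1 / p)"

section \<open>Smooth functions and the classical \<open>X\<close>-gradient\<close>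

text \<open>\<open>C\<^sup>n\<close> on an open set, by iterating partial derivatives.\<close>

primrec Ck_on :: "nat \<Rightarrow> (real^'n) set \<Rightarrow> (real^'n \<Rightarrow> real) \<Rightarrow> bool" where
  "Ck_on 0 V f \<longleftrightarrow> continuous_on V f"
| "Ck_on (Suc n) V f \<longleftrightarrow> (\<forall>x\<in>V. f differentiable (at x)) \<and>
     (\<forall>k. Ck_on n V (\<lambda>x. frechet_derivative f (at x) (axis k 1)))"

definition test_functions :: "(real^'n) set \<Rightarrow> (real^'n \<Rightarrow> real) set" where
  "test_functions \<Omega> = {\<phi>. (\<forall>n. Ck_on n UNIV \<phi>) \<and>
     compact (closure {x. \<phi> x \<noteq> 0}) \<and> closure {x. \<phi> x \<noteq> 0} \<subseteq> \<Omega>}"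

definition classical_Xgrad ::
    "('m::finite \<Rightarrow> real^'n \<Rightarrow> real^'n) \<Rightarrow> (real^'n \<Rightarrow> real) \<Rightarrow> real^'n \<Rightarrow> real^'m" where
  "classical_Xgrad X \<phi> x =
     (\<chi> j. \<Sum>k\<in>UNIV. X j x $ k * frechet_derivative \<phi> (at x) (axis k 1))"

section \<open>The control distance\<close>

definition locally_Lipschitz_field :: "(real^'n \<Rightarrow> real^'n) \<Rightarrow> bool" where
  "locally_Lipschitz_field Y \<longleftrightarrow> (\<forall>x. \<exists>r>0. \<exists>L. L-lipschitz_on (ball x r) Y)"

definition absolutely_continuous_path :: "real \<Rightarrow> (real \<Rightarrow> real^'n) \<Rightarrow> bool" where
  "absolutely_continuous_path T \<gamma> \<longleftrightarrow>
     (\<forall>\<epsilon>>0. \<exists>\<delta>>0. \<forall>D::(real \<times> real) set.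
        finite D \<and> (\<forall>(a, b)\<in>D. 0 \<le> a \<and> a \<le> b \<and> b \<le> T) \<and>
        pairwise (\<lambda>(a, b) (c, d). {a<..<b} \<inter> {c<..<d} = {}) D \<and>
        (\<Sum>(a, b)\<in>D. b - a) < \<delta>
        \<longrightarrow> (\<Sum>(a, b)\<in>D. norm (\<gamma> b - \<gamma> a)) < \<epsilon>)"

definition subunit_path ::
    "('m::finite \<Rightarrow> real^'n \<Rightarrow> real^'n) \<Rightarrow> real \<Rightarrow> (real \<Rightarrow> real^'n) \<Rightarrow> bool" where
  "subunit_path X T \<gamma> \<longleftrightarrow> absolutely_continuous_path T \<gamma> \<and>
     (\<exists>\<theta>::'m \<Rightarrow> real \<Rightarrow> real. AE t in lebesgue_on {0..T}.
        (\<gamma> has_vector_derivative (\<Sum>j\<in>UNIV. \<theta> j t *\<^sub>R X j (\<gamma> t))) (at t) \<and>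
        (\<Sum>j\<in>UNIV. (\<theta> j t)\<^sup>2) \<le> 1)"

text \<open>The infimum is over a nonempty set whenever \<open>x\<close> and \<open>y\<close> can be joined by a subunit path.\<close>

definition dX :: "('m::finite \<Rightarrow> real^'n \<Rightarrow> real^'n) \<Rightarrow> real^'n \<Rightarrow> real^'n \<Rightarrow> real" where
  "dX X x y = Inf {T. T > 0 \<and> (\<exists>\<gamma>. subunit_path X T \<gamma> \<and> \<gamma> 0 = x \<and> \<gamma> T = y)}"

text \<open>Balls of the metric space \<open>(\<Omega>, d\<^sub>X)\<close>.\<close>

definition Xball ::
    "(real^'n) set \<Rightarrow> ('m::finite \<Rightarrow> real^'n \<Rightarrow> real^'n) \<Rightarrow> real^'n \<Rightarrow> real \<Rightarrow> (real^'n) set" where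
  "Xball \<Omega> X x r = {y \<in> \<Omega>. dX X x y < r}"

definition average :: "'a::euclidean_space set \<Rightarrow> ('a \<Rightarrow> real) \<Rightarrow> real" where
  "average B u = (LINT x|lebesgue_on B. u x) / measure lebesgue B"

text \<open>\<open>C\<^sup>1(closure B)\<close> is read as: \<open>C\<^sup>1\<close> in an open neighbourhood of the closure.\<close>

definition Poincare_ineq ::
    "(real^'n) set \<Rightarrow> ('m::finite \<Rightarrow> real^'n \<Rightarrow> real^'n) \<Rightarrow> real \<Rightarrow> real \<Rightarrow> bool" where
  "Poincare_ineq \<Omega> X C\<^sub>P \<nu> \<longleftrightarrow>
     (\<forall>x\<in>\<Omega>. \<forall>r>0. \<forall>u V. open V \<and> closure (Xball \<Omega> X x (\<nu> * r)) \<subseteq> V \<and> Ck_on 1 V u \<longrightarrow>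
        average (Xball \<Omega> X x r) (\<lambda>y. \<bar>u y - average (Xball \<Omega> X x r) u\<bar>)
          \<le> C\<^sub>P * r * average (Xball \<Omega> X x (\<nu> * r)) (\<lambda>y. norm (classical_Xgrad X u y)))"

section \<open>The spaces \<open>W\<^sub>0\<^sup>1\<^sup>,\<^sup>p(\<Omega>, X)\<close>\<close>

text \<open>
  By the Sobolev inequality (\<open>1 \<le> p < Q\<close>), test functions that are Cauchy for \<open>\<phi> \<mapsto> \<parallel>X\<phi>\<parallel>\<^sub>p\<close> converge in \<open>L\<^sup>p(\<Omega>)\<close>,
  so the closure under this norm is a space of functions, namely the following one;
  \<open>W0_grad \<Omega> X p u G\<close> says that \<open>u\<close> belongs to it and that \<open>Xu = G\<close>.
\<close>

definition W0_grad ::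
    "(real^'n) set \<Rightarrow> ('m::finite \<Rightarrow> real^'n \<Rightarrow> real^'n) \<Rightarrow> real \<Rightarrow>
     (real^'n \<Rightarrow> real) \<Rightarrow> (real^'n \<Rightarrow> real^'m) \<Rightarrow> bool" where
  "W0_grad \<Omega> X p u G \<longleftrightarrow> (\<exists>\<phi>. (\<forall>k. \<phi> k \<in> test_functions \<Omega>) \<and>
     Lp_tendsto \<Omega> p \<phi> u \<and> Lp_tendsto \<Omega> p (\<lambda>k. classical_Xgrad X (\<phi> k)) G)"

definition W0 ::
    "(real^'n) set \<Rightarrow> ('m::finite \<Rightarrow> real^'n \<Rightarrow> real^'n) \<Rightarrow> real \<Rightarrow> (real^'n \<Rightarrow> real) set" where
  "W0 \<Omega> X p = {u. \<exists>G. W0_grad \<Omega> X p u G}"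

text \<open>
  The limit \<open>G\<close> is unique up to null sets (test functions tending to \<open>0\<close> in \<open>L\<^sup>1\<close> whose \<open>X\<close>-gradients
  converge in \<open>L\<^sup>1\<close> have gradients tending to \<open>0\<close>, the coefficients being locally Lipschitz).
  For bounded \<open>\<Omega>\<close> an \<open>L\<^sup>p\<close> limit is an \<open>L\<^sup>1\<close> limit, so exponent \<open>1\<close> gives the gradient for every \<open>p \<ge> 1\<close>.
\<close>

definition Xgrad ::
    "(real^'n) set \<Rightarrow> ('m::finite \<Rightarrow> real^'n \<Rightarrow> real^'n) \<Rightarrow>
     (real^'n \<Rightarrow> real) \<Rightarrow> real^'n \<Rightarrow> real^'m" where
  "Xgrad \<Omega> X u = (SOME G. W0_grad \<Omega> X 1 u G)"

definition W0_norm ::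
    "(real^'n) set \<Rightarrow> ('m::finite \<Rightarrow> real^'n \<Rightarrow> real^'n) \<Rightarrow> real \<Rightarrow> (real^'n \<Rightarrow> real) \<Rightarrow> real" where
  "W0_norm \<Omega> X p u = Lp_norm \<Omega> p (Xgrad \<Omega> X u)"

definition W0_dual ::
    "(real^'n) set \<Rightarrow> ('m::finite \<Rightarrow> real^'n \<Rightarrow> real^'n) \<Rightarrow> real \<Rightarrow> ((real^'n \<Rightarrow> real) \<Rightarrow> real) set" where
  "W0_dual \<Omega> X p = {l.
     (\<forall>u\<in>W0 \<Omega> X p. \<forall>v\<in>W0 \<Omega> X p. \<forall>a b. l (\<lambda>x. a * u x + b * v x) = a * l u + b * l v) \<and>
     (\<exists>K. \<forall>u\<in>W0 \<Omega> X p. \<bar>l u\<bar> \<le> K * W0_norm \<Omega> X p u)}"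

definition W0_weakly_tendsto ::
    "(real^'n) set \<Rightarrow> ('m::finite \<Rightarrow> real^'n \<Rightarrow> real^'n) \<Rightarrow> real \<Rightarrow>
     (nat \<Rightarrow> real^'n \<Rightarrow> real) \<Rightarrow> (real^'n \<Rightarrow> real) \<Rightarrow> bool" where
  "W0_weakly_tendsto \<Omega> X p U u \<longleftrightarrow> (\<forall>n. U n \<in> W0 \<Omega> X p) \<and> u \<in> W0 \<Omega> X p \<and>
     (\<forall>l\<in>W0_dual \<Omega> X p. (\<lambda>n. l (U n)) \<longlonglongrightarrow> l u)"

text \<open>\<open>p\<^sup>*\<close> and \<open>p\<^sup>*\<^sup>*\<close>.\<close>

definition star_exp :: "real \<Rightarrow> real \<Rightarrow> real" where
  "star_exp Q p = p * Q / (Q - p)"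

definition dstar_exp :: "real \<Rightarrow> real \<Rightarrow> real" where
  "dstar_exp Q p = p * Q / (Q - 2 * p)"

definition Sobolev_ineq ::
    "(real^'n) set \<Rightarrow> ('m::finite \<Rightarrow> real^'n \<Rightarrow> real^'n) \<Rightarrow> real \<Rightarrow> real \<Rightarrow> real \<Rightarrow> bool" where
  "Sobolev_ineq \<Omega> X Q p S \<longleftrightarrow> (\<forall>u\<in>W0 \<Omega> X p. u \<in> Lp \<Omega> (star_exp Q p) \<and>
     Lp_norm \<Omega> (star_exp Q p) u \<le> S * W0_norm \<Omega> X p u)"

section \<open>Solutions\<close>

definition elliptic ::
    "(real^'n) set \<Rightarrow> real \<Rightarrow> real \<Rightarrow> (real^'n \<Rightarrow> real^'m^'m) \<Rightarrow> bool" where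
  "elliptic \<Omega> \<alpha> \<beta> A \<longleftrightarrow> A \<in> borel_measurable (lebesgue_on \<Omega>) \<and>
     (\<exists>M. \<forall>x\<in>\<Omega>. \<forall>i j. \<bar>A x $ i $ j\<bar> \<le> M) \<and>
     (\<forall>x\<in>\<Omega>. \<forall>\<eta>. \<alpha> * (norm \<eta>)\<^sup>2 \<le> (A x *v \<eta>) \<bullet> \<eta> \<and> (A x *v \<eta>) \<bullet> \<eta> \<le> \<beta> * (norm \<eta>)\<^sup>2)"

definition weak_solution ::
    "(real^'n) set \<Rightarrow> ('m::finite \<Rightarrow> real^'n \<Rightarrow> real^'n) \<Rightarrow> (real^'n \<Rightarrow> real^'m^'m) \<Rightarrow>
     (real^'n \<Rightarrow> real) \<Rightarrow> (real^'n \<Rightarrow> real) \<Rightarrow> bool" where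
  "weak_solution \<Omega> X A f u \<longleftrightarrow> u \<in> W0 \<Omega> X 2 \<and>
     (\<forall>w\<in>W0 \<Omega> X 2. (LINT x|lebesgue_on \<Omega>. (A x *v Xgrad \<Omega> X u x) \<bullet> Xgrad \<Omega> X w x)
                  = (LINT x|lebesgue_on \<Omega>. f x * w x))"

definition truncate :: "nat \<Rightarrow> real \<Rightarrow> real" where
  "truncate n t = max (- real n) (min t (real n))"

definition approx_solution ::
    "(real^'n) set \<Rightarrow> ('m::finite \<Rightarrow> real^'n \<Rightarrow> real^'n) \<Rightarrow> real \<Rightarrow> (real^'n \<Rightarrow> real^'m^'m) \<Rightarrow>
     (real^'n \<Rightarrow> real) \<Rightarrow> (real^'n \<Rightarrow> real) \<Rightarrow> bool" where
  "approx_solution \<Omega> X Q A f u \<longleftrightarrow>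
     (\<exists>U \<sigma>. (\<forall>n. weak_solution \<Omega> X A (\<lambda>x. truncate n (f x)) (U n)) \<and> strict_mono \<sigma> \<and>
        (\<forall>q. 1 < q \<and> q < Q / (Q - 1) \<longrightarrow> W0_weakly_tendsto \<Omega> X q (U \<circ> \<sigma>) u) \<and>
        (\<forall>s. 1 \<le> s \<and> s < Q / (Q - 2) \<longrightarrow> Lp_tendsto \<Omega> (ereal s) (U \<circ> \<sigma>) u))"

definition is_solution ::
    "(real^'n) set \<Rightarrow> ('m::finite \<Rightarrow> real^'n \<Rightarrow> real^'n) \<Rightarrow> real \<Rightarrow> (real^'n \<Rightarrow> real^'m^'m) \<Rightarrow>
     (real^'n \<Rightarrow> real) \<Rightarrow> (real^'n \<Rightarrow> real) \<Rightarrow> bool" where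
  "is_solution \<Omega> X Q A f u \<longleftrightarrow> f \<in> Lp \<Omega> 1 \<and>
     (if f \<in> Lp \<Omega> (ereal (2 * Q / (Q + 2))) then weak_solution \<Omega> X A f u
      else approx_solution \<Omega> X Q A f u)"

end

theory Submission
  imports Defs
begin

text \<open>
  The estimates are a priori estimates for weak solutions, carried over to all solutions by linearity and
  strong convergence.
  
  A weak solution \<open>d\<close> with datum \<open>F\<close> is tested with \<open>H (d)\<close>, where \<open>H' = h\<^sup>2\<close> for a bounded continuous
  profile \<open>h\<close>. By ellipticity this bounds the \<open>L\<^sup>2\<close> norm of \<open>h (d) Xd\<close>, the gradient of \<open>K (d)\<close> with
  \<open>K' = h\<close>, and the Sobolev inequality then bounds the norm of \<open>K (d)\<close> with exponent \<open>2\<^sup>*\<close>, in terms of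
  the integral of \<open>F H (d)\<close> (\<open>energy\<close>, \<open>energy_Sobolev\<close>). Each case of the theorem is a choice of \<open>h\<close>.
  
  A constant \<open>h\<close> gives the bound in \<open>W\<^sub>0\<^sup>1\<^sup>,\<^sup>2\<close> (\<open>W12_estimate\<close>). A ramp between two levels gives an
  inequality between the measures of superlevel sets of \<open>d\<close>, which Stampacchia's iteration turns into a
  bound for \<open>d\<close> when \<open>p > Q/2\<close> (\<open>sup_estimate\<close>). A power \<open>(1 + \<bar>t\<bar>)\<^sup>\<gamma>\<^sup>-\<^sup>1\<close>, with \<open>\<gamma>\<close> such
  that \<open>2\<^sup>* \<gamma> = p\<^sup>*\<^sup>*\<close>, makes the right-hand side a smaller power of the left-hand side when \<open>1 < p < Q/2\<close>
  (\<open>subcritical_estimate\<close>). If \<open>\<gamma> \<ge> 1\<close>, this bounds \<open>d\<close> in \<open>L\<close> to the exponent \<open>p\<^sup>*\<^sup>*\<close>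
  (\<open>Lebesgue_estimate\<close>); if \<open>\<gamma> < 1\<close>, interpolation with the weighted energy bounds the gradient in \<open>L\<close> to the
  exponent \<open>p\<^sup>*\<close> (\<open>W1_pstar_estimate\<close>). For \<open>p = 1\<close>, profiles with bounded \<open>H\<close> give the weak type
  bounds (\<open>weak_type_estimate\<close>) and the integrability of the gradient (\<open>W11_estimate\<close>).
  
  Since the equation is linear, the estimates also apply to differences of weak solutions. Along the
  weak solutions that define a solution, the data converge, hence the gradients form a Cauchy sequence;
  the limit belongs to \<open>W\<^sub>0\<close>, its gradient is the strong limit of the gradients, and the estimates
  persist (\<open>gradient_limit\<close>, \<open>weak_type_limit\<close>).
  
  Two facts about \<open>W\<^sub>0\<close> underlie this. The gradient is determined by the function, although the
  coefficients are only Lipschitz: difference quotients can be moved from a test function to a Lipschitz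
  function (\<open>gradient_limit_zero\<close>). And \<open>H (d)\<close> belongs to \<open>W\<^sub>0\<close>, with the expected gradient,
  although test functions must be smooth: on the range of a test function, \<open>h\<close> is uniformly close to a
  polynomial (\<open>W0_grad_chain\<close>).
\<close>

section \<open>Lebesgue spaces\<close>

text \<open>
  The \<open>p\<close>-th power of the \<open>L\<^sup>p\<close> norm. It is subadditive up to the factor \<open>2\<^sup>p\<close>, which is enough for
  limits and for bounds with unspecified constants.
\<close>

abbreviation Lint :: "'a::euclidean_space set \<Rightarrow> real \<Rightarrow> ('a \<Rightarrow> 'b::euclidean_space) \<Rightarrow> real" where
  "Lint \<Omega> p f \<equiv> LINT x|lebesgue_on \<Omega>. norm (f x) powr p"

lemma Lp_iff:
  "f \<in> Lp \<Omega> (ereal p) \<longleftrightarrow>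
     f \<in> borel_measurable (lebesgue_on \<Omega>) \<and> integrable (lebesgue_on \<Omega>) (\<lambda>x. norm (f x) powr p)"
  by (simp add: Lp_def)

lemma Lp_norm_ereal: "Lp_norm \<Omega> (ereal p) f = Lint \<Omega> p f powr (1 / p)"
  by (simp add: Lp_norm_def)

lemma Lp_borel [measurable_dest]: "f \<in> Lp \<Omega> p \<Longrightarrow> f \<in> borel_measurable (lebesgue_on \<Omega>)"
  by (simp add: Lp_def)

lemma Lint_nonneg [simp]: "0 \<le> Lint \<Omega> p f"
  by (rule integral_nonneg_AE) auto

lemma powr_add_le:
  fixes a b p :: real
  assumes "0 \<le> a" "0 \<le> b" "0 \<le> p"
  shows "(a + b) powr p \<le> 2 powr p * (a powr p + b powr p)"
proof -
  have "(a + b) powr p \<le> (2 * max a b) powr p"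
    using assms by (intro powr_mono2) auto
  also have "\<dots> = 2 powr p * max a b powr p"
    using assms by (simp add: powr_mult)
  also have "\<dots> \<le> 2 powr p * (a powr p + b powr p)"
    using assms by (intro mult_left_mono) (auto simp: max_def)
  finally show ?thesis .
qed

lemma norm_add_powr_le:
  fixes a b :: "'a::real_normed_vector"
  assumes "0 \<le> p"
  shows "norm (a + b) powr p \<le> 2 powr p * (norm a powr p + norm b powr p)"
proof -
  have "norm (a + b) powr p \<le> (norm a + norm b) powr p"
    using assms by (intro powr_mono2 norm_triangle_ineq) auto
  then show ?thesis
    using powr_add_le[of "norm a" "norm b" p] assms by simp
qed

lemma integrable_norm_add_powr:
  fixes f g :: "'a::euclidean_space \<Rightarrow> 'b::euclidean_space"
  assumes "f \<in> Lp \<Omega> (ereal p)" "g \<in> Lp \<Omega> (ereal p)" "0 \<le> p"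
  shows "integrable (lebesgue_on \<Omega>) (\<lambda>x. norm (f x + g x) powr p)"
proof (rule Bochner_Integration.integrable_bound)
  note [measurable] = Lp_borel[OF assms(1)] Lp_borel[OF assms(2)]
  show "integrable (lebesgue_on \<Omega>) (\<lambda>x. 2 powr p * (norm (f x) powr p + norm (g x) powr p))"
    using assms by (auto simp: Lp_iff)
  show "(\<lambda>x. norm (f x + g x) powr p) \<in> borel_measurable (lebesgue_on \<Omega>)"
    by measurable
qed (use norm_add_powr_le[OF assms(3)] in auto)

lemma Lp_add:
  fixes f g :: "'a::euclidean_space \<Rightarrow> 'b::euclidean_space"
  assumes "f \<in> Lp \<Omega> (ereal p)" "g \<in> Lp \<Omega> (ereal p)" "0 \<le> p"
  shows "(\<lambda>x. f x + g x) \<in> Lp \<Omega> (ereal p)"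
  using integrable_norm_add_powr[OF assms] assms by (auto simp: Lp_iff)

lemma Lint_add_le:
  fixes f g :: "'a::euclidean_space \<Rightarrow> 'b::euclidean_space"
  assumes "f \<in> Lp \<Omega> (ereal p)" "g \<in> Lp \<Omega> (ereal p)" "0 \<le> p"
  shows "Lint \<Omega> p (\<lambda>x. f x + g x) \<le> 2 powr p * (Lint \<Omega> p f + Lint \<Omega> p g)"
proof -
  have "Lint \<Omega> p (\<lambda>x. f x + g x)
      \<le> (LINT x|lebesgue_on \<Omega>. 2 powr p * (norm (f x) powr p + norm (g x) powr p))"
    by (intro integral_mono integrable_norm_add_powr[OF assms] norm_add_powr_le[OF assms(3)])
       (use assms in \<open>auto simp: Lp_iff\<close>)
  then show ?thesis
    using assms by (simp add: Lp_iff)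
qed

lemma Lp_scale:
  fixes f :: "'a::euclidean_space \<Rightarrow> 'b::euclidean_space"
  assumes "f \<in> Lp \<Omega> (ereal p)"
  shows "(\<lambda>x. c *\<^sub>R f x) \<in> Lp \<Omega> (ereal p)"
  using assms by (auto simp: Lp_iff powr_mult)

lemma Lint_scale:
  fixes f :: "'a::euclidean_space \<Rightarrow> 'b::euclidean_space"
  shows "Lint \<Omega> p (\<lambda>x. c *\<^sub>R f x) = \<bar>c\<bar> powr p * Lint \<Omega> p f"
  by (simp add: powr_mult)

lemma Lp_diff:
  fixes f g :: "'a::euclidean_space \<Rightarrow> 'b::euclidean_space"
  assumes "f \<in> Lp \<Omega> (ereal p)" "g \<in> Lp \<Omega> (ereal p)" "0 \<le> p"
  shows "(\<lambda>x. f x - g x) \<in> Lp \<Omega> (ereal p)"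
  using Lp_add[OF assms(1) Lp_scale[OF assms(2), of "-1"] assms(3)] by simp

lemma Lint_diff_le:
  fixes f g :: "'a::euclidean_space \<Rightarrow> 'b::euclidean_space"
  assumes "f \<in> Lp \<Omega> (ereal p)" "g \<in> Lp \<Omega> (ereal p)" "0 \<le> p"
  shows "Lint \<Omega> p (\<lambda>x. f x - g x) \<le> 2 powr p * (Lint \<Omega> p f + Lint \<Omega> p g)"
  using Lint_add_le[OF assms(1) Lp_scale[OF assms(2), of "-1"] assms(3)] by simp

text \<open>
  Splitting at height \<open>\<epsilon>\<close>: this is what embeds \<open>L\<^sup>p\<close> into \<open>L\<^sup>q\<close> for \<open>q \<le> p\<close> on a set of finite measure.
\<close>

lemma powr_interpolate:
  fixes a e :: real
  assumes "0 \<le> a" "0 < e" "0 \<le> q" "q \<le> p"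
  shows "a powr q \<le> e powr q + e powr (q - p) * a powr p"
proof (cases "a \<le> e")
  case True
  then have "a powr q \<le> e powr q"
    using assms by (intro powr_mono2) auto
  then show ?thesis by (simp add: add_increasing2)
next
  case False
  then have "a powr q = a powr (q - p) * a powr p"
    using assms by (simp flip: powr_add)
  also have "\<dots> \<le> e powr (q - p) * a powr p"
    using False assms by (intro mult_right_mono powr_mono2') auto
  finally show ?thesis by (simp add: add_increasing)
qed

lemma Lint_interpolate:
  assumes \<Omega>: "\<Omega> \<in> lmeasurable" and f: "f \<in> Lp \<Omega> (ereal p)" and q: "0 \<le> q" "q \<le> p"
  shows Lp_mono: "f \<in> Lp \<Omega> (ereal q)"
    and "0 < e \<Longrightarrow> Lint \<Omega> q f \<le> e powr q * measure lebesgue \<Omega> + e powr (q - p) * Lint \<Omega> p f"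
proof -
  interpret finite_measure "lebesgue_on \<Omega>"
    using \<Omega> by (simp add: finite_measure_lebesgue_on)
  note [measurable] = Lp_borel[OF f]
  have int: "integrable (lebesgue_on \<Omega>) (\<lambda>x. e powr q + e powr (q - p) * norm (f x) powr p)" for e
    using f by (auto simp: Lp_iff)
  have int2: "integrable (lebesgue_on \<Omega>) (\<lambda>x. norm (f x) powr q)"
  proof (rule Bochner_Integration.integrable_bound[OF int[of 1]])
    show "AE x in lebesgue_on \<Omega>. norm (norm (f x) powr q) \<le> norm (1 powr q + 1 powr (q - p) * norm (f x) powr p)"
      using powr_interpolate[of "norm (f _)" 1 q p] q by auto
  qed measurable
  then show "f \<in> Lp \<Omega> (ereal q)" using f by (simp add: Lp_iff)
  show "Lint \<Omega> q f \<le> e powr q * measure lebesgue \<Omega> + e powr (q - p) * Lint \<Omega> p f" if e: "0 < e"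
  proof -
    have "Lint \<Omega> q f \<le> (LINT x|lebesgue_on \<Omega>. e powr q + e powr (q - p) * norm (f x) powr p)"
      by (intro integral_mono int int2 powr_interpolate) (use q e in auto)
    also have "\<dots> = e powr q * measure lebesgue \<Omega> + e powr (q - p) * Lint \<Omega> p f"
      using f \<Omega> by (simp add: Lp_iff measure_restrict_space)
    finally show ?thesis .
  qed
qed

lemma tendsto_powr_zero:
  fixes a :: "nat \<Rightarrow> real"
  assumes "a \<longlonglongrightarrow> 0" "\<And>n. 0 \<le> a n" "0 < p"
  shows "(\<lambda>n. a n powr p) \<longlonglongrightarrow> 0"
  using tendsto_zero_powrI[OF assms(1) tendsto_const[of p]] assms by simp

lemma Lp_tendsto_iff:
  assumes p: "0 < p"
  shows "Lp_tendsto \<Omega> (ereal p) F f \<longleftrightarrow> (\<forall>n. F n \<in> Lp \<Omega> (ereal p)) \<and> f \<in> Lp \<Omega> (ereal p) \<and>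
     (\<lambda>n. Lint \<Omega> p (\<lambda>x. F n x - f x)) \<longlonglongrightarrow> 0"
proof -
  have "(\<lambda>n. a n powr (1 / p)) \<longlonglongrightarrow> 0 \<longleftrightarrow> a \<longlonglongrightarrow> 0" if "\<And>n. 0 \<le> a n" for a :: "nat \<Rightarrow> real"
  proof
    assume *: "(\<lambda>n. a n powr (1 / p)) \<longlonglongrightarrow> 0"
    have "(\<lambda>n. (a n powr (1 / p)) powr p) \<longlonglongrightarrow> 0"
      by (rule tendsto_powr_zero[OF *]) (use p in auto)
    then show "a \<longlonglongrightarrow> 0" using p that by (simp add: powr_powr)
  next
    assume "a \<longlonglongrightarrow> 0"
    then show "(\<lambda>n. a n powr (1 / p)) \<longlonglongrightarrow> 0"
      using p that by (intro tendsto_powr_zero) auto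
  qed
  from this[of "\<lambda>n. Lint \<Omega> p (\<lambda>x. F n x - f x)"] show ?thesis
    by (simp add: Lp_tendsto_def Lp_norm_ereal)
qed

lemma Lp_tendsto_mono:
  assumes \<Omega>: "\<Omega> \<in> lmeasurable" and F: "Lp_tendsto \<Omega> (ereal p) F f" and q: "0 < q" "q \<le> p"
  shows "Lp_tendsto \<Omega> (ereal q) F f"
proof -
  have p: "0 < p" using q by simp
  have mem: "F n \<in> Lp \<Omega> (ereal p)" "f \<in> Lp \<Omega> (ereal p)"
    and lim: "(\<lambda>n. Lint \<Omega> p (\<lambda>x. F n x - f x)) \<longlonglongrightarrow> 0" for n
    using F by (auto simp: Lp_tendsto_iff[OF p])
  have D: "(\<lambda>x. F n x - f x) \<in> Lp \<Omega> (ereal p)" for n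
    using mem p by (intro Lp_diff) auto
  have "(\<lambda>n. Lint \<Omega> q (\<lambda>x. F n x - f x)) \<longlonglongrightarrow> 0"
  proof (rule LIMSEQ_I)
    fix r :: real assume r: "0 < r"
    let ?m = "measure lebesgue \<Omega>"
    define e where "e = (r / (2 * (?m + 1))) powr (1 / q)"
    have m: "0 < ?m + 1" by (simp add: add_nonneg_pos)
    then have e: "0 < e" using r by (simp add: e_def)
    have "e powr q * ?m \<le> r / 2"
    proof -
      have "e powr q = r / (2 * (?m + 1))" using r q by (simp add: e_def powr_powr)
      then have "e powr q * (?m + 1) = r / 2" using m by (simp add: field_simps)
      moreover have "e powr q * ?m \<le> e powr q * (?m + 1)" by (intro mult_left_mono) auto
      ultimately show ?thesis by simp
    qed
    moreover have "(\<lambda>n. e powr (q - p) * Lint \<Omega> p (\<lambda>x. F n x - f x)) \<longlonglongrightarrow> e powr (q - p) * 0"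
      by (intro tendsto_intros lim)
    then have "\<forall>\<^sub>F n in sequentially. e powr (q - p) * Lint \<Omega> p (\<lambda>x. F n x - f x) < r / 2"
      using r by (intro order_tendstoD(2)) auto
    then obtain N where "e powr (q - p) * Lint \<Omega> p (\<lambda>x. F n x - f x) < r / 2" if "n \<ge> N" for n
      by (auto simp: eventually_sequentially)
    ultimately have "Lint \<Omega> q (\<lambda>x. F n x - f x) < r" if "n \<ge> N" for n
      using Lint_interpolate(2)[OF \<Omega> D[of n] less_imp_le[OF q(1)] q(2) e] that by fastforce
    then show "\<exists>N. \<forall>n\<ge>N. norm (Lint \<Omega> q (\<lambda>x. F n x - f x) - 0) < r" by auto
  qed
  then show ?thesis
    using mem Lp_mono[OF \<Omega> _ less_imp_le[OF q(1)] q(2)] by (auto simp: Lp_tendsto_iff[OF q(1)])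
qed

lemma Lp_tendsto_add:
  fixes f g :: "'a::euclidean_space \<Rightarrow> 'b::euclidean_space"
  assumes "Lp_tendsto \<Omega> (ereal p) F f" "Lp_tendsto \<Omega> (ereal p) G g" and p: "0 < p"
  shows "Lp_tendsto \<Omega> (ereal p) (\<lambda>n x. F n x + G n x) (\<lambda>x. f x + g x)"
proof -
  have mem: "\<And>n. F n \<in> Lp \<Omega> (ereal p)" "f \<in> Lp \<Omega> (ereal p)" "\<And>n. G n \<in> Lp \<Omega> (ereal p)" "g \<in> Lp \<Omega> (ereal p)"
    and lim: "(\<lambda>n. Lint \<Omega> p (\<lambda>x. F n x - f x)) \<longlonglongrightarrow> 0" "(\<lambda>n. Lint \<Omega> p (\<lambda>x. G n x - g x)) \<longlonglongrightarrow> 0"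
    using assms by (auto simp: Lp_tendsto_iff[OF p])
  have "(\<lambda>n. Lint \<Omega> p (\<lambda>x. (F n x + G n x) - (f x + g x))) \<longlonglongrightarrow> 0"
  proof (rule tendsto_sandwich[where f="\<lambda>_. 0"])
    show "(\<lambda>n. 2 powr p * (Lint \<Omega> p (\<lambda>x. F n x - f x) + Lint \<Omega> p (\<lambda>x. G n x - g x))) \<longlonglongrightarrow> 0"
      using tendsto_mult[OF tendsto_const[of "2 powr p"] tendsto_add[OF lim]] by simp
    show "\<forall>\<^sub>F n in sequentially. Lint \<Omega> p (\<lambda>x. (F n x + G n x) - (f x + g x))
       \<le> 2 powr p * (Lint \<Omega> p (\<lambda>x. F n x - f x) + Lint \<Omega> p (\<lambda>x. G n x - g x))"
    proof (intro always_eventually allI)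
      fix n show "Lint \<Omega> p (\<lambda>x. (F n x + G n x) - (f x + g x))
       \<le> 2 powr p * (Lint \<Omega> p (\<lambda>x. F n x - f x) + Lint \<Omega> p (\<lambda>x. G n x - g x))"
      using Lint_add_le[OF Lp_diff[OF mem(1) mem(2)] Lp_diff[OF mem(3) mem(4)], of n n] p
      by (simp add: algebra_simps)
    qed
  qed (auto intro: always_eventually)
  then show ?thesis
    using mem p by (auto simp: Lp_tendsto_iff[OF p] intro!: Lp_add)
qed

lemma Lp_tendsto_scale:
  fixes f :: "'a::euclidean_space \<Rightarrow> 'b::euclidean_space"
  assumes "Lp_tendsto \<Omega> (ereal p) F f" and p: "0 < p"
  shows "Lp_tendsto \<Omega> (ereal p) (\<lambda>n x. c *\<^sub>R F n x) (\<lambda>x. c *\<^sub>R f x)"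
proof -
  have "(\<lambda>n. Lint \<Omega> p (\<lambda>x. c *\<^sub>R (F n x - f x))) \<longlonglongrightarrow> 0"
    unfolding Lint_scale
    using assms by (intro tendsto_mult_right_zero) (auto simp: Lp_tendsto_iff[OF p])
  then show ?thesis
    using assms by (auto simp: Lp_tendsto_iff[OF p] scaleR_diff_right intro!: Lp_scale)
qed

lemma Lp_tendsto_diff:
  fixes f g :: "'a::euclidean_space \<Rightarrow> 'b::euclidean_space"
  assumes "Lp_tendsto \<Omega> (ereal p) F f" "Lp_tendsto \<Omega> (ereal p) G g" and p: "0 < p"
  shows "Lp_tendsto \<Omega> (ereal p) (\<lambda>n x. F n x - G n x) (\<lambda>x. f x - g x)"
  using Lp_tendsto_add[OF assms(1) Lp_tendsto_scale[OF assms(2) p, of "-1"] p] by simp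

lemma Lp_tendsto_const: "f \<in> Lp \<Omega> (ereal p) \<Longrightarrow> 0 < p \<Longrightarrow> Lp_tendsto \<Omega> (ereal p) (\<lambda>n. f) f"
  by (simp add: Lp_tendsto_iff)

lemma Lp_tendsto_subseq:
  "Lp_tendsto \<Omega> (ereal p) F f \<Longrightarrow> strict_mono r \<Longrightarrow> Lp_tendsto \<Omega> (ereal p) (\<lambda>n. F (r n)) f"
  using LIMSEQ_subseq_LIMSEQ[of "\<lambda>n. Lp_norm \<Omega> (ereal p) (\<lambda>x. F n x - f x)" 0 r]
  by (auto simp: Lp_tendsto_def o_def)

lemma Lp_tendsto_AE_subseq:
  fixes f :: "'a::euclidean_space \<Rightarrow> 'b::euclidean_space"
  assumes F: "Lp_tendsto \<Omega> (ereal p) F f" and p: "0 < p"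
  obtains r where "strict_mono r" "AE x in lebesgue_on \<Omega>. (\<lambda>n. F (r n) x) \<longlonglongrightarrow> f x"
proof -
  have mem: "\<And>n. (\<lambda>x. F n x - f x) \<in> Lp \<Omega> (ereal p)"
    and lim: "(\<lambda>n. Lint \<Omega> p (\<lambda>x. F n x - f x)) \<longlonglongrightarrow> 0"
    using F p by (auto simp: Lp_tendsto_iff[OF p] intro: Lp_diff)
  obtain r where r: "strict_mono r"
    and ae: "AE x in lebesgue_on \<Omega>. (\<lambda>n. norm (F (r n) x - f x) powr p) \<longlonglongrightarrow> 0"
    using tendsto_L1_AE_subseq[of "lebesgue_on \<Omega>" "\<lambda>n x. norm (F n x - f x) powr p"] mem lim
    by (auto simp: Lp_iff)
  have "(\<lambda>n. F (r n) x) \<longlonglongrightarrow> f x" if "(\<lambda>n. norm (F (r n) x - f x) powr p) \<longlonglongrightarrow> 0" for x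
  proof -
    have "(\<lambda>n. (norm (F (r n) x - f x) powr p) powr (1 / p)) \<longlonglongrightarrow> 0"
      by (rule tendsto_powr_zero[OF that]) (use p in auto)
    then have "(\<lambda>n. norm (F (r n) x - f x)) \<longlonglongrightarrow> 0" using p by (simp add: powr_powr)
    then show ?thesis by (simp add: tendsto_norm_zero_iff LIM_zero_iff)
  qed
  with ae have "AE x in lebesgue_on \<Omega>. (\<lambda>n. F (r n) x) \<longlonglongrightarrow> f x" by auto
  with r that show ?thesis by blast
qed

lemma Lp_tendsto_unique:
  fixes f g :: "'a::euclidean_space \<Rightarrow> 'b::euclidean_space"
  assumes "Lp_tendsto \<Omega> (ereal p) F f" "Lp_tendsto \<Omega> (ereal p) F g" and p: "0 < p"
  shows "AE x in lebesgue_on \<Omega>. f x = g x"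
proof -
  obtain r where r: "strict_mono r" "AE x in lebesgue_on \<Omega>. (\<lambda>n. F (r n) x) \<longlonglongrightarrow> f x"
    using Lp_tendsto_AE_subseq[OF assms(1) p] by blast
  obtain s where s: "strict_mono s" "AE x in lebesgue_on \<Omega>. (\<lambda>n. F (r (s n)) x) \<longlonglongrightarrow> g x"
    using Lp_tendsto_AE_subseq[OF Lp_tendsto_subseq[OF assms(2) r(1)] p] by blast
  show ?thesis
    using r(2) s(2)
  proof eventually_elim
    case (elim x)
    then have "(\<lambda>n. F (r (s n)) x) \<longlonglongrightarrow> f x"
      using LIMSEQ_subseq_LIMSEQ[OF elim(1) s(1)] by (simp add: o_def)
    then show ?case using elim(2) LIMSEQ_unique by blast
  qed
qed

lemma Lp_AE_cong:
  assumes "f \<in> Lp \<Omega> (ereal p)" "g \<in> borel_measurable (lebesgue_on \<Omega>)" "AE x in lebesgue_on \<Omega>. f x = g x"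
  shows "g \<in> Lp \<Omega> (ereal p)" and "Lint \<Omega> p f = Lint \<Omega> p g"
proof -
  note [measurable] = Lp_borel[OF assms(1)] assms(2)
  have ae: "AE x in lebesgue_on \<Omega>. norm (f x) powr p = norm (g x) powr p" using assms(3) by auto
  then have "integrable (lebesgue_on \<Omega>) (\<lambda>x. norm (f x) powr p)
      = integrable (lebesgue_on \<Omega>) (\<lambda>x. norm (g x) powr p)"
    by (intro integrable_cong_AE) measurable
  with assms show "g \<in> Lp \<Omega> (ereal p)" by (simp add: Lp_iff)
  show "Lint \<Omega> p f = Lint \<Omega> p g" by (intro integral_cong_AE ae) measurable
qed

lemma Lp_tendsto_AE_cong:
  assumes F: "Lp_tendsto \<Omega> (ereal p) F f" and p: "0 < p"
    and g: "g \<in> borel_measurable (lebesgue_on \<Omega>)" "AE x in lebesgue_on \<Omega>. f x = g x"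
  shows "Lp_tendsto \<Omega> (ereal p) F g"
proof -
  have mem: "\<And>n. F n \<in> Lp \<Omega> (ereal p)" "f \<in> Lp \<Omega> (ereal p)"
    using F by (auto simp: Lp_tendsto_iff[OF p])
  have "Lint \<Omega> p (\<lambda>x. F n x - f x) = Lint \<Omega> p (\<lambda>x. F n x - g x)" for n
    using g(2) by (intro Lp_AE_cong(2) Lp_diff mem borel_measurable_diff Lp_borel[OF mem(1)] g(1))
      (use p in auto)
  then show ?thesis
    using F Lp_AE_cong(1)[OF mem(2) g] by (auto simp: Lp_tendsto_iff[OF p])
qed

text \<open>
  Bounds pass to \<open>L\<^sup>p\<close> limits up to the factor \<open>2\<^sup>p\<close>, by quasi-subadditivity.
\<close>

lemma Lint_limit_le:
  assumes F: "Lp_tendsto \<Omega> (ereal p) F f" and p: "0 < p"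
    and bound: "\<forall>\<^sub>F n in sequentially. Lint \<Omega> p (F n) \<le> C"
  shows "Lint \<Omega> p f \<le> 2 powr p * C"
proof -
  have mem: "\<And>n. F n \<in> Lp \<Omega> (ereal p)" "f \<in> Lp \<Omega> (ereal p)"
    and lim: "(\<lambda>n. Lint \<Omega> p (\<lambda>x. F n x - f x)) \<longlonglongrightarrow> 0"
    using F by (auto simp: Lp_tendsto_iff[OF p])
  show ?thesis
  proof (rule tendsto_lowerbound)
    show "(\<lambda>n. 2 powr p * (C + Lint \<Omega> p (\<lambda>x. F n x - f x))) \<longlonglongrightarrow> 2 powr p * C"
      using tendsto_mult[OF tendsto_const[of "2 powr p"] tendsto_add[OF tendsto_const[of C] lim]] by simp
    show "\<forall>\<^sub>F n in sequentially. Lint \<Omega> p f \<le> 2 powr p * (C + Lint \<Omega> p (\<lambda>x. F n x - f x))"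
      using bound
    proof eventually_elim
      case (elim n)
      have "Lint \<Omega> p f \<le> 2 powr p * (Lint \<Omega> p (F n) + Lint \<Omega> p (\<lambda>x. F n x - f x))"
        using Lint_diff_le[OF mem(1)[of n] Lp_diff[OF mem(1)[of n] mem(2)]] p by simp
      also have "\<dots> \<le> 2 powr p * (C + Lint \<Omega> p (\<lambda>x. F n x - f x))"
        using elim by (intro mult_left_mono add_right_mono) auto
      finally show ?case .
    qed
  qed simp
qed

lemma Lp_tendsto_dominated:
  fixes f :: "'a::euclidean_space \<Rightarrow> 'b::euclidean_space"
  assumes "\<And>n. F n \<in> Lp \<Omega> (ereal p)" "f \<in> Lp \<Omega> (ereal p)" and p: "0 < p"
    and w: "w \<in> Lp \<Omega> (ereal p)"
    and ae: "AE x in lebesgue_on \<Omega>. (\<lambda>n. F n x) \<longlonglongrightarrow> f x"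
    and dom: "\<And>n. AE x in lebesgue_on \<Omega>. norm (F n x - f x) \<le> norm (w x)"
  shows "Lp_tendsto \<Omega> (ereal p) F f"
proof -
  note [measurable] = Lp_borel[OF assms(1)] Lp_borel[OF assms(2)]
  have "(\<lambda>n. Lint \<Omega> p (\<lambda>x. F n x - f x)) \<longlonglongrightarrow> (LINT x|lebesgue_on \<Omega>. 0)"
  proof (rule integral_dominated_convergence)
    show "integrable (lebesgue_on \<Omega>) (\<lambda>x. norm (w x) powr p)" using w by (simp add: Lp_iff)
    show "AE x in lebesgue_on \<Omega>. (\<lambda>n. norm (F n x - f x) powr p) \<longlonglongrightarrow> 0"
      using ae
    proof eventually_elim
      case (elim x)
      then have "(\<lambda>n. norm (F n x - f x)) \<longlonglongrightarrow> 0"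
        by (simp add: tendsto_norm_zero_iff LIM_zero_iff)
      then show ?case
        using p by (intro tendsto_powr_zero) auto
    qed
    show "AE x in lebesgue_on \<Omega>. norm (norm (F n x - f x) powr p) \<le> norm (w x) powr p" for n
      using dom[of n] by eventually_elim (use p in \<open>auto intro: powr_mono2\<close>)
  qed auto
  then show ?thesis using assms by (simp add: Lp_tendsto_iff[OF p])
qed

text \<open>
  Completeness. On a set of finite measure an \<open>L\<^sup>p\<close> Cauchy sequence is Cauchy in \<open>L\<^sup>1\<close>, so a
  subsequence converges almost everywhere; Fatou's lemma, applied to \<open>F n - F (r i)\<close> as
  \<open>i\<close> grows, shows that the pointwise limit is the limit in \<open>L\<^sup>p\<close>.
\<close>

lemma Lp_Cauchy_limit:
  fixes F :: "nat \<Rightarrow> 'a::euclidean_space \<Rightarrow> 'b::euclidean_space"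
  assumes \<Omega>: "\<Omega> \<in> lmeasurable" and p: "1 \<le> p" and F: "\<And>n. F n \<in> Lp \<Omega> (ereal p)"
    and cauchy: "\<And>e. 0 < e \<Longrightarrow> \<exists>N. \<forall>m\<ge>N. \<forall>n\<ge>N. Lint \<Omega> p (\<lambda>x. F m x - F n x) < e"
  obtains f where "Lp_tendsto \<Omega> (ereal p) F f"
proof -
  note [measurable] = Lp_borel[OF F]
  have D: "(\<lambda>x. F m x - F n x) \<in> Lp \<Omega> (ereal p)" for m n
    using F p by (intro Lp_diff) auto
  have F1: "F n \<in> Lp \<Omega> (ereal 1)" for n
    using Lp_mono[OF \<Omega> F] p by auto
  then have int1: "integrable (lebesgue_on \<Omega>) (F n)" for n
    by (subst integrable_norm_iff[symmetric]) (auto simp: Lp_iff)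
  have "\<exists>N. \<forall>i\<ge>N. \<forall>j\<ge>N. (LINT x|lebesgue_on \<Omega>. norm (F i x - F j x)) < r" if r: "0 < r" for r
  proof -
    let ?m = "measure lebesgue \<Omega>"
    define e where "e = r / (2 * (?m + 1))"
    have m: "0 < ?m + 1" by (simp add: add_nonneg_pos)
    then have e: "0 < e" using r by (simp add: e_def)
    from m have e2: "e * ?m \<le> r / 2" using r by (simp add: e_def divide_simps)
    obtain N where N: "\<And>m n. m \<ge> N \<Longrightarrow> n \<ge> N \<Longrightarrow> Lint \<Omega> p (\<lambda>x. F m x - F n x) < r / 2 / e powr (1 - p)"
      using cauchy[of "r / 2 / e powr (1 - p)"] r e by auto
    have "(LINT x|lebesgue_on \<Omega>. norm (F i x - F j x)) < r" if "i \<ge> N" "j \<ge> N" for i j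
    proof -
      have "e powr (1 - p) * Lint \<Omega> p (\<lambda>x. F i x - F j x) < r / 2"
        using N[OF that] e by (simp add: field_simps)
      then show ?thesis
        using Lint_interpolate(2)[OF \<Omega> D[of i j], of 1 e] p e e2 by simp
    qed
    then show ?thesis by blast
  qed
  then obtain r where r: "strict_mono r" and ae: "AE x in lebesgue_on \<Omega>. Cauchy (\<lambda>i. F (r i) x)"
    using cauchy_L1_AE_cauchy_subseq[of "lebesgue_on \<Omega>" F] int1 by blast
  define f where "f x = lim (\<lambda>i. F (r i) x)" for x
  have [measurable]: "f \<in> borel_measurable (lebesgue_on \<Omega>)"
    unfolding f_def by (rule borel_measurable_lim_metric) measurable
  have conv: "AE x in lebesgue_on \<Omega>. (\<lambda>i. F (r i) x) \<longlonglongrightarrow> f x"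
    using ae by eventually_elim (auto simp: f_def Cauchy_convergent_iff convergent_LIMSEQ_iff)
  have fatou: "integrable (lebesgue_on \<Omega>) (\<lambda>x. norm (F n x - f x) powr p) \<and> Lint \<Omega> p (\<lambda>x. F n x - f x) \<le> e"
    if N: "\<And>m n. m \<ge> N \<Longrightarrow> n \<ge> N \<Longrightarrow> Lint \<Omega> p (\<lambda>x. F m x - F n x) < e" "n \<ge> N" "0 < e" for n N e
  proof -
    have "AE x in lebesgue_on \<Omega>. (\<lambda>i. norm (F n x - F (r i) x) powr p) \<longlonglongrightarrow> norm (F n x - f x) powr p"
      using conv by eventually_elim (use p in \<open>auto intro!: tendsto_intros tendsto_powr2 always_eventually\<close>)
    then have "AE x in lebesgue_on \<Omega>. ennreal (norm (F n x - f x) powr p)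
        \<le> liminf (\<lambda>i. ennreal (norm (F n x - F (r i) x) powr p))"
    proof eventually_elim
      case (elim x)
      have "(\<lambda>i. ennreal (norm (F n x - F (r i) x) powr p)) \<longlonglongrightarrow> ennreal (norm (F n x - f x) powr p)"
        using elim by (intro tendsto_ennrealI)
      then show ?case using lim_imp_Liminf[OF sequentially_bot] by fastforce
    qed
    then have "(\<integral>\<^sup>+x. ennreal (norm (F n x - f x) powr p) \<partial>lebesgue_on \<Omega>)
      \<le> (\<integral>\<^sup>+x. liminf (\<lambda>i. ennreal (norm (F n x - F (r i) x) powr p)) \<partial>lebesgue_on \<Omega>)"
      by (rule nn_integral_mono_AE)
    also have "\<dots> \<le> liminf (\<lambda>i. \<integral>\<^sup>+x. ennreal (norm (F n x - F (r i) x) powr p) \<partial>lebesgue_on \<Omega>)"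
      by (rule nn_integral_liminf) measurable
    also have "\<dots> \<le> ennreal e"
    proof (rule Liminf_le)
      show "\<forall>\<^sub>F i in sequentially. (\<integral>\<^sup>+x. ennreal (norm (F n x - F (r i) x) powr p) \<partial>lebesgue_on \<Omega>) \<le> ennreal e"
      proof (intro eventually_sequentiallyI)
        fix i assume "N \<le> i"
        then have "N \<le> r i" using seq_suble[OF r, of i] by linarith
        have "(\<integral>\<^sup>+x. ennreal (norm (F n x - F (r i) x) powr p) \<partial>lebesgue_on \<Omega>) = ennreal (Lint \<Omega> p (\<lambda>x. F n x - F (r i) x))"
          using D[of n "r i"] by (intro nn_integral_eq_integral) (auto simp: Lp_iff)
        then show "(\<integral>\<^sup>+x. ennreal (norm (F n x - F (r i) x) powr p) \<partial>lebesgue_on \<Omega>) \<le> ennreal e"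
          using N(1)[OF \<open>n \<ge> N\<close> \<open>N \<le> r i\<close>] \<open>0 < e\<close> by (auto intro!: ennreal_leI)
      qed
    qed auto
    finally have le: "(\<integral>\<^sup>+x. ennreal (norm (F n x - f x) powr p) \<partial>lebesgue_on \<Omega>) \<le> ennreal e" .
    have int: "integrable (lebesgue_on \<Omega>) (\<lambda>x. norm (F n x - f x) powr p)"
      by (rule integrableI_bounded) (use le in \<open>auto simp: le_less_trans\<close>)
    with le have "ennreal (Lint \<Omega> p (\<lambda>x. F n x - f x)) \<le> ennreal e"
      by (subst (asm) nn_integral_eq_integral) auto
    with int \<open>0 < e\<close> show ?thesis by simp
  qed
  obtain N1 where N1: "\<And>m n. m \<ge> N1 \<Longrightarrow> n \<ge> N1 \<Longrightarrow> Lint \<Omega> p (\<lambda>x. F m x - F n x) < 1"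
    using cauchy[of 1] by auto
  have "(\<lambda>x. F N1 x - f x) \<in> Lp \<Omega> (ereal p)"
    using fatou[OF N1, of N1] by (simp add: Lp_iff)
  from Lp_diff[OF F[of N1] this] have f: "f \<in> Lp \<Omega> (ereal p)" using p by simp
  have "(\<lambda>n. Lint \<Omega> p (\<lambda>x. F n x - f x)) \<longlonglongrightarrow> 0"
  proof (rule LIMSEQ_I)
    fix e :: real assume e: "0 < e"
    obtain N where N: "\<And>m n. m \<ge> N \<Longrightarrow> n \<ge> N \<Longrightarrow> Lint \<Omega> p (\<lambda>x. F m x - F n x) < e / 2"
      using cauchy[of "e / 2"] e by auto
    have "Lint \<Omega> p (\<lambda>x. F n x - f x) \<le> e / 2" if "n \<ge> N" for n
      using fatou[OF N that] e by simp
    then show "\<exists>no. \<forall>n\<ge>no. norm (Lint \<Omega> p (\<lambda>x. F n x - f x) - 0) < e"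
      using e by (intro exI[of _ N]) fastforce
  qed
  with F f p that[of f] show ?thesis by (auto simp: Lp_tendsto_iff)
qed

text \<open>
  Young's inequality for the functions divided by their norms; if one norm vanishes, so does the product.
\<close>

lemma Holder_inequality:
  fixes f g :: "'a \<Rightarrow> real"
  assumes pq: "1 < p" "1 < q" "1 / p + 1 / q = 1"
    and [measurable]: "f \<in> borel_measurable M" "g \<in> borel_measurable M"
    and f: "integrable M (\<lambda>x. \<bar>f x\<bar> powr p)" and g: "integrable M (\<lambda>x. \<bar>g x\<bar> powr q)"
  shows "integrable M (\<lambda>x. f x * g x)"
    and "(\<integral>x. \<bar>f x * g x\<bar> \<partial>M) \<le> (\<integral>x. \<bar>f x\<bar> powr p \<partial>M) powr (1 / p) * (\<integral>x. \<bar>g x\<bar> powr q \<partial>M) powr (1 / q)"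
proof -
  have young: "\<bar>f x * g x\<bar> \<le> \<bar>f x\<bar> powr p / p + \<bar>g x\<bar> powr q / q" for x
    using Youngs_inequality[OF pq, of "\<bar>f x\<bar>" "\<bar>g x\<bar>"] by (simp add: abs_mult)
  show int: "integrable M (\<lambda>x. f x * g x)"
    by (rule Bochner_Integration.integrable_bound[where f="\<lambda>x. \<bar>f x\<bar> powr p / p + \<bar>g x\<bar> powr q / q"])
       (use f g young in \<open>auto intro!: AE_I2 order.trans[OF young]\<close>)
  let ?A = "\<integral>x. \<bar>f x\<bar> powr p \<partial>M" and ?B = "\<integral>x. \<bar>g x\<bar> powr q \<partial>M"
  have nn: "0 \<le> ?A" "0 \<le> ?B" by auto
  show "(\<integral>x. \<bar>f x * g x\<bar> \<partial>M) \<le> ?A powr (1 / p) * ?B powr (1 / q)"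
  proof (cases "?A = 0 \<or> ?B = 0")
    case True
    then have "AE x in M. f x * g x = 0"
    proof
      assume "?A = 0"
      then have "AE x in M. \<bar>f x\<bar> powr p = 0" using f by (subst (asm) integral_nonneg_eq_0_iff_AE) auto
      then show ?thesis by eventually_elim auto
    next
      assume "?B = 0"
      then have "AE x in M. \<bar>g x\<bar> powr q = 0" using g by (subst (asm) integral_nonneg_eq_0_iff_AE) auto
      then show ?thesis by eventually_elim auto
    qed
    then have "(\<integral>x. \<bar>f x * g x\<bar> \<partial>M) = (\<integral>x. 0 \<partial>M)"
      by (intro integral_cong_AE) auto
    then show ?thesis by simp
  next
    case False
    with nn have pos: "0 < ?A" "0 < ?B" by linarith+
    define a where "a = ?A powr (1 / p)"
    define b where "b = ?B powr (1 / q)"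
    have ab: "0 < a" "0 < b" using pos by (auto simp: a_def b_def)
    have apow: "a powr p = ?A" "b powr q = ?B" using pos pq by (auto simp: a_def b_def powr_powr)
    have "\<bar>f x * g x\<bar> \<le> a * b * (\<bar>f x\<bar> powr p / ?A / p + \<bar>g x\<bar> powr q / ?B / q)" for x
    proof -
      have "(\<bar>f x\<bar> / a) * (\<bar>g x\<bar> / b) \<le> (\<bar>f x\<bar> / a) powr p / p + (\<bar>g x\<bar> / b) powr q / q"
        using ab by (intro Youngs_inequality[OF pq]) auto
      also have "\<dots> = \<bar>f x\<bar> powr p / ?A / p + \<bar>g x\<bar> powr q / ?B / q"
        using ab by (simp add: powr_divide apow)
      finally show ?thesis using ab by (simp add: field_simps abs_mult)
    qed
    then have "(\<integral>x. \<bar>f x * g x\<bar> \<partial>M) \<le> (\<integral>x. a * b * (\<bar>f x\<bar> powr p / ?A / p + \<bar>g x\<bar> powr q / ?B / q) \<partial>M)"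
      using f g by (intro integral_mono integrable_abs int) auto
    also have "\<dots> = a * b * (?A / ?A / p + ?B / ?B / q)"
      using f g by simp
    also have "\<dots> = a * b" using pos pq by simp
    finally show ?thesis by (simp add: a_def b_def)
  qed
qed

section \<open>Smooth functions\<close>

abbreviation partial :: "(real^'n \<Rightarrow> real) \<Rightarrow> 'n \<Rightarrow> real^'n \<Rightarrow> real" where
  "partial f k x \<equiv> frechet_derivative f (at x) (axis k 1)"

lemma Ck_on_Suc_imp: "Ck_on (Suc n) UNIV f \<Longrightarrow> Ck_on n UNIV f"
proof (induction n arbitrary: f)
  case 0
  then show ?case
    by (auto intro!: differentiable_imp_continuous_on simp: differentiable_on_def)
qed auto

lemma Ck_on_const: "Ck_on n UNIV (\<lambda>x. c)"
  by (induction n arbitrary: c) auto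

lemma frechet_derivative_worksI:
  "f differentiable F \<Longrightarrow> (f has_derivative frechet_derivative f F) F"
  by (simp flip: frechet_derivative_works)

lemma partial_add:
  "f differentiable (at x) \<Longrightarrow> g differentiable (at x) \<Longrightarrow> partial (\<lambda>x. f x + g x) k x = partial f k x + partial g k x"
  using fun_cong[OF frechet_derivative_at[OF has_derivative_add[OF
      frechet_derivative_worksI[of f "at x"] frechet_derivative_worksI[of g "at x"]]], of "axis k 1"] by simp

lemma partial_mult:
  "f differentiable (at x) \<Longrightarrow> g differentiable (at x) \<Longrightarrow>
     partial (\<lambda>x. f x * g x) k x = f x * partial g k x + partial f k x * g x"
  using fun_cong[OF frechet_derivative_at[OF has_derivative_mult[OF
      frechet_derivative_worksI[of f "at x"] frechet_derivative_worksI[of g "at x"]]], of "axis k 1"] by simp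

lemma Ck_on_add: "Ck_on n UNIV f \<Longrightarrow> Ck_on n UNIV g \<Longrightarrow> Ck_on n UNIV (\<lambda>x. f x + g x)"
proof (induction n arbitrary: f g)
  case (Suc n)
  have "partial (\<lambda>x. f x + g x) k = (\<lambda>x. partial f k x + partial g k x)" for k
    using Suc.prems by (auto simp: fun_eq_iff partial_add)
  then show ?case
    using Suc.prems Suc.IH by (auto intro: differentiable_add)
qed (auto intro: continuous_on_add)

lemma Ck_on_mult: "Ck_on n UNIV f \<Longrightarrow> Ck_on n UNIV g \<Longrightarrow> Ck_on n UNIV (\<lambda>x. f x * g x)"
proof (induction n arbitrary: f g)
  case (Suc n)
  have "partial (\<lambda>x. f x * g x) k = (\<lambda>x. f x * partial g k x + partial f k x * g x)" for k
    using Suc.prems by (auto simp: fun_eq_iff partial_mult)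
  then show ?case
    using Suc.prems Ck_on_Suc_imp[OF Suc.prems(1)] Ck_on_Suc_imp[OF Suc.prems(2)]
    by (simp add: differentiable_mult Ck_on_add Suc.IH)
qed (auto intro: continuous_on_mult)

lemma Ck_on_power: "Ck_on n UNIV f \<Longrightarrow> Ck_on n UNIV (\<lambda>x. f x ^ i)"
  by (induction i) (simp_all add: Ck_on_mult Ck_on_const)

lemma Ck_on_sum: "finite I \<Longrightarrow> (\<And>i. i \<in> I \<Longrightarrow> Ck_on n UNIV (f i)) \<Longrightarrow> Ck_on n UNIV (\<lambda>x. \<Sum>i\<in>I. f i x)"
  by (induction I rule: finite_induct) (simp_all add: Ck_on_add Ck_on_const)

section \<open>Test functions\<close>

lemma test_functionI:
  assumes "\<And>n. Ck_on n UNIV \<phi>" "compact K" "K \<subseteq> \<Omega>" "\<And>x. x \<notin> K \<Longrightarrow> \<phi> x = 0"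
  shows "\<phi> \<in> test_functions \<Omega>"
proof -
  have "closure {x. \<phi> x \<noteq> 0} \<subseteq> K"
    using assms by (intro closure_minimal) (auto intro: compact_imp_closed)
  then show ?thesis
    using assms compact_Int_closed[OF assms(2) closed_closure, of "{x. \<phi> x \<noteq> 0}"]
    by (auto simp: test_functions_def Int_absorb1)
qed

lemma test_function_smooth:
  assumes "\<phi> \<in> test_functions \<Omega>"
  shows "Ck_on n UNIV \<phi>" "\<phi> differentiable (at x)" "continuous_on UNIV \<phi>" "continuous_on UNIV (partial \<phi> k)"
proof -
  show *: "Ck_on n UNIV \<phi>" for n using assms by (simp add: test_functions_def)
  from *[of "Suc 0"] *[of 0] show "\<phi> differentiable (at x)" "continuous_on UNIV \<phi>" "continuous_on UNIV (partial \<phi> k)" by simp_all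
qed

lemma test_function_support:
  assumes "\<phi> \<in> test_functions \<Omega>"
  shows "\<exists>K. compact K \<and> K \<subseteq> \<Omega> \<and> (\<forall>x. x \<notin> K \<longrightarrow> \<phi> x = 0) \<and> (\<forall>x k. x \<notin> K \<longrightarrow> partial \<phi> k x = 0)"
proof (intro exI conjI allI impI)
  let ?K = "closure {x. \<phi> x \<noteq> 0}"
  show "compact ?K" "?K \<subseteq> \<Omega>" using assms by (auto simp: test_functions_def)
  show 0: "\<phi> x = 0" if "x \<notin> ?K" for x using that closure_subset[of "{x. \<phi> x \<noteq> 0}"] by blast
  have "\<phi> differentiable (at x)" for x
    by (rule test_function_smooth(2)[OF assms])
  note d = this
  fix x k assume x: "x \<notin> ?K"
  have "frechet_derivative \<phi> (at x) = frechet_derivative (\<lambda>_. 0) (at x)"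
  proof (rule frechet_derivative_transform_within_open)
    show "x \<in> - ?K" using x by blast
    show "\<phi> y = 0" if "y \<in> - ?K" for y by (rule 0) (use that in blast)
  qed (rule d, rule open_Compl, rule closed_closure)
  then show "partial \<phi> k x = 0" by simp
qed

lemma test_functions_add:
  assumes "\<phi> \<in> test_functions \<Omega>" "\<psi> \<in> test_functions \<Omega>"
  shows "(\<lambda>x. \<phi> x + \<psi> x) \<in> test_functions \<Omega>"
proof -
  obtain K where K: "compact K" "K \<subseteq> \<Omega>" "\<And>x. x \<notin> K \<Longrightarrow> \<phi> x = 0"
      "\<And>x k. x \<notin> K \<Longrightarrow> partial \<phi> k x = 0" using test_function_support[OF assms(1)] by blast
  obtain L where L: "compact L" "L \<subseteq> \<Omega>" "\<And>x. x \<notin> L \<Longrightarrow> \<psi> x = 0"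
      "\<And>x k. x \<notin> L \<Longrightarrow> partial \<psi> k x = 0" using test_function_support[OF assms(2)] by blast
  show ?thesis
  proof (rule test_functionI[of _ "K \<union> L"])
    show "Ck_on n UNIV (\<lambda>x. \<phi> x + \<psi> x)" for n
      by (intro Ck_on_add test_function_smooth(1)[OF assms(1)] test_function_smooth(1)[OF assms(2)])
    show "\<phi> x + \<psi> x = 0" if "x \<notin> K \<union> L" for x
      using that K(3)[of x] L(3)[of x] by simp
  qed (simp_all add: K(1,2) L(1,2) compact_Un)
qed

lemma test_functions_mult:
  assumes "\<phi> \<in> test_functions \<Omega>" "\<And>n. Ck_on n UNIV \<psi>"
  shows "(\<lambda>x. \<phi> x * \<psi> x) \<in> test_functions \<Omega>"
proof -
  obtain K where K: "compact K" "K \<subseteq> \<Omega>" "\<And>x. x \<notin> K \<Longrightarrow> \<phi> x = 0"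
      "\<And>x k. x \<notin> K \<Longrightarrow> partial \<phi> k x = 0" using test_function_support[OF assms(1)] by blast
  show ?thesis
  proof (rule test_functionI[of _ K])
    show "Ck_on n UNIV (\<lambda>x. \<phi> x * \<psi> x)" for n
      by (intro Ck_on_mult test_function_smooth(1)[OF assms(1)] assms(2))
  qed (simp_all add: K(1,2,3))
qed

lemma test_functions_scale: "\<phi> \<in> test_functions \<Omega> \<Longrightarrow> (\<lambda>x. c * \<phi> x) \<in> test_functions \<Omega>"
  unfolding mult.commute[of c] by (rule test_functions_mult) (auto intro: Ck_on_const)

text \<open>
  The primitive is displayed as \<open>t * R t\<close> because its composition with a test function is then a
  test function times a smooth function, hence again a test function.
\<close>

lemma polynomial_primitive:
  assumes "real_polynomial_function (p :: real \<Rightarrow> real)"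
  obtains R where "real_polynomial_function R" "\<And>t. ((\<lambda>t. t * R t) has_real_derivative p t) (at t)"
proof -
  obtain a n where p: "p = (\<lambda>t. \<Sum>i\<le>n. a i * t ^ i)"
    using assms by (auto simp: real_polynomial_function_iff_sum)
  define R where "R t = (\<Sum>i\<le>n. (a i / Suc i) * t ^ i)" for t
  show ?thesis
  proof
    show "real_polynomial_function R"
      unfolding real_polynomial_function_iff_sum R_def fun_eq_iff by (intro exI[of _ "\<lambda>i. a i / Suc i"] exI[of _ n]) auto
    have "(\<lambda>t. t * R t) = (\<lambda>t. \<Sum>i\<le>n. (a i / Suc i) * t ^ Suc i)"
      by (simp add: R_def sum_distrib_left mult_ac fun_eq_iff)
    moreover have "((\<lambda>t. \<Sum>i\<le>n. (a i / Suc i) * t ^ Suc i) has_real_derivative (\<Sum>i\<le>n. (a i / Suc i) * (real (Suc i) * t ^ i))) (at t)" for t :: real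
      by (intro DERIV_sum DERIV_cmult) (auto intro!: derivative_eq_intros simp del: power_Suc)
    ultimately show "((\<lambda>t. t * R t) has_real_derivative p t) (at t)" for t by (simp add: p del: power_Suc of_nat_Suc)
  qed
qed

lemma test_functions_polynomial:
  assumes "\<phi> \<in> test_functions \<Omega>" "real_polynomial_function (R :: real \<Rightarrow> real)"
  shows "(\<lambda>x. \<phi> x * R (\<phi> x)) \<in> test_functions \<Omega>"
proof -
  obtain a n where R: "R = (\<lambda>t. \<Sum>i\<le>n. a i * t ^ i)"
    using assms by (auto simp: real_polynomial_function_iff_sum)
  show ?thesis
  proof (rule test_functions_mult[OF assms(1)])
    fix m
    have "Ck_on m UNIV (\<lambda>x. a i * \<phi> x ^ i)" for i
      using Ck_on_mult[OF Ck_on_const[of m "a i"] Ck_on_power[OF test_function_smooth(1)[OF assms(1)], of m i]] .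
    then show "Ck_on m UNIV (\<lambda>x. R (\<phi> x))"
      unfolding R by (rule Ck_on_sum[OF finite_atMost])
  qed
qed

section \<open>The classical gradient\<close>

lemma classical_Xgrad_add:
  assumes "f differentiable (at x)" "g differentiable (at x)"
  shows "classical_Xgrad X (\<lambda>x. f x + g x) x = classical_Xgrad X f x + classical_Xgrad X g x"
  by (simp add: classical_Xgrad_def vec_eq_iff partial_add[OF assms] sum.distrib algebra_simps)

lemma classical_Xgrad_chain:
  assumes f: "f differentiable (at x)" and H: "(H has_real_derivative h) (at (f x))"
  shows "classical_Xgrad X (\<lambda>x. H (f x)) x = h *\<^sub>R classical_Xgrad X f x"
proof -
  have *: "((\<lambda>x. H (f x)) has_derivative (\<lambda>v. h * frechet_derivative f (at x) v)) (at x)"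
    using has_derivative_compose[OF frechet_derivative_worksI[OF f]] H
    by (auto simp: has_field_derivative_def)
  have "partial (\<lambda>x. H (f x)) k x = h * partial f k x" for k
    using fun_cong[OF frechet_derivative_at[OF *], of "axis k 1"] by simp
  then show ?thesis
    by (simp add: classical_Xgrad_def vec_eq_iff sum_distrib_left mult_ac)
qed

lemma classical_Xgrad_scale:
  assumes "f differentiable (at x)"
  shows "classical_Xgrad X (\<lambda>x. c * f x) x = c *\<^sub>R classical_Xgrad X f x"
  by (rule classical_Xgrad_chain[OF assms]) (auto intro!: derivative_eq_intros)

lemma locally_Lipschitz_field_continuous:
  assumes "locally_Lipschitz_field Y" shows "continuous_on UNIV Y"
proof (intro continuous_at_imp_continuous_on ballI)
  fix x
  obtain r L where r: "r > 0" "L-lipschitz_on (ball x r) Y"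
    using assms unfolding locally_Lipschitz_field_def by blast
  then have "continuous_on (ball x r) Y" by (auto intro: lipschitz_on_continuous_on)
  then show "isCont Y x" using r by (simp add: continuous_on_eq_continuous_at)
qed

lemma locally_Lipschitz_field_compact:
  fixes Y :: "real^'n \<Rightarrow> real^'n"
  assumes Y: "locally_Lipschitz_field Y" and K: "compact K"
  obtains L where "L-lipschitz_on K Y"
proof -
  have "local_lipschitz {0::real} K (\<lambda>_. Y)"
    unfolding local_lipschitz_def
  proof (intro ballI)
    fix x and t :: real
    obtain r L where r: "r > 0" "L-lipschitz_on (ball x r) Y"
      using Y unfolding locally_Lipschitz_field_def by blast
    then have "L-lipschitz_on (cball x (r / 2) \<inter> K) Y"
      by (rule_tac lipschitz_on_subset[OF r(2)]) auto
    then show "\<exists>u>0. \<exists>L. \<forall>t\<in>cball t u \<inter> {0}. L-lipschitz_on (cball x u \<inter> K) Y"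
      using r by (intro exI[of _ "r / 2"]) auto
  qed
  then show ?thesis
    using local_lipschitz_compact_implies_lipschitz[where X=K and T="{0::real}" and f="\<lambda>_. Y"] K that by auto
qed

section \<open>Uniqueness of the gradient\<close>

lemma lborel_integral_shift:
  fixes f :: "'a::euclidean_space \<Rightarrow> real"
  assumes "f \<in> borel_measurable borel"
  shows "(\<integral>x. f (c + x) \<partial>lborel) = (\<integral>x. f x \<partial>lborel)"
  using integral_distr[of "(+) c" lborel borel f] assms by (simp add: lborel_distr_plus)

lemma integrable_lborel_compact_support:
  fixes f :: "'a::euclidean_space \<Rightarrow> real"
  assumes f: "continuous_on UNIV f" and K: "compact K" "\<And>x. x \<notin> K \<Longrightarrow> f x = 0"
  shows "integrable lborel f"
proof -
  have "integrable lborel (\<lambda>x. indicator K x *\<^sub>R f x)"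
    using borel_integrable_compact[OF K(1) continuous_on_subset[OF f]] by auto
  moreover have "(\<lambda>x. indicator K x *\<^sub>R f x) = f" using K(2) by (auto simp: fun_eq_iff indicator_def)
  ultimately show ?thesis by simp
qed

text \<open>
  Integration by parts against a Lipschitz function, without differentiating it: the difference
  quotient is moved from the test function to \<open>b\<close>, where it is bounded by the Lipschitz constant.
\<close>

lemma integral_partial_le:
  fixes \<phi> b :: "real^'n \<Rightarrow> real"
  assumes \<phi>: "\<phi> \<in> test_functions \<Omega>" and \<Omega>: "\<Omega> \<subseteq> cball 0 R"
    and b: "continuous_on UNIV b" "L-lipschitz_on (cball 0 (R + 1)) b"
  shows "\<bar>\<integral>x. b x * partial \<phi> k x \<partial>lborel\<bar> \<le> L * (\<integral>x. \<bar>\<phi> x\<bar> \<partial>lborel)"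
proof -
  obtain K where K: "compact K" "K \<subseteq> \<Omega>" "\<And>x. x \<notin> K \<Longrightarrow> \<phi> x = 0" "\<And>x k. x \<notin> K \<Longrightarrow> partial \<phi> k x = 0"
    using test_function_support[OF \<phi>] by blast
  note sm = test_function_smooth[OF \<phi>]
  have [measurable]: "\<phi> \<in> borel_measurable borel" "b \<in> borel_measurable borel" "partial \<phi> k \<in> borel_measurable borel"
    using sm(3,4) b(1) by (auto intro: borel_measurable_continuous_onI)
  let ?e = "axis k 1 :: real^'n"
  define h where "h n = 1 / real (Suc n)" for n
  have h: "0 < h n" "h n \<le> 1" for n by (auto simp: h_def)
  have h0: "h \<longlonglongrightarrow> 0" unfolding h_def by (rule LIMSEQ_Suc[OF lim_1_over_n])
  define D where "D n x = (\<phi> (x + h n *\<^sub>R ?e) - \<phi> x) / h n" for n x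
  have deriv: "((\<lambda>t. \<phi> (x + t *\<^sub>R ?e)) has_real_derivative partial \<phi> k (x + t *\<^sub>R ?e)) (at t)" for x t
  proof -
    have "((\<lambda>t. \<phi> (x + t *\<^sub>R ?e)) has_derivative (\<lambda>s. frechet_derivative \<phi> (at (x + t *\<^sub>R ?e)) (s *\<^sub>R ?e))) (at t)"
      by (rule has_derivative_compose[OF _ frechet_derivative_worksI[OF sm(2)], of "\<lambda>t. x + t *\<^sub>R ?e"])
         (auto intro!: derivative_eq_intros)
    moreover have "frechet_derivative \<phi> (at y) (s *\<^sub>R ?e) = partial \<phi> k y * s" for y s
      using linear_scale[OF linear_frechet_derivative[OF sm(2)]] by (simp add: mult.commute)
    ultimately show ?thesis by (simp add: has_field_derivative_def)
  qed
  have lim: "(\<lambda>n. b x * D n x) \<longlonglongrightarrow> b x * partial \<phi> k x" for x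
  proof (intro tendsto_mult tendsto_const)
    have "((\<lambda>t. (\<phi> (x + t *\<^sub>R ?e) - \<phi> x) / t) \<longlongrightarrow> partial \<phi> k x) (at 0)"
      using deriv[of x 0] by (simp add: has_field_derivative_iff)
    moreover have "filterlim h (at 0) sequentially"
      using h0 less_imp_neq[OF h(1)] by (auto simp: filterlim_at intro!: always_eventually)
    ultimately show "(\<lambda>n. D n x) \<longlonglongrightarrow> partial \<phi> k x"
      unfolding D_def by (rule filterlim_compose)
  qed
  obtain B where B: "\<And>x. \<bar>partial \<phi> k x\<bar> \<le> B" "0 \<le> B"
  proof -
    have "bounded (partial \<phi> k ` K)"
      using K(1) sm(4) by (intro compact_imp_bounded compact_continuous_image continuous_on_subset[OF sm(4)]) auto
    then obtain B where "\<And>x. x \<in> K \<Longrightarrow> \<bar>partial \<phi> k x\<bar> \<le> B" by (auto simp: bounded_iff)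
    then have "\<bar>partial \<phi> k x\<bar> \<le> max B 0" for x
      by (cases "x \<in> K") (auto simp: K(4) le_max_iff_disj)
    then show ?thesis using that[of "max B 0"] by auto
  qed
  have Dle: "\<bar>D n x\<bar> \<le> B" for n x
  proof -
    obtain z where "\<phi> (x + h n *\<^sub>R ?e) - \<phi> (x + 0 *\<^sub>R ?e) = (h n - 0) * partial \<phi> k (x + z *\<^sub>R ?e)"
      using MVT2[of 0 "h n" "\<lambda>t. \<phi> (x + t *\<^sub>R ?e)" "\<lambda>t. partial \<phi> k (x + t *\<^sub>R ?e)"] deriv h by blast
    then have "D n x = partial \<phi> k (x + z *\<^sub>R ?e)" using h(1)[of n] by (simp add: D_def)
    then show ?thesis using B by simp
  qed
  have inR: "x \<in> cball 0 R" if "\<phi> x \<noteq> 0" for x using that K \<Omega> by blast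
  have shift: "norm (x + s *\<^sub>R ?e) \<le> norm x + \<bar>s\<bar>" for x and s :: real
    using norm_triangle_ineq[of x "s *\<^sub>R ?e"] by simp
  have D0: "D n x = 0" if "x \<notin> cball 0 (R + 1)" for n x
  proof -
    have "\<phi> x = 0" using inR[of x] that by auto
    moreover have "norm x \<le> norm (x + h n *\<^sub>R ?e) + h n"
      using shift[of "x + h n *\<^sub>R ?e" "- h n"] h[of n] by simp
    then have "\<phi> (x + h n *\<^sub>R ?e) = 0" using inR[of "x + h n *\<^sub>R ?e"] that h(2)[of n] unfolding mem_cball_0 by linarith
    ultimately show ?thesis by (simp add: D_def)
  qed
  have "bounded (b ` cball 0 (R + 1))"
    by (intro compact_imp_bounded compact_continuous_image continuous_on_subset[OF b(1)]) auto
  then obtain M where M: "\<And>x. x \<in> cball 0 (R + 1) \<Longrightarrow> \<bar>b x\<bar> \<le> M"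
    unfolding bounded_iff by fastforce
  have conv: "(\<lambda>n. \<integral>x. b x * D n x \<partial>lborel) \<longlonglongrightarrow> (\<integral>x. b x * partial \<phi> k x \<partial>lborel)"
  proof (rule integral_dominated_convergence)
    show "integrable lborel (\<lambda>x::real^'n. indicator (cball 0 (R + 1)) x *\<^sub>R (M * B))"
      by (intro borel_integrable_compact) auto
    show "AE x in lborel. norm (b x * D n x) \<le> indicator (cball 0 (R + 1)) x *\<^sub>R (M * B)" for n
    proof (intro AE_I2)
      fix x show "norm (b x * D n x) \<le> indicator (cball 0 (R + 1)) x *\<^sub>R (M * B)"
      proof (cases "x \<in> cball 0 (R + 1)")
        case True
        then have "\<bar>b x\<bar> * \<bar>D n x\<bar> \<le> M * B"
          using M[OF True] Dle B by (intro mult_mono) (auto intro: order.trans[OF abs_ge_zero M[OF True]])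
        with True show ?thesis by (simp add: abs_mult)
      qed (use D0 in auto)
    qed
    show "(\<lambda>x. b x * D n x) \<in> borel_measurable lborel" for n unfolding D_def by measurable
  qed (use lim in auto)
  have int\<phi>: "integrable lborel \<phi>" using sm(3) K by (intro integrable_lborel_compact_support)
  have "\<bar>\<integral>x. b x * D n x \<partial>lborel\<bar> \<le> L * (\<integral>x. \<bar>\<phi> x\<bar> \<partial>lborel)" for n
  proof -
    let ?s = "h n *\<^sub>R ?e"
    define K' where "K' = (\<lambda>x. - ?s + x) ` K"
    have K': "compact K'" unfolding K'_def using K by (intro compact_translation)
    have K'0: "\<phi> (x + ?s) = 0" if "x \<notin> K'" for x
    proof (rule ccontr)
      assume "\<phi> (x + ?s) \<noteq> 0"
      then have "x + ?s \<in> K" using K by auto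
      then show False using that by (force simp: K'_def image_iff)
    qed
    have i1: "integrable lborel (\<lambda>x. b x * \<phi> (x + ?s))"
      by (rule integrable_lborel_compact_support[OF _ K'])
         (use K'0 in \<open>auto intro!: continuous_intros b continuous_on_compose2[OF sm(3)]\<close>)
    have i2: "integrable lborel (\<lambda>x. b x * \<phi> x)"
      by (rule integrable_lborel_compact_support[OF _ K(1)]) (use K in \<open>auto intro!: continuous_intros b sm(3)\<close>)
    have i3: "integrable lborel (\<lambda>x. b (x - ?s) * \<phi> x)"
      by (rule integrable_lborel_compact_support[OF _ K(1)])
         (use K in \<open>auto intro!: continuous_intros continuous_on_compose2[OF b(1)] sm(3)\<close>)
    have "(\<integral>x. b (x - ?s) * \<phi> x \<partial>lborel) = (\<integral>x. b (?s + x - ?s) * \<phi> (?s + x) \<partial>lborel)"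
      by (rule lborel_integral_shift[symmetric]) measurable
    then have sh: "(\<integral>x. b x * \<phi> (x + ?s) \<partial>lborel) = (\<integral>x. b (x - ?s) * \<phi> x \<partial>lborel)"
      by (simp add: add.commute)
    have "(\<integral>x. b x * D n x \<partial>lborel) = ((\<integral>x. b x * \<phi> (x + ?s) \<partial>lborel) - (\<integral>x. b x * \<phi> x \<partial>lborel)) / h n"
      unfolding D_def using i1 i2 by (simp add: right_diff_distrib)
    also have "\<dots> = (\<integral>x. (b (x - ?s) - b x) / h n * \<phi> x \<partial>lborel)"
      unfolding sh using i2 i3 by (simp add: left_diff_distrib diff_divide_distrib)
    also have "\<bar>\<dots>\<bar> \<le> (\<integral>x. L * \<bar>\<phi> x\<bar> \<partial>lborel)"
    proof (rule order.trans[OF integral_abs_bound integral_mono])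
      have "integrable lborel (\<lambda>x. (b (x - ?s) * \<phi> x - b x * \<phi> x) / h n)" using i2 i3 by auto
      then show "integrable lborel (\<lambda>x. \<bar>(b (x - ?s) - b x) / h n * \<phi> x\<bar>)"
        by (intro integrable_abs) (simp add: left_diff_distrib)
      show "\<bar>(b (x - ?s) - b x) / h n * \<phi> x\<bar> \<le> L * \<bar>\<phi> x\<bar>" for x
      proof (cases "\<phi> x = 0")
        case False
        then have "x \<in> cball 0 R" by (rule inR)
        then have "dist (b (x - ?s)) (b x) \<le> L * dist (x - ?s) x"
          using shift[of x "- h n"] h[of n] by (intro lipschitz_onD[OF b(2)]) auto
        then have "\<bar>b (x - ?s) - b x\<bar> / h n \<le> L" using h[of n] by (simp add: dist_norm field_simps)
        from mult_right_mono[OF this abs_ge_zero[of "\<phi> x"]] show ?thesis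
          using h(1)[of n] by (simp add: abs_mult)
      qed simp
    qed (use int\<phi> in auto)
    finally show ?thesis using int\<phi> by simp
  qed
  then show ?thesis
    by (intro LIMSEQ_le_const2[OF tendsto_rabs[OF conv]]) auto
qed

text \<open>
  Up to a null set, \<open>{f > 0}\<close> is an increasing union of closed sets, and so is \<open>{f < 0}\<close>; the integral
  of \<open>f\<close> over each of them is therefore zero.
\<close>

lemma AE_zero_if_closed_integrals_zero:
  fixes f :: "'a::euclidean_space \<Rightarrow> real"
  assumes \<Omega>: "\<Omega> \<in> sets lebesgue" and f: "integrable (lebesgue_on \<Omega>) f"
    and zero: "\<And>S. closed S \<Longrightarrow> (LINT x|lebesgue_on \<Omega>. indicator S x * f x) = 0"
  shows "AE x in lebesgue_on \<Omega>. f x = 0"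
proof -
  have half: "AE x in lebesgue_on \<Omega>. \<not> 0 < g x"
    if g: "integrable (lebesgue_on \<Omega>) g" and zg: "\<And>S. closed S \<Longrightarrow> (LINT x|lebesgue_on \<Omega>. indicator S x * g x) = 0" for g :: "'a \<Rightarrow> real"
  proof -
    note [measurable] = borel_measurable_integrable[OF g]
    have "{x \<in> space (lebesgue_on \<Omega>). 0 < g x} \<in> sets (lebesgue_on \<Omega>)" by measurable
    then have "{x \<in> \<Omega>. 0 < g x} \<in> sets lebesgue"
      using \<Omega> by (auto simp: sets_restrict_space_iff)
    then obtain C T where CT: "fsigma C" "T \<in> null_sets lebesgue" "C \<union> T = {x \<in> \<Omega>. 0 < g x}"
      using lebesgue_set_almost_fsigma by metis
    obtain F :: "nat \<Rightarrow> 'a set" where F: "range F \<subseteq> Collect compact" "C = \<Union>(range F)"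
      using CT(1) unfolding fsigma_Union_compact by blast
    define S where "S n = (\<Union>i<n. F i)" for n
    have S: "closed (S n)" for n
      unfolding S_def using F by (intro closed_UN) (auto intro: compact_imp_closed)
    have [measurable]: "C \<in> sets lebesgue" unfolding F(2)
      using F(1) by (intro sets.countable_UN) (use lmeasurable_compact in \<open>blast dest: fmeasurableD\<close>)
    have Sm: "S n \<in> sets lebesgue" for n using S[of n] by auto
    have restr: "(\<lambda>x. indicator A x * g x) \<in> borel_measurable (lebesgue_on \<Omega>)" if "A \<in> sets lebesgue" for A
    proof -
      have "indicator A \<in> borel_measurable lebesgue" using that by auto
      then show ?thesis
        by (intro borel_measurable_times borel_measurable_integrable[OF g]) (rule measurable_restrict_space1)
    qed
    have intA: "integrable (lebesgue_on \<Omega>) (\<lambda>x. indicator A x * g x)" if "A \<in> sets lebesgue" for A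
      by (rule Bochner_Integration.integrable_bound[OF g restr[OF that]]) (auto simp: indicator_def)
    have "(\<lambda>n. LINT x|lebesgue_on \<Omega>. indicator (S n) x * g x) \<longlonglongrightarrow> (LINT x|lebesgue_on \<Omega>. indicator C x * g x)"
    proof (rule integral_dominated_convergence[where w="\<lambda>x. \<bar>g x\<bar>"])
      have "(\<lambda>n. indicator (S n) x :: real) \<longlonglongrightarrow> indicator C x" for x
      proof (cases "x \<in> C")
        case True
        then obtain i where "x \<in> F i" using F by auto
        note xF = this
        have "x \<in> S n" if "n \<ge> Suc i" for n unfolding S_def
          by (rule UN_I[of i]) (use that xF in simp_all)
        then have "\<And>n. n \<ge> Suc i \<Longrightarrow> indicator (S n) x = (1::real)" by simp
        then show ?thesis using True by (intro tendsto_eventually) (auto simp: eventually_sequentially)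
      next
        case False
        then have "x \<notin> S n" for n unfolding S_def F(2) by blast
        with False show ?thesis by simp
      qed
      then show "AE x in lebesgue_on \<Omega>. (\<lambda>n. indicator (S n) x * g x) \<longlonglongrightarrow> indicator C x * g x"
        by (intro AE_I2 tendsto_mult tendsto_const)
      show "(\<lambda>x. indicator C x * g x) \<in> borel_measurable (lebesgue_on \<Omega>)" by (rule restr) simp
      show "(\<lambda>x. indicator (S n) x * g x) \<in> borel_measurable (lebesgue_on \<Omega>)" for n by (rule restr[OF Sm])
      show "integrable (lebesgue_on \<Omega>) (\<lambda>x. \<bar>g x\<bar>)" by (rule integrable_abs[OF g])
      show "AE x in lebesgue_on \<Omega>. norm (indicator (S n) x * g x) \<le> \<bar>g x\<bar>" for n
        by (intro AE_I2) (simp add: indicator_def)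
    qed
    then have "(LINT x|lebesgue_on \<Omega>. indicator C x * g x) = 0"
      by (simp add: zg[OF S] LIMSEQ_const_iff)
    moreover have "AE x in lebesgue_on \<Omega>. 0 \<le> indicator C x * g x"
    proof (intro AE_I2)
      fix x show "0 \<le> indicator C x * g x"
        using CT(3) by (cases "x \<in> C") (auto dest!: equalityD1)
    qed
    ultimately have "AE x in lebesgue_on \<Omega>. indicator C x * g x = 0"
      using intA[of C] by (subst (asm) integral_nonneg_eq_0_iff_AE) auto
    moreover have "AE x in lebesgue_on \<Omega>. x \<notin> T"
      using AE_not_in[OF CT(2)] \<Omega> by (auto simp: AE_restrict_space_iff)
    moreover have "AE x in lebesgue_on \<Omega>. x \<in> \<Omega>"
      using AE_space[of "lebesgue_on \<Omega>"] by simp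
    ultimately show ?thesis
    proof eventually_elim
      case (elim x)
      show ?case
      proof
        assume "0 < g x"
        then have "x \<in> C" using elim(2,3) CT(3) by blast
        with elim(1) \<open>0 < g x\<close> show False by simp
      qed
    qed
  qed
  have "AE x in lebesgue_on \<Omega>. \<not> 0 < f x" by (rule half[OF f zero])
  moreover have "AE x in lebesgue_on \<Omega>. \<not> 0 < - f x" using zero f by (intro half) auto
  ultimately show ?thesis by eventually_elim auto
qed

lemma integral_lebesgue_on_eq_lborel:
  fixes f :: "'a::euclidean_space \<Rightarrow> real"
  assumes "\<Omega> \<in> sets lebesgue" "continuous_on UNIV f" "\<And>x. x \<notin> \<Omega> \<Longrightarrow> f x = 0"
  shows "(LINT x|lebesgue_on \<Omega>. f x) = (\<integral>x. f x \<partial>lborel)"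
proof -
  have "(LINT x|lebesgue_on \<Omega>. f x) = (LINT x|lebesgue. indicator \<Omega> x *\<^sub>R f x)"
    using assms(1) by (simp add: integral_restrict_space)
  also have "(\<lambda>x. indicator \<Omega> x *\<^sub>R f x) = f" using assms(3) by (auto simp: fun_eq_iff indicator_def)
  also have "(LINT x|lebesgue. f x) = (\<integral>x. f x \<partial>lborel)"
    using assms(2) by (intro integral_completion) (auto intro: borel_measurable_continuous_onI)
  finally show ?thesis .
qed

lemma continuous_on_classical_Xgrad:
  assumes "\<forall>j. locally_Lipschitz_field (X j)" "\<phi> \<in> test_functions \<Omega>"
  shows "continuous_on UNIV (classical_Xgrad X \<phi>)"
  unfolding classical_Xgrad_def
  by (intro continuous_intros continuous_on_component locally_Lipschitz_field_continuous
      test_function_smooth(4)[OF assms(2)]) (use assms(1) in blast)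

lemma continuous_compact_support_in_Lp:
  fixes f :: "'a::euclidean_space \<Rightarrow> 'b::euclidean_space"
  assumes \<Omega>: "\<Omega> \<in> lmeasurable" and f: "continuous_on UNIV f" and K: "compact K" "\<And>x. x \<notin> K \<Longrightarrow> f x = 0" and p: "0 \<le> p"
  shows "f \<in> Lp \<Omega> (ereal p)"
proof -
  interpret finite_measure "lebesgue_on \<Omega>" using \<Omega> by (simp add: finite_measure_lebesgue_on)
  have [measurable]: "f \<in> borel_measurable (lebesgue_on \<Omega>)"
    by (intro continuous_imp_measurable_on_sets_lebesgue continuous_on_subset[OF f] fmeasurableD[OF \<Omega>]) auto
  have "bounded (f ` K)" by (intro compact_imp_bounded compact_continuous_image continuous_on_subset[OF f] K) auto
  then obtain B where B: "\<And>x. x \<in> K \<Longrightarrow> norm (f x) \<le> B" unfolding bounded_iff by blast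
  have le: "norm (f x) \<le> max B 0" for x
    using B[of x] K(2)[of x] by (cases "x \<in> K") auto
  have "integrable (lebesgue_on \<Omega>) (\<lambda>x. norm (f x) powr p)"
    by (rule integrable_const_bound[where B="max B 0 powr p"]) (auto intro!: AE_I2 powr_mono2 p le)
  then show ?thesis by (simp add: Lp_iff)
qed

lemma test_function_in_Lp:
  assumes "\<Omega> \<in> lmeasurable" "\<forall>j. locally_Lipschitz_field (X j)" "\<phi> \<in> test_functions \<Omega>" "0 \<le> p"
  shows "\<phi> \<in> Lp \<Omega> (ereal p)" "classical_Xgrad X \<phi> \<in> Lp \<Omega> (ereal p)"
proof -
  obtain K where K: "compact K" "K \<subseteq> \<Omega>" "\<And>x. x \<notin> K \<Longrightarrow> \<phi> x = 0" "\<And>x k. x \<notin> K \<Longrightarrow> partial \<phi> k x = 0"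
    using test_function_support[OF assms(3)] by blast
  show "\<phi> \<in> Lp \<Omega> (ereal p)"
    by (rule continuous_compact_support_in_Lp[OF assms(1) test_function_smooth(3)[OF assms(3)] K(1) K(3) assms(4)])
  have "classical_Xgrad X \<phi> x = 0" if "x \<notin> K" for x
    using K(4)[OF that] by (simp add: classical_Xgrad_def vec_eq_iff)
  then show "classical_Xgrad X \<phi> \<in> Lp \<Omega> (ereal p)"
    by (rule continuous_compact_support_in_Lp[OF assms(1) continuous_on_classical_Xgrad[OF assms(2,3)] K(1) _ assms(4)])
qed

lemma lipschitz_on_mult_bounded:
  fixes f g :: "'a::metric_space \<Rightarrow> real"
  assumes "L-lipschitz_on S f" "M-lipschitz_on S g" "\<And>x. x \<in> S \<Longrightarrow> \<bar>f x\<bar> \<le> B" "\<And>x. x \<in> S \<Longrightarrow> \<bar>g x\<bar> \<le> C" "0 \<le> B" "0 \<le> C"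
  shows "(B * M + C * L)-lipschitz_on S (\<lambda>x. f x * g x)"
proof (rule lipschitz_onI)
  fix x y assume xy: "x \<in> S" "y \<in> S"
  have "f x * g x - f y * g y = f x * (g x - g y) + g y * (f x - f y)" by (simp add: algebra_simps)
  then have "dist (f x * g x) (f y * g y) \<le> \<bar>f x\<bar> * \<bar>g x - g y\<bar> + \<bar>g y\<bar> * \<bar>f x - f y\<bar>"
    unfolding dist_real_def by (simp flip: abs_mult)
  also have "\<dots> \<le> B * (M * dist x y) + C * (L * dist x y)"
    using lipschitz_onD[OF assms(1) xy] lipschitz_onD[OF assms(2) xy] assms(3)[OF xy(1)] assms(4)[OF xy(2)] assms(5,6)
    by (intro add_mono mult_mono) (auto simp: dist_real_def)
  finally show "dist (f x * g x) (f y * g y) \<le> (B * M + C * L) * dist x y" by (simp add: algebra_simps)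
next
  show "0 \<le> B * M + C * L"
    using assms(5,6) lipschitz_on_nonneg[OF assms(1)] lipschitz_on_nonneg[OF assms(2)] by simp
qed

lemma integrable_vec_nth:
  fixes f :: "'a \<Rightarrow> real^'n"
  assumes "integrable M f"
  shows "integrable M (\<lambda>x. f x $ j)"
proof -
  have "integrable M (\<lambda>x. f x \<bullet> axis j 1)" using assms by (intro integrable_inner_left)
  then show ?thesis by (simp add: inner_axis)
qed

text \<open>
  The \<open>X\<close>-gradient is closable in \<open>L\<^sup>1\<close>. Tested with a Lipschitz function \<open>\<psi>\<close>, the gradients of
  \<open>\<phi> n\<close> are bounded by a multiple of \<open>\<parallel>\<phi> n\<parallel>\<^sub>1\<close>, which tends to zero, because the product of \<open>\<psi>\<close> with a
  coefficient is Lipschitz on bounded sets. So the limit \<open>G\<close> is orthogonal to every such \<open>\<psi>\<close>, and these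
  functions decrease to the indicators of closed sets.
\<close>

theorem gradient_limit_zero:
  fixes X :: "'m::finite \<Rightarrow> real^'n \<Rightarrow> real^'n" and \<Omega> :: "(real^'n) set"
  assumes "open \<Omega>" "bounded \<Omega>" and X: "\<forall>j. locally_Lipschitz_field (X j)"
    and \<phi>: "\<And>n. \<phi> n \<in> test_functions \<Omega>"
    and lim0: "Lp_tendsto \<Omega> (ereal 1) \<phi> (\<lambda>_. 0)"
    and limG: "Lp_tendsto \<Omega> (ereal 1) (\<lambda>n. classical_Xgrad X (\<phi> n)) G"
  shows "AE x in lebesgue_on \<Omega>. G x = 0"
proof -
  have \<Omega>: "\<Omega> \<in> lmeasurable" using assms(1,2) by (rule_tac bounded_set_imp_lmeasurable) auto
  then have \<Omega>': "\<Omega> \<in> sets lebesgue" by auto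
  obtain R where R: "\<Omega> \<subseteq> cball 0 R" using bounded_subset_ballD[OF assms(2), of 0] ball_subset_cball by blast
  let ?B = "cball 0 (R + 1) :: (real^'n) set"
  have Lp1: "f \<in> Lp \<Omega> (ereal 1) \<Longrightarrow> integrable (lebesgue_on \<Omega>) f" for f :: "real^'n \<Rightarrow> 'b::euclidean_space"
    by (subst integrable_norm_iff[symmetric]) (auto simp: Lp_iff)
  have GL: "G \<in> Lp \<Omega> (ereal 1)" using limG by (simp add: Lp_tendsto_def)
  have intG: "integrable (lebesgue_on \<Omega>) (\<lambda>x. G x $ j)" for j
    by (rule integrable_vec_nth[OF Lp1[OF GL]])
  have "AE x in lebesgue_on \<Omega>. G x $ j = 0" for j
  proof (rule AE_zero_if_closed_integrals_zero[OF \<Omega>' intG])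
    fix S :: "(real^'n) set" assume S: "closed S"
    show "(LINT x|lebesgue_on \<Omega>. indicator S x * G x $ j) = 0"
    proof (cases "S = {}")
      case False
      define \<psi> where "\<psi> m x = max 0 (1 - real m * infdist x S)" for m x
      have \<psi>01: "0 \<le> \<psi> m x" "\<psi> m x \<le> 1" for m x by (auto simp: \<psi>_def infdist_nonneg)
      have \<psi>L: "(real m)-lipschitz_on ?B (\<psi> m)" for m
      proof (rule lipschitz_onI)
        fix x y
        have "\<bar>\<psi> m x - \<psi> m y\<bar> \<le> \<bar>real m * infdist x S - real m * infdist y S\<bar>" by (auto simp: \<psi>_def)
        also have "\<dots> = real m * \<bar>infdist x S - infdist y S\<bar>" by (simp add: abs_mult flip: right_diff_distrib)
        also have "\<dots> \<le> real m * dist x y" by (intro mult_left_mono infdist_triangle_abs) auto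
        finally show "dist (\<psi> m x) (\<psi> m y) \<le> real m * dist x y" by (simp add: dist_real_def)
      qed auto
      have \<psi>c: "continuous_on UNIV (\<psi> m)" for m unfolding \<psi>_def by (intro continuous_intros)
      have \<psi>m: "\<psi> m \<in> borel_measurable (lebesgue_on \<Omega>)" for m
        by (intro continuous_imp_measurable_on_sets_lebesgue continuous_on_subset[OF \<psi>c] \<Omega>') auto
      have zero: "(LINT x|lebesgue_on \<Omega>. \<psi> m x * G x $ j) = 0" for m
      proof -
        have "\<exists>L. L-lipschitz_on ?B (\<lambda>x. X j x $ k * \<psi> m x)" for k
        proof -
          obtain L where L: "L-lipschitz_on ?B (X j)" using locally_Lipschitz_field_compact[of "X j" ?B] X by auto
          have L': "L-lipschitz_on ?B (\<lambda>x. X j x $ k)"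
            by (rule lipschitz_onI)
               (use lipschitz_onD[OF L] lipschitz_on_nonneg[OF L] in \<open>auto intro: order.trans[OF dist_vec_nth_le]\<close>)
          have "bounded ((\<lambda>x. X j x $ k) ` ?B)"
            by (intro compact_imp_bounded compact_continuous_image lipschitz_on_continuous_on[OF L']) auto
          then obtain B where B: "\<And>x. x \<in> ?B \<Longrightarrow> \<bar>X j x $ k\<bar> \<le> B" unfolding bounded_iff by fastforce
          have "\<bar>X j x $ k\<bar> \<le> max B 0" if "x \<in> ?B" for x using B[OF that] by simp
          then have "(max B 0 * real m + 1 * L)-lipschitz_on ?B (\<lambda>x. X j x $ k * \<psi> m x)"
            using \<psi>01 by (intro lipschitz_on_mult_bounded[OF L' \<psi>L]) auto
          then show ?thesis by blast
        qed
        then obtain L where L: "\<And>k. (L k)-lipschitz_on ?B (\<lambda>x. X j x $ k * \<psi> m x)" by metis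
        have Xc: "continuous_on UNIV (\<lambda>x. X j x $ k)" for k
          using locally_Lipschitz_field_continuous[of "X j"] X by (intro continuous_on_component) auto
        have bc: "continuous_on UNIV (\<lambda>x. X j x $ k * \<psi> m x)" for k
          by (intro continuous_on_mult Xc \<psi>c)
        let ?a = "\<lambda>n. LINT x|lebesgue_on \<Omega>. \<psi> m x * classical_Xgrad X (\<phi> n) x $ j"
        have a_le: "\<bar>?a n\<bar> \<le> (\<Sum>k\<in>UNIV. L k) * Lint \<Omega> 1 (\<phi> n)" for n
        proof -
          obtain K where K: "compact K" "K \<subseteq> \<Omega>" "\<And>x. x \<notin> K \<Longrightarrow> \<phi> n x = 0" "\<And>x k. x \<notin> K \<Longrightarrow> partial (\<phi> n) k x = 0"
            using test_function_support[OF \<phi>[of n]] by blast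
          have c: "continuous_on UNIV (\<lambda>x. X j x $ k * \<psi> m x * partial (\<phi> n) k x)" for k
            by (intro continuous_on_mult Xc \<psi>c test_function_smooth(4)[OF \<phi>])
          have i: "integrable lborel (\<lambda>x. X j x $ k * \<psi> m x * partial (\<phi> n) k x)" for k
            by (rule integrable_lborel_compact_support[OF c K(1)]) (simp add: K(4))
          have "?a n = (LINT x|lebesgue_on \<Omega>. (\<Sum>k\<in>UNIV. X j x $ k * \<psi> m x * partial (\<phi> n) k x))"
            by (simp add: classical_Xgrad_def sum_distrib_left mult_ac)
          also have "\<dots> = (\<integral>x. (\<Sum>k\<in>UNIV. X j x $ k * \<psi> m x * partial (\<phi> n) k x) \<partial>lborel)"
          proof (rule integral_lebesgue_on_eq_lborel[OF \<Omega>'])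
            show "continuous_on UNIV (\<lambda>x. \<Sum>k\<in>UNIV. X j x $ k * \<psi> m x * partial (\<phi> n) k x)"
              by (intro continuous_on_sum c)
            show "(\<Sum>k\<in>UNIV. X j x $ k * \<psi> m x * partial (\<phi> n) k x) = 0" if "x \<notin> \<Omega>" for x
              using K(4)[of x] that K(2) by (intro sum.neutral ballI) (auto simp: subset_iff)
          qed
          also have "\<dots> = (\<Sum>k\<in>UNIV. \<integral>x. X j x $ k * \<psi> m x * partial (\<phi> n) k x \<partial>lborel)"
            using i by (rule Bochner_Integration.integral_sum)
          also have "\<bar>\<dots>\<bar> \<le> (\<Sum>k\<in>UNIV. L k * (\<integral>x. \<bar>\<phi> n x\<bar> \<partial>lborel))"
            by (rule order.trans[OF sum_abs]) (intro sum_mono integral_partial_le[OF \<phi> R bc L])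
          also have "(\<integral>x. \<bar>\<phi> n x\<bar> \<partial>lborel) = (LINT x|lebesgue_on \<Omega>. \<bar>\<phi> n x\<bar>)"
            using K(2,3) by (intro integral_lebesgue_on_eq_lborel[symmetric] \<Omega>' continuous_on_rabs test_function_smooth(3)[OF \<phi>]) auto
          also have "\<dots> = Lint \<Omega> 1 (\<phi> n)" by simp
          finally show ?thesis by (simp add: sum_distrib_right)
        qed
        have "(\<lambda>n. Lint \<Omega> 1 (\<phi> n)) \<longlonglongrightarrow> 0"
          using lim0 Lp_tendsto_iff[of 1 \<Omega> \<phi> "\<lambda>_. 0"] by simp
        then have "(\<lambda>n. (\<Sum>k\<in>UNIV. L k) * Lint \<Omega> 1 (\<phi> n)) \<longlonglongrightarrow> 0" by (rule tendsto_mult_right_zero)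
        then have a0: "?a \<longlonglongrightarrow> 0"
          by (rule Lim_null_comparison[rotated]) (use a_le in simp)
        have int\<psi>: "integrable (lebesgue_on \<Omega>) (\<lambda>x. \<psi> m x * F x $ j)" if "F \<in> Lp \<Omega> (ereal 1)" for F :: "real^'n \<Rightarrow> real^'m"
        proof -
          have Fj: "integrable (lebesgue_on \<Omega>) (\<lambda>x. F x $ j)"
            by (rule integrable_vec_nth[OF Lp1[OF that]])
          note [measurable] = \<psi>m borel_measurable_integrable[OF Fj]
          show ?thesis
            by (rule Bochner_Integration.integrable_bound[OF Fj])
               (use \<psi>01 in \<open>auto simp: abs_mult intro!: mult_left_le_one_le\<close>)
        qed
        have GnL: "classical_Xgrad X (\<phi> n) \<in> Lp \<Omega> (ereal 1)" for n
          by (rule test_function_in_Lp(2)[OF \<Omega> X \<phi>]) simp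
        have diff: "\<bar>?a n - (LINT x|lebesgue_on \<Omega>. \<psi> m x * G x $ j)\<bar> \<le> Lint \<Omega> 1 (\<lambda>x. classical_Xgrad X (\<phi> n) x - G x)" for n
        proof -
          have D: "(\<lambda>x. classical_Xgrad X (\<phi> n) x - G x) \<in> Lp \<Omega> (ereal 1)" by (intro Lp_diff GnL GL) auto
          have "?a n - (LINT x|lebesgue_on \<Omega>. \<psi> m x * G x $ j)
              = (LINT x|lebesgue_on \<Omega>. \<psi> m x * (classical_Xgrad X (\<phi> n) x - G x) $ j)"
            using int\<psi>[OF GnL] int\<psi>[OF GL] by (simp add: right_diff_distrib)
          also have "\<bar>\<dots>\<bar> \<le> (LINT x|lebesgue_on \<Omega>. norm (classical_Xgrad X (\<phi> n) x - G x))"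
          proof (rule order.trans[OF integral_abs_bound integral_mono])
            show "\<bar>\<psi> m x * (classical_Xgrad X (\<phi> n) x - G x) $ j\<bar> \<le> norm (classical_Xgrad X (\<phi> n) x - G x)" for x
            proof -
              have "\<psi> m x * \<bar>(classical_Xgrad X (\<phi> n) x - G x) $ j\<bar> \<le> 1 * norm (classical_Xgrad X (\<phi> n) x - G x)"
                using \<psi>01 by (intro mult_mono component_le_norm_cart) auto
              then show ?thesis using \<psi>01 by (simp add: abs_mult)
            qed
          qed (use int\<psi>[OF D] Lp1[OF D] in auto)
          finally show ?thesis by simp
        qed
        have "(\<lambda>n. Lint \<Omega> 1 (\<lambda>x. classical_Xgrad X (\<phi> n) x - G x)) \<longlonglongrightarrow> 0"
          using limG Lp_tendsto_iff[of 1 \<Omega> "\<lambda>n. classical_Xgrad X (\<phi> n)" G] by simp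
        then have "(\<lambda>n. ?a n - (LINT x|lebesgue_on \<Omega>. \<psi> m x * G x $ j)) \<longlonglongrightarrow> 0"
          by (rule Lim_null_comparison[rotated]) (use diff in simp)
        then have "?a \<longlonglongrightarrow> (LINT x|lebesgue_on \<Omega>. \<psi> m x * G x $ j)" by (simp add: LIM_zero_iff)
        then show ?thesis using a0 by (rule LIMSEQ_unique)
      qed
      have "(\<lambda>m. LINT x|lebesgue_on \<Omega>. \<psi> m x * G x $ j) \<longlonglongrightarrow> (LINT x|lebesgue_on \<Omega>. indicator S x * G x $ j)"
      proof (rule integral_dominated_convergence[where w="\<lambda>x. \<bar>G x $ j\<bar>"])
        have "(\<lambda>m. \<psi> m x) \<longlonglongrightarrow> indicator S x" for x
        proof (cases "x \<in> S")
          case False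
          then have d: "0 < infdist x S"
            using S \<open>S \<noteq> {}\<close> infdist_nonneg[of x S] in_closed_iff_infdist_zero[of S x] by fastforce
          obtain N where N: "1 / infdist x S < real N" using reals_Archimedean2 by blast
          have "\<psi> m x = 0" if "m \<ge> N" for m
          proof -
            have "1 / infdist x S \<le> real m" using N that by linarith
            then have "1 \<le> real m * infdist x S" using d by (simp add: field_simps)
            then show ?thesis by (simp add: \<psi>_def)
          qed
          then have "\<forall>\<^sub>F m in sequentially. \<psi> m x = 0" by (auto simp: eventually_sequentially)
          then show ?thesis using False by (intro tendsto_eventually) simp
        qed (simp add: \<psi>_def)
        then show "AE x in lebesgue_on \<Omega>. (\<lambda>m. \<psi> m x * G x $ j) \<longlonglongrightarrow> indicator S x * G x $ j"
          by (intro AE_I2 tendsto_mult tendsto_const)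
        show "(\<lambda>x. indicator S x * G x $ j) \<in> borel_measurable (lebesgue_on \<Omega>)"
        proof (intro borel_measurable_times borel_measurable_integrable[OF intG])
          have "indicator S \<in> borel_measurable lebesgue" using S by (intro borel_measurable_indicator) auto
          then show "indicator S \<in> borel_measurable (lebesgue_on \<Omega>)" by (rule measurable_restrict_space1)
        qed
        show "(\<lambda>x. \<psi> m x * G x $ j) \<in> borel_measurable (lebesgue_on \<Omega>)" for m
          by (intro borel_measurable_times \<psi>m borel_measurable_integrable[OF intG])
        show "AE x in lebesgue_on \<Omega>. norm (\<psi> m x * G x $ j) \<le> \<bar>G x $ j\<bar>" for m
          using \<psi>01 by (intro AE_I2) (auto simp: abs_mult intro!: mult_left_le_one_le)
      qed (use intG in auto)
      then show ?thesis by (simp add: zero LIMSEQ_const_iff)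
    qed simp
  qed
  then have "AE x in lebesgue_on \<Omega>. \<forall>j. G x $ j = 0" by (subst AE_all_countable) auto
  then show ?thesis by eventually_elim (simp add: vec_eq_iff)
qed

section \<open>Sobolev functions\<close>

lemma Lp_dominated:
  fixes f :: "'a::euclidean_space \<Rightarrow> 'b::euclidean_space" and g :: "'a \<Rightarrow> 'c::euclidean_space"
  assumes g: "g \<in> Lp \<Omega> (ereal p)" and f: "f \<in> borel_measurable (lebesgue_on \<Omega>)" and p: "0 \<le> p"
    and le: "\<And>x. x \<in> \<Omega> \<Longrightarrow> norm (f x) \<le> norm (g x)"
  shows "f \<in> Lp \<Omega> (ereal p)" "Lint \<Omega> p f \<le> Lint \<Omega> p g"
proof -
  note [measurable] = f
  have i: "integrable (lebesgue_on \<Omega>) (\<lambda>x. norm (f x) powr p)"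
    by (rule Bochner_Integration.integrable_bound[where f="\<lambda>x. norm (g x) powr p"])
       (use g le p in \<open>auto simp: Lp_iff intro!: AE_I2 powr_mono2\<close>)
  then show "f \<in> Lp \<Omega> (ereal p)" using f by (simp add: Lp_iff)
  show "Lint \<Omega> p f \<le> Lint \<Omega> p g"
    using g i le p by (intro integral_mono_AE) (auto simp: Lp_iff intro!: AE_I2 powr_mono2)
qed

lemma Lp_norm_fun: "f \<in> Lp \<Omega> (ereal p) \<Longrightarrow> (\<lambda>x. norm (f x)) \<in> Lp \<Omega> (ereal p)"
  by (auto simp: Lp_iff)

lemma Lp_tendsto_squeeze:
  fixes f :: "'a::euclidean_space \<Rightarrow> 'b::euclidean_space" and A :: "nat \<Rightarrow> 'a \<Rightarrow> 'c::euclidean_space"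
    and B :: "nat \<Rightarrow> 'a \<Rightarrow> 'd::euclidean_space"
  assumes F: "\<And>n. F n \<in> Lp \<Omega> (ereal p)" "f \<in> Lp \<Omega> (ereal p)" and p: "0 < p"
    and A: "Lp_tendsto \<Omega> (ereal p) A (\<lambda>_. 0)" and B: "Lp_tendsto \<Omega> (ereal p) B (\<lambda>_. 0)"
    and le: "\<And>n x. x \<in> \<Omega> \<Longrightarrow> norm (F n x - f x) \<le> norm (A n x) + norm (B n x)"
  shows "Lp_tendsto \<Omega> (ereal p) F f"
proof -
  have mem: "A n \<in> Lp \<Omega> (ereal p)" "B n \<in> Lp \<Omega> (ereal p)"
    and lim: "(\<lambda>n. Lint \<Omega> p (A n)) \<longlonglongrightarrow> 0" "(\<lambda>n. Lint \<Omega> p (B n)) \<longlonglongrightarrow> 0" for n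
    using A B by (auto simp: Lp_tendsto_iff[OF p])
  have "(\<lambda>n. Lint \<Omega> p (\<lambda>x. F n x - f x)) \<longlonglongrightarrow> 0"
  proof (rule tendsto_sandwich[where f="\<lambda>_. 0"])
    show "(\<lambda>n. 2 powr p * (Lint \<Omega> p (A n) + Lint \<Omega> p (B n))) \<longlonglongrightarrow> 0"
      using tendsto_mult[OF tendsto_const[of "2 powr p"] tendsto_add[OF lim]] by simp
    show "\<forall>\<^sub>F n in sequentially. Lint \<Omega> p (\<lambda>x. F n x - f x) \<le> 2 powr p * (Lint \<Omega> p (A n) + Lint \<Omega> p (B n))"
    proof (intro always_eventually allI)
      fix n
      have s: "(\<lambda>x. norm (A n x) + norm (B n x)) \<in> Lp \<Omega> (ereal p)"
        using p by (intro Lp_add Lp_norm_fun mem) auto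
      have "Lint \<Omega> p (\<lambda>x. F n x - f x) \<le> Lint \<Omega> p (\<lambda>x. norm (A n x) + norm (B n x))"
        by (rule Lp_dominated(2)[OF s]) (use le p Lp_borel[OF F(1)] Lp_borel[OF F(2)] in auto)
      also have "\<dots> \<le> 2 powr p * (Lint \<Omega> p (\<lambda>x. norm (A n x)) + Lint \<Omega> p (\<lambda>x. norm (B n x)))"
        using p by (intro Lint_add_le Lp_norm_fun mem) auto
      finally show "Lint \<Omega> p (\<lambda>x. F n x - f x) \<le> 2 powr p * (Lint \<Omega> p (A n) + Lint \<Omega> p (B n))" by simp
    qed
  qed auto
  then show ?thesis using F by (simp add: Lp_tendsto_iff[OF p])
qed

lemma Lp_tendsto_0_diff:
  fixes f :: "'a::euclidean_space \<Rightarrow> 'b::euclidean_space"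
  assumes "Lp_tendsto \<Omega> (ereal p) F f" "0 < p"
  shows "Lp_tendsto \<Omega> (ereal p) (\<lambda>n x. F n x - f x) (\<lambda>_. 0)"
  using Lp_tendsto_diff[OF assms(1) Lp_tendsto_const assms(2), of f] assms by (auto simp: Lp_tendsto_def)

locale vector_fields =
  fixes \<Omega> :: "(real^'n) set" and X :: "'m::finite \<Rightarrow> real^'n \<Rightarrow> real^'n"
  assumes open_domain: "open \<Omega>" and bounded_domain: "bounded \<Omega>"
    and Lipschitz_fields: "\<forall>j. locally_Lipschitz_field (X j)"
begin

lemma lmeasurable_domain: "\<Omega> \<in> lmeasurable"
  using bounded_domain open_domain by (intro bounded_set_imp_lmeasurable) auto

lemma finite_measure_domain: "finite_measure (lebesgue_on \<Omega>)"
  using lmeasurable_domain by (rule finite_measure_lebesgue_on)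

lemma W0_grad_memD:
  assumes "W0_grad \<Omega> X p u G"
  shows "u \<in> Lp \<Omega> (ereal p)" "G \<in> Lp \<Omega> (ereal p)"
  using assms by (auto simp: W0_grad_def Lp_tendsto_def)

lemma W0_grad_lincomb:
  assumes "W0_grad \<Omega> X p u G" "W0_grad \<Omega> X p v H" "0 < p"
  shows "W0_grad \<Omega> X p (\<lambda>x. a * u x + b * v x) (\<lambda>x. a *\<^sub>R G x + b *\<^sub>R H x)"
proof -
  obtain \<phi> where \<phi>: "\<And>k. \<phi> k \<in> test_functions \<Omega>" "Lp_tendsto \<Omega> (ereal p) \<phi> u"
      "Lp_tendsto \<Omega> (ereal p) (\<lambda>k. classical_Xgrad X (\<phi> k)) G"
    using assms(1) unfolding W0_grad_def by blast
  obtain \<psi> where \<psi>: "\<And>k. \<psi> k \<in> test_functions \<Omega>" "Lp_tendsto \<Omega> (ereal p) \<psi> v"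
      "Lp_tendsto \<Omega> (ereal p) (\<lambda>k. classical_Xgrad X (\<psi> k)) H"
    using assms(2) unfolding W0_grad_def by blast
  have sm: "\<phi> k differentiable (at x)" "\<psi> k differentiable (at x)" for k x
    by (rule test_function_smooth(2)[OF \<phi>(1)] test_function_smooth(2)[OF \<psi>(1)])+
  have sm': "(\<lambda>x. a * \<phi> k x) differentiable (at x)" "(\<lambda>x. b * \<psi> k x) differentiable (at x)" for k x
    by (intro differentiable_mult differentiable_const sm)+
  have grad: "classical_Xgrad X (\<lambda>x. a * \<phi> k x + b * \<psi> k x)
      = (\<lambda>x. a *\<^sub>R classical_Xgrad X (\<phi> k) x + b *\<^sub>R classical_Xgrad X (\<psi> k) x)" for k
    by (rule ext) (simp only: classical_Xgrad_add[OF sm'] classical_Xgrad_scale[OF sm(1)] classical_Xgrad_scale[OF sm(2)])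
  show ?thesis
    unfolding W0_grad_def
  proof (intro exI conjI allI)
    show "(\<lambda>x. a * \<phi> k x + b * \<psi> k x) \<in> test_functions \<Omega>" for k
      by (intro test_functions_add test_functions_scale \<phi> \<psi>)
    show "Lp_tendsto \<Omega> (ereal p) (\<lambda>k x. a * \<phi> k x + b * \<psi> k x) (\<lambda>x. a * u x + b * v x)"
      using Lp_tendsto_add[OF Lp_tendsto_scale[OF \<phi>(2) assms(3), of a] Lp_tendsto_scale[OF \<psi>(2) assms(3), of b] assms(3)]
      by simp
    show "Lp_tendsto \<Omega> (ereal p) (\<lambda>k. classical_Xgrad X (\<lambda>x. a * \<phi> k x + b * \<psi> k x)) (\<lambda>x. a *\<^sub>R G x + b *\<^sub>R H x)"
      unfolding grad
      by (rule Lp_tendsto_add[OF Lp_tendsto_scale[OF \<phi>(3) assms(3), of a] Lp_tendsto_scale[OF \<psi>(3) assms(3), of b] assms(3)])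
  qed
qed

lemma W0_grad_diff:
  assumes "W0_grad \<Omega> X p u G" "W0_grad \<Omega> X p v H" "0 < p"
  shows "W0_grad \<Omega> X p (\<lambda>x. u x - v x) (\<lambda>x. G x - H x)"
  using W0_grad_lincomb[OF assms, of 1 "-1"] by simp

lemma W0_grad_mono:
  assumes "W0_grad \<Omega> X p u G" "0 < q" "q \<le> p"
  shows "W0_grad \<Omega> X q u G"
  using assms Lp_tendsto_mono[OF lmeasurable_domain] unfolding W0_grad_def by meson

lemma W0_grad_AE_cong:
  assumes "W0_grad \<Omega> X p u G" "0 < p"
    and "v \<in> borel_measurable (lebesgue_on \<Omega>)" "AE x in lebesgue_on \<Omega>. u x = v x"
    and "H \<in> borel_measurable (lebesgue_on \<Omega>)" "AE x in lebesgue_on \<Omega>. G x = H x"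
  shows "W0_grad \<Omega> X p v H"
proof -
  obtain \<phi> where \<phi>: "\<And>k. \<phi> k \<in> test_functions \<Omega>" "Lp_tendsto \<Omega> (ereal p) \<phi> u"
      "Lp_tendsto \<Omega> (ereal p) (\<lambda>k. classical_Xgrad X (\<phi> k)) G"
    using assms(1) unfolding W0_grad_def by blast
  show ?thesis
    unfolding W0_grad_def
    using \<phi>(1) Lp_tendsto_AE_cong[OF \<phi>(2) assms(2-4)] Lp_tendsto_AE_cong[OF \<phi>(3) assms(2,5,6)] by blast
qed

lemma W0_grad_unique:
  assumes "W0_grad \<Omega> X p u G" "W0_grad \<Omega> X q u H" "1 \<le> p" "1 \<le> q"
  shows "AE x in lebesgue_on \<Omega>. G x = H x"
proof -
  have "W0_grad \<Omega> X 1 u G" "W0_grad \<Omega> X 1 u H"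
    using W0_grad_mono[OF assms(1), of 1] W0_grad_mono[OF assms(2), of 1] assms(3,4) by simp_all
  then have "W0_grad \<Omega> X 1 (\<lambda>x. u x - u x) (\<lambda>x. G x - H x)" by (rule W0_grad_diff) simp
  then have "W0_grad \<Omega> X 1 (\<lambda>x. 0) (\<lambda>x. G x - H x)" by simp
  then obtain \<phi> where \<phi>: "\<And>k. \<phi> k \<in> test_functions \<Omega>" "Lp_tendsto \<Omega> (ereal 1) \<phi> (\<lambda>_. 0)"
      "Lp_tendsto \<Omega> (ereal 1) (\<lambda>k. classical_Xgrad X (\<phi> k)) (\<lambda>x. G x - H x)"
    unfolding W0_grad_def by blast
  have "AE x in lebesgue_on \<Omega>. G x - H x = 0"
    by (rule gradient_limit_zero[OF open_domain bounded_domain Lipschitz_fields \<phi>])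
  then show ?thesis by simp
qed

lemma Xgrad_AE_eq:
  assumes "W0_grad \<Omega> X p u G" "1 \<le> p"
  shows "AE x in lebesgue_on \<Omega>. Xgrad \<Omega> X u x = G x" and "W0_grad \<Omega> X p u (Xgrad \<Omega> X u)"
proof -
  have "W0_grad \<Omega> X 1 u G" using W0_grad_mono[OF assms(1), of 1] assms(2) by simp
  then have g: "W0_grad \<Omega> X 1 u (Xgrad \<Omega> X u)" unfolding Xgrad_def by (rule someI[of "W0_grad \<Omega> X 1 u"])
  show ae: "AE x in lebesgue_on \<Omega>. Xgrad \<Omega> X u x = G x" by (rule W0_grad_unique[OF g assms(1) _ assms(2)]) simp
  then have ae': "AE x in lebesgue_on \<Omega>. G x = Xgrad \<Omega> X u x" by eventually_elim simp
  show "W0_grad \<Omega> X p u (Xgrad \<Omega> X u)"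
    by (rule W0_grad_AE_cong[OF assms(1) _ _ _ _ ae'])
       (use assms Lp_borel[OF W0_grad_memD(1)[OF g]] Lp_borel[OF W0_grad_memD(2)[OF g]] in auto)
qed

lemma W0_iff: "1 \<le> p \<Longrightarrow> u \<in> W0 \<Omega> X p \<longleftrightarrow> W0_grad \<Omega> X p u (Xgrad \<Omega> X u)"
  unfolding W0_def using Xgrad_AE_eq(2) by blast

lemma W0_norm_eq:
  assumes "W0_grad \<Omega> X p u G" "1 \<le> p"
  shows "W0_norm \<Omega> X p u = Lint \<Omega> p G powr (1 / p)"
proof -
  have "Lint \<Omega> p (Xgrad \<Omega> X u) = Lint \<Omega> p G"
    by (rule Lp_AE_cong(2)[OF W0_grad_memD(2)[OF Xgrad_AE_eq(2)[OF assms]]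
          Lp_borel[OF W0_grad_memD(2)[OF assms(1)]] Xgrad_AE_eq(1)[OF assms]])
  then show ?thesis by (simp add: W0_norm_def Lp_norm_ereal)
qed

text \<open>Closedness of the gradient, by a diagonal choice of test functions.\<close>

lemma W0_grad_closed:
  assumes W: "\<And>n. W0_grad \<Omega> X p (U n) (F n)" and p: "0 < p"
    and u: "Lp_tendsto \<Omega> (ereal p) U u" and G: "Lp_tendsto \<Omega> (ereal p) F G"
  shows "W0_grad \<Omega> X p u G"
proof -
  have "\<exists>\<phi>. \<phi> \<in> test_functions \<Omega> \<and> Lint \<Omega> p (\<lambda>x. \<phi> x - U n x) < inverse (Suc n) \<and>
      Lint \<Omega> p (\<lambda>x. classical_Xgrad X \<phi> x - F n x) < inverse (Suc n)" for n
  proof -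
    obtain \<phi> where \<phi>: "\<And>k. \<phi> k \<in> test_functions \<Omega>" "Lp_tendsto \<Omega> (ereal p) \<phi> (U n)"
        "Lp_tendsto \<Omega> (ereal p) (\<lambda>k. classical_Xgrad X (\<phi> k)) (F n)"
      using W[of n] unfolding W0_grad_def by blast
    have l: "(\<lambda>k. Lint \<Omega> p (\<lambda>x. \<phi> k x - U n x)) \<longlonglongrightarrow> 0"
        "(\<lambda>k. Lint \<Omega> p (\<lambda>x. classical_Xgrad X (\<phi> k) x - F n x)) \<longlonglongrightarrow> 0"
      using \<phi>(2,3) by (auto simp: Lp_tendsto_iff[OF p])
    have ev: "\<forall>\<^sub>F k in sequentially. Lint \<Omega> p (\<lambda>x. \<phi> k x - U n x) < inverse (Suc n) \<and>
        Lint \<Omega> p (\<lambda>x. classical_Xgrad X (\<phi> k) x - F n x) < inverse (Suc n)"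
      by (intro eventually_conj order_tendstoD(2)[OF l(1)] order_tendstoD(2)[OF l(2)]) auto
    obtain k where "Lint \<Omega> p (\<lambda>x. \<phi> k x - U n x) < inverse (Suc n) \<and>
        Lint \<Omega> p (\<lambda>x. classical_Xgrad X (\<phi> k) x - F n x) < inverse (Suc n)"
      using eventually_happens'[OF sequentially_bot ev] by blast
    then show ?thesis using \<phi>(1)[of k] by blast
  qed
  then have "\<forall>n. \<exists>\<phi>. \<phi> \<in> test_functions \<Omega> \<and> Lint \<Omega> p (\<lambda>x. \<phi> x - U n x) < inverse (Suc n) \<and>
      Lint \<Omega> p (\<lambda>x. classical_Xgrad X \<phi> x - F n x) < inverse (Suc n)"
    by (rule allI)
  from choice[OF this] obtain \<phi> where ch: "\<forall>n. \<phi> n \<in> test_functions \<Omega> \<and> Lint \<Omega> p (\<lambda>x. \<phi> n x - U n x) < inverse (Suc n) \<and>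
      Lint \<Omega> p (\<lambda>x. classical_Xgrad X (\<phi> n) x - F n x) < inverse (Suc n)"
    by (rule exE)
  have \<phi>: "\<phi> n \<in> test_functions \<Omega>" "Lint \<Omega> p (\<lambda>x. \<phi> n x - U n x) < inverse (Suc n)"
      "Lint \<Omega> p (\<lambda>x. classical_Xgrad X (\<phi> n) x - F n x) < inverse (Suc n)" for n
    using spec[OF ch, of n] by simp_all
  have inv: "(\<lambda>n. inverse (real (Suc n))) \<longlonglongrightarrow> 0" by (rule LIMSEQ_inverse_real_of_nat)
  have mem: "\<phi> n \<in> Lp \<Omega> (ereal p)" "classical_Xgrad X (\<phi> n) \<in> Lp \<Omega> (ereal p)" for n
    using test_function_in_Lp[OF lmeasurable_domain Lipschitz_fields \<phi>(1)[of n], of p] p by simp_all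
  have UF: "U n \<in> Lp \<Omega> (ereal p)" "F n \<in> Lp \<Omega> (ereal p)" for n by (rule W0_grad_memD[OF W])+
  have d1: "Lp_tendsto \<Omega> (ereal p) (\<lambda>n x. \<phi> n x - U n x) (\<lambda>_. 0)"
    unfolding Lp_tendsto_iff[OF p]
  proof (intro conjI allI)
    show "(\<lambda>n. Lint \<Omega> p (\<lambda>x. \<phi> n x - U n x - 0)) \<longlonglongrightarrow> 0"
      by (rule tendsto_sandwich[OF _ _ tendsto_const inv]) (use less_imp_le[OF \<phi>(2)] in simp_all)
  qed (use p in \<open>auto intro!: Lp_diff mem UF simp: Lp_iff[of "\<lambda>_. 0"]\<close>)
  have d2: "Lp_tendsto \<Omega> (ereal p) (\<lambda>n x. classical_Xgrad X (\<phi> n) x - F n x) (\<lambda>_. 0)"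
    unfolding Lp_tendsto_iff[OF p]
  proof (intro conjI allI)
    show "(\<lambda>n. Lint \<Omega> p (\<lambda>x. classical_Xgrad X (\<phi> n) x - F n x - 0)) \<longlonglongrightarrow> 0"
      by (rule tendsto_sandwich[OF _ _ tendsto_const inv]) (use less_imp_le[OF \<phi>(3)] in simp_all)
  qed (use p in \<open>auto intro!: Lp_diff mem UF simp: Lp_iff[of "\<lambda>_. 0"]\<close>)
  have "Lp_tendsto \<Omega> (ereal p) \<phi> u" using Lp_tendsto_add[OF d1 u p] by simp
  moreover have "Lp_tendsto \<Omega> (ereal p) (\<lambda>n. classical_Xgrad X (\<phi> n)) G" using Lp_tendsto_add[OF d2 G p] by simp
  ultimately show ?thesis unfolding W0_grad_def using \<phi>(1) by blast
qed

text \<open>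
  The chain rule. The approximating test functions are composed with polynomials only: on the bounded
  range of a test function the derivative \<open>h\<close> is uniformly close to a polynomial.
\<close>

theorem W0_grad_chain:
  assumes W: "W0_grad \<Omega> X p u G" and p: "1 \<le> p"
    and H: "\<And>t. (H has_real_derivative h t) (at t)" and H0: "H 0 = 0"
    and h: "continuous_on UNIV h" and M: "\<And>t. \<bar>h t\<bar> \<le> M"
  shows "W0_grad \<Omega> X p (\<lambda>x. H (u x)) (\<lambda>x. h (u x) *\<^sub>R G x)"
proof -
  have p0: "0 < p" using p by simp
  have M0: "0 \<le> M" using M[of 0] by simp
  obtain \<phi>0 where \<phi>0: "\<And>k. \<phi>0 k \<in> test_functions \<Omega>" "Lp_tendsto \<Omega> (ereal p) \<phi>0 u"
      "Lp_tendsto \<Omega> (ereal p) (\<lambda>k. classical_Xgrad X (\<phi>0 k)) G"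
    using W unfolding W0_grad_def by blast
  \<comment> \<open>Pointwise convergence is what makes \<open>h (\<phi> k)\<close> converge to \<open>h u\<close>.\<close>
  obtain r where r: "strict_mono r" "AE x in lebesgue_on \<Omega>. (\<lambda>k. \<phi>0 (r k) x) \<longlonglongrightarrow> u x"
    using Lp_tendsto_AE_subseq[OF \<phi>0(2) p0] by blast
  define \<phi> where "\<phi> k = \<phi>0 (r k)" for k
  have \<phi>: "\<And>k. \<phi> k \<in> test_functions \<Omega>" "Lp_tendsto \<Omega> (ereal p) \<phi> u"
      "Lp_tendsto \<Omega> (ereal p) (\<lambda>k. classical_Xgrad X (\<phi> k)) G"
      "AE x in lebesgue_on \<Omega>. (\<lambda>k. \<phi> k x) \<longlonglongrightarrow> u x"
    using \<phi>0(1) r(2) Lp_tendsto_subseq[OF \<phi>0(2) r(1)] Lp_tendsto_subseq[OF \<phi>0(3) r(1)]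
    by (simp_all add: \<phi>_def[abs_def])
  have uG: "u \<in> Lp \<Omega> (ereal p)" "G \<in> Lp \<Omega> (ereal p)" by (rule W0_grad_memD[OF W])+
  have Hc: "continuous_on UNIV H" by (intro continuous_at_imp_continuous_on ballI DERIV_isCont[OF H])
  have [measurable]: "H \<in> borel_measurable borel" "h \<in> borel_measurable borel"
    by (intro borel_measurable_continuous_onI Hc h)+
  note [measurable] = Lp_borel[OF uG(1)] Lp_borel[OF uG(2)]
  have lip: "\<bar>A s - A t\<bar> \<le> B * \<bar>s - t\<bar>"
    if "\<And>y. y \<in> closed_segment s t \<Longrightarrow> (A has_real_derivative a y) (at y)" "\<And>y. y \<in> closed_segment s t \<Longrightarrow> \<bar>a y\<bar> \<le> B"
    for A a :: "real \<Rightarrow> real" and B s t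
    using field_differentiable_bound[of "closed_segment s t" A a B s t] that
    by (auto intro: has_field_derivative_at_within)
  define close_to where "close_to k P q \<longleftrightarrow> (\<lambda>x. P (\<phi> k x)) \<in> test_functions \<Omega> \<and>
      (\<forall>x. (P has_real_derivative q (\<phi> k x)) (at (\<phi> k x))) \<and>
      (\<forall>x. \<bar>h (\<phi> k x) - q (\<phi> k x)\<bar> \<le> inverse (Suc k)) \<and>
      (\<forall>x. \<bar>H (\<phi> k x) - P (\<phi> k x)\<bar> \<le> inverse (Suc k) * \<bar>\<phi> k x\<bar>)" for k P q
  have "\<exists>P q. (\<lambda>x. P (\<phi> k x)) \<in> test_functions \<Omega> \<and>
      (\<forall>x. (P has_real_derivative q (\<phi> k x)) (at (\<phi> k x))) \<and>
      (\<forall>x. \<bar>h (\<phi> k x) - q (\<phi> k x)\<bar> \<le> inverse (Suc k)) \<and>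
      (\<forall>x. \<bar>H (\<phi> k x) - P (\<phi> k x)\<bar> \<le> inverse (Suc k) * \<bar>\<phi> k x\<bar>)" for k
  proof -
    obtain K where K: "compact K" "K \<subseteq> \<Omega>" "\<And>x. x \<notin> K \<Longrightarrow> \<phi> k x = 0"
        "\<And>x j. x \<notin> K \<Longrightarrow> partial (\<phi> k) j x = 0"
      using test_function_support[OF \<phi>(1)[of k]] by blast
    have "bounded (\<phi> k ` K)"
      by (intro compact_imp_bounded compact_continuous_image continuous_on_subset[OF test_function_smooth(3)[OF \<phi>(1)]] K) auto
    then obtain R0 where R0: "\<And>x. x \<in> K \<Longrightarrow> \<bar>\<phi> k x\<bar> \<le> R0" unfolding bounded_iff by fastforce
    define R where "R = max R0 0"
    have R: "\<bar>\<phi> k x\<bar> \<le> R" for x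
      by (cases "x \<in> K") (simp_all add: R_def K(3) le_max_iff_disj R0)
    obtain q where q: "real_polynomial_function q" "\<And>t. t \<in> {-R..R} \<Longrightarrow> \<bar>h t - q t\<bar> < inverse (Suc k)"
      by (rule Stone_Weierstrass_real_polynomial_function[of "{-R..R}" h "inverse (Suc k)"])
         (auto intro: continuous_on_subset[OF h])
    obtain S where S: "real_polynomial_function S" "\<And>t. ((\<lambda>t. t * S t) has_real_derivative q t) (at t)"
      using polynomial_primitive[OF q(1)] by blast
    have le: "\<bar>H t - t * S t\<bar> \<le> inverse (Suc k) * \<bar>t\<bar>" if t: "\<bar>t\<bar> \<le> R" for t
    proof -
      have sub: "y \<in> {-R..R}" if "y \<in> closed_segment t 0" for y
        using that t by (auto simp: closed_segment_eq_real_ivl split: if_splits)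
      have "\<bar>(H t - t * S t) - (H 0 - 0 * S 0)\<bar> \<le> inverse (Suc k) * \<bar>t - 0\<bar>"
      proof (rule lip)
        show "((\<lambda>t. H t - t * S t) has_real_derivative (h y - q y)) (at y)" for y
          by (intro DERIV_diff H S(2))
        show "\<bar>h y - q y\<bar> \<le> inverse (Suc k)" if "y \<in> closed_segment t 0" for y
          using q(2)[OF sub[OF that]] by simp
      qed
      then show ?thesis using H0 by simp
    qed
    have qR: "\<bar>h t - q t\<bar> \<le> inverse (Suc k)" if "\<bar>t\<bar> \<le> R" for t
      by (rule less_imp_le[OF q(2)]) (use that in \<open>simp add: abs_le_iff\<close>)
    show ?thesis
      by (rule exI[of _ "\<lambda>t. t * S t"], rule exI[of _ q])
         (intro conjI allI test_functions_polynomial[OF \<phi>(1) S(1)] S(2) qR le R)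
  qed
  then have "\<forall>k. \<exists>P q. close_to k P q" by (simp add: close_to_def)
  then obtain P where "\<forall>k. \<exists>q. close_to k (P k) q" by (rule exE[OF choice])
  then obtain q where "\<forall>k. close_to k (P k) (q k)" by (rule exE[OF choice])
  then have P: "(\<lambda>x. P k (\<phi> k x)) \<in> test_functions \<Omega>"
      "\<And>x. (P k has_real_derivative q k (\<phi> k x)) (at (\<phi> k x))"
      "\<And>x. \<bar>h (\<phi> k x) - q k (\<phi> k x)\<bar> \<le> inverse (Suc k)"
      "\<And>x. \<bar>H (\<phi> k x) - P k (\<phi> k x)\<bar> \<le> inverse (Suc k) * \<bar>\<phi> k x\<bar>" for k
    by (simp_all add: close_to_def)
  have grad: "classical_Xgrad X (\<lambda>x. P k (\<phi> k x)) = (\<lambda>x. q k (\<phi> k x) *\<^sub>R classical_Xgrad X (\<phi> k) x)" for k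
    by (rule ext) (rule classical_Xgrad_chain[OF test_function_smooth(2)[OF \<phi>(1)] P(2)])
  have Plp: "(\<lambda>x. P k (\<phi> k x)) \<in> Lp \<Omega> (ereal p)"
      "(\<lambda>x. q k (\<phi> k x) *\<^sub>R classical_Xgrad X (\<phi> k) x) \<in> Lp \<Omega> (ereal p)" for k
    using test_function_in_Lp[OF lmeasurable_domain Lipschitz_fields P(1)[of k], of p] p grad[of k] by auto
  have \<phi>m: "\<phi> k \<in> borel_measurable (lebesgue_on \<Omega>)" for k
    using \<phi>(2) by (auto simp: Lp_tendsto_def intro: Lp_borel)
  note [measurable] = \<phi>m
  have HLip: "\<bar>H s - H t\<bar> \<le> M * \<bar>s - t\<bar>" for s t by (rule lip[OF H M])
  have HuL: "(\<lambda>x. H (u x)) \<in> Lp \<Omega> (ereal p)"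
  proof (rule Lp_dominated(1)[OF Lp_scale[OF uG(1), of M]])
    show "norm (H (u x)) \<le> norm (M *\<^sub>R u x)" for x using HLip[of "u x" 0] H0 M0 by (simp add: abs_mult)
  qed (use p in auto)
  have hGL: "(\<lambda>x. h (u x) *\<^sub>R G x) \<in> Lp \<Omega> (ereal p)"
  proof (rule Lp_dominated(1)[OF Lp_scale[OF uG(2), of M]])
    show "norm (h (u x) *\<^sub>R G x) \<le> norm (M *\<^sub>R G x)" for x using M[of "u x"] M0 by (simp add: mult_right_mono)
  qed (use p in auto)
  have inv: "(\<lambda>n. inverse (real (Suc n))) \<longlonglongrightarrow> 0" by (rule LIMSEQ_inverse_real_of_nat)
  have inv1: "inverse (real (Suc n)) \<le> 1" "0 \<le> inverse (real (Suc n))" for n by (simp_all add: inverse_le_1_iff)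
  have z: "(\<lambda>_. 0) \<in> Lp \<Omega> (ereal p)" by (simp add: Lp_iff)
  have z': "(\<lambda>_. 0 :: real^'m) \<in> Lp \<Omega> (ereal p)" by (simp add: Lp_iff)
  have a1: "Lp_tendsto \<Omega> (ereal p) (\<lambda>k x. inverse (Suc k) *\<^sub>R u x) (\<lambda>_. 0)"
  proof (rule Lp_tendsto_dominated[OF Lp_scale[OF uG(1)] z p0 uG(1)])
    show "AE x in lebesgue_on \<Omega>. (\<lambda>k. inverse (Suc k) *\<^sub>R u x) \<longlonglongrightarrow> 0"
    proof (intro AE_I2)
      fix x show "(\<lambda>k. inverse (Suc k) *\<^sub>R u x) \<longlonglongrightarrow> 0"
        using tendsto_scaleR[OF inv tendsto_const[of "u x"]] by (simp del: of_nat_Suc)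
    qed
    show "AE x in lebesgue_on \<Omega>. norm (inverse (Suc k) *\<^sub>R u x - 0) \<le> norm (u x)" for k
      using inv1[of k] by (intro AE_I2) (simp add: abs_mult mult_left_le_one_le del: of_nat_Suc)
  qed
  have a2: "Lp_tendsto \<Omega> (ereal p) (\<lambda>k x. (inverse (Suc k) + \<bar>h (\<phi> k x) - h (u x)\<bar>) *\<^sub>R G x) (\<lambda>_. 0)"
  proof (rule Lp_tendsto_dominated[OF _ z' p0 Lp_scale[OF uG(2), of "1 + 2 * M"]])
    have c: "inverse (Suc k) + \<bar>h (\<phi> k x) - h (u x)\<bar> \<le> 1 + 2 * M" for k x
      using inv1[of k] M[of "\<phi> k x"] M[of "u x"] by linarith
    have c0: "0 \<le> inverse (Suc k) + \<bar>h (\<phi> k x) - h (u x)\<bar>" for k x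
      using inv1(2)[of k] by linarith
    show dom: "AE x in lebesgue_on \<Omega>. norm ((inverse (Suc k) + \<bar>h (\<phi> k x) - h (u x)\<bar>) *\<^sub>R G x - 0) \<le> norm ((1 + 2 * M) *\<^sub>R G x)" for k
      using c[of k] c0[of k] M0 by (intro AE_I2) (simp add: mult_right_mono del: of_nat_Suc)
    show "(\<lambda>x. (inverse (Suc k) + \<bar>h (\<phi> k x) - h (u x)\<bar>) *\<^sub>R G x) \<in> Lp \<Omega> (ereal p)" for k
    proof (rule Lp_dominated(1)[OF Lp_scale[OF uG(2), of "1 + 2 * M"]])
      show "norm ((inverse (Suc k) + \<bar>h (\<phi> k x) - h (u x)\<bar>) *\<^sub>R G x) \<le> norm ((1 + 2 * M) *\<^sub>R G x)" for x
        using c[of k x] c0[of k x] M0 by (simp add: mult_right_mono del: of_nat_Suc)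
    qed (use p in auto)
    show "AE x in lebesgue_on \<Omega>. (\<lambda>k. (inverse (Suc k) + \<bar>h (\<phi> k x) - h (u x)\<bar>) *\<^sub>R G x) \<longlonglongrightarrow> 0"
      using \<phi>(4)
    proof eventually_elim
      case (elim x)
      have "isCont h (u x)" using h by (simp add: continuous_on_eq_continuous_at)
      from isCont_tendsto_compose[OF this elim] have "(\<lambda>k. h (\<phi> k x)) \<longlonglongrightarrow> h (u x)" .
      then have "(\<lambda>k. \<bar>h (\<phi> k x) - h (u x)\<bar>) \<longlonglongrightarrow> 0" by (simp add: tendsto_rabs_zero_iff LIM_zero_iff)
      from tendsto_scaleR[OF tendsto_add[OF inv this] tendsto_const[of "G x"]] show ?case by simp
    qed
  qed
  have b1: "Lp_tendsto \<Omega> (ereal p) (\<lambda>k x. (M + 1) *\<^sub>R (\<phi> k x - u x)) (\<lambda>_. 0)"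
    using Lp_tendsto_scale[OF Lp_tendsto_0_diff[OF \<phi>(2) p0] p0, of "M + 1"] by simp
  have b2: "Lp_tendsto \<Omega> (ereal p) (\<lambda>k x. (M + 1) *\<^sub>R (classical_Xgrad X (\<phi> k) x - G x)) (\<lambda>_. 0)"
    using Lp_tendsto_scale[OF Lp_tendsto_0_diff[OF \<phi>(3) p0] p0, of "M + 1"] by simp
  have lim1: "Lp_tendsto \<Omega> (ereal p) (\<lambda>k x. P k (\<phi> k x)) (\<lambda>x. H (u x))"
  proof (rule Lp_tendsto_squeeze[OF Plp(1) HuL p0 a1 b1])
    fix k x
    let ?i = "inverse (real (Suc k))"
    have "\<bar>P k (\<phi> k x) - H (u x)\<bar> \<le> ?i * \<bar>\<phi> k x\<bar> + M * \<bar>\<phi> k x - u x\<bar>"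
      using P(4)[of k x] HLip[of "\<phi> k x" "u x"] by linarith
    also have "?i * \<bar>\<phi> k x\<bar> \<le> ?i * \<bar>u x\<bar> + 1 * \<bar>\<phi> k x - u x\<bar>"
    proof -
      have "?i * \<bar>\<phi> k x\<bar> \<le> ?i * (\<bar>u x\<bar> + \<bar>\<phi> k x - u x\<bar>)" by (intro mult_left_mono inv1) linarith
      also have "\<dots> = ?i * \<bar>u x\<bar> + ?i * \<bar>\<phi> k x - u x\<bar>" by (rule distrib_left)
      also have "?i * \<bar>\<phi> k x - u x\<bar> \<le> 1 * \<bar>\<phi> k x - u x\<bar>" by (intro mult_right_mono inv1) simp
      finally show ?thesis by simp
    qed
    finally have "\<bar>P k (\<phi> k x) - H (u x)\<bar> \<le> ?i * \<bar>u x\<bar> + (M + 1) * \<bar>\<phi> k x - u x\<bar>" by (simp add: algebra_simps del: of_nat_Suc)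
    then show "norm (P k (\<phi> k x) - H (u x)) \<le> norm (?i *\<^sub>R u x) + norm ((M + 1) *\<^sub>R (\<phi> k x - u x))"
      using M0 by (simp add: abs_mult del: of_nat_Suc)
  qed
  have lim2: "Lp_tendsto \<Omega> (ereal p) (\<lambda>k. classical_Xgrad X (\<lambda>x. P k (\<phi> k x))) (\<lambda>x. h (u x) *\<^sub>R G x)"
    unfolding grad
  proof (rule Lp_tendsto_squeeze[OF Plp(2) hGL p0 a2 b2])
    fix k x
    let ?i = "inverse (real (Suc k))" and ?g = "classical_Xgrad X (\<phi> k) x"
    have "q k (\<phi> k x) *\<^sub>R ?g - h (u x) *\<^sub>R G x
        = (q k (\<phi> k x) - h (\<phi> k x)) *\<^sub>R ?g + h (\<phi> k x) *\<^sub>R (?g - G x) + (h (\<phi> k x) - h (u x)) *\<^sub>R G x"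
      by (simp add: algebra_simps)
    also have "norm \<dots> \<le> \<bar>q k (\<phi> k x) - h (\<phi> k x)\<bar> * norm ?g + \<bar>h (\<phi> k x)\<bar> * norm (?g - G x) + \<bar>h (\<phi> k x) - h (u x)\<bar> * norm (G x)"
      by (intro order.trans[OF norm_triangle_ineq] add_mono) (simp_all add: order.trans[OF norm_triangle_ineq])
    also have "\<dots> \<le> (?i * norm (G x) + 1 * norm (?g - G x)) + M * norm (?g - G x) + \<bar>h (\<phi> k x) - h (u x)\<bar> * norm (G x)"
    proof (intro add_mono mult_right_mono M norm_ge_zero order.refl)
      have "\<bar>q k (\<phi> k x) - h (\<phi> k x)\<bar> * norm ?g \<le> ?i * (norm (G x) + norm (?g - G x))"
        using P(3)[of k x] norm_triangle_sub[of ?g "G x"] by (intro mult_mono) (auto simp: abs_minus_commute)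
      also have "\<dots> = ?i * norm (G x) + ?i * norm (?g - G x)" by (rule distrib_left)
      also have "?i * norm (?g - G x) \<le> 1 * norm (?g - G x)" by (intro mult_right_mono inv1) simp
      finally show "\<bar>q k (\<phi> k x) - h (\<phi> k x)\<bar> * norm ?g \<le> ?i * norm (G x) + 1 * norm (?g - G x)" by simp
    qed
    also have "\<dots> = (?i + \<bar>h (\<phi> k x) - h (u x)\<bar>) * norm (G x) + (M + 1) * norm (?g - G x)"
      by (simp add: algebra_simps del: of_nat_Suc)
    also have "\<dots> = norm ((?i + \<bar>h (\<phi> k x) - h (u x)\<bar>) *\<^sub>R G x) + norm ((M + 1) *\<^sub>R (?g - G x))"
      using M0 inv1(2)[of k] by (simp del: of_nat_Suc)
    finally show "norm (q k (\<phi> k x) *\<^sub>R ?g - h (u x) *\<^sub>R G x)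
        \<le> norm ((?i + \<bar>h (\<phi> k x) - h (u x)\<bar>) *\<^sub>R G x) + norm ((M + 1) *\<^sub>R (?g - G x))" .
  qed
  show ?thesis
    unfolding W0_grad_def
    by (rule exI[of _ "\<lambda>k x. P k (\<phi> k x)"]) (intro conjI allI P(1) lim1 lim2)
qed

end

section \<open>One-dimensional primitives\<close>

lemma primitive_exists:
  fixes h :: "real \<Rightarrow> real"
  assumes "continuous_on UNIV h"
  obtains H where "H 0 = 0" "\<And>t. (H has_real_derivative h t) (at t)"
proof -
  have "isCont h t" for t using assms by (simp add: continuous_on_eq_continuous_at)
  then obtain F where F: "\<And>t. (F has_vector_derivative h t) (at t)"
    using einterval_antiderivative[of "-\<infinity>" "\<infinity>" h] by auto
  show ?thesis
  proof
    show "((\<lambda>t. F t - F 0) has_real_derivative h t) (at t)" for t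
      using F[of t] DERIV_diff[of F "h t" t UNIV "\<lambda>_. F 0" 0]
      by (simp add: has_real_derivative_iff_has_vector_derivative)
  qed simp
qed

lemma primitive_odd:
  fixes h :: "real \<Rightarrow> real"
  assumes H: "\<And>t. (H has_real_derivative h t) (at t)" "H 0 = 0" and even: "\<And>t. h (- t) = h t"
  shows "H (- t) = - H t"
proof -
  have "((\<lambda>t. H (- t) + H t) has_real_derivative 0) (at s)" for s
  proof -
    have "((\<lambda>t. H (- t)) has_real_derivative h (- s) * (- 1)) (at s)"
      by (rule DERIV_chain2[OF H(1)]) (auto intro!: derivative_eq_intros)
    from DERIV_add[OF this H(1)[of s]] show ?thesis by (simp add: even)
  qed
  then have "H (- t) + H t = H (- 0) + H 0"
    by (intro DERIV_isconst_all) blast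
  then show ?thesis using H(2) by simp
qed

lemma deriv_compare:
  fixes A B :: "real \<Rightarrow> real"
  assumes "r \<le> t" "A r \<le> B r"
    and "\<And>s. r \<le> s \<Longrightarrow> s \<le> t \<Longrightarrow> (A has_real_derivative a s) (at s)"
    and "\<And>s. r \<le> s \<Longrightarrow> s \<le> t \<Longrightarrow> (B has_real_derivative b s) (at s)"
    and "\<And>s. r \<le> s \<Longrightarrow> s \<le> t \<Longrightarrow> a s \<le> b s"
  shows "A t \<le> B t"
proof -
  have "B r - A r \<le> B t - A t"
  proof (rule DERIV_nonneg_imp_nondecreasing[OF assms(1)])
    fix s assume s: "r \<le> s" "s \<le> t"
    show "\<exists>y. ((\<lambda>s. B s - A s) has_real_derivative y) (at s) \<and> 0 \<le> y"
      using DERIV_diff[OF assms(4)[OF s] assms(3)[OF s]] assms(5)[OF s] by (intro exI[of _ "b s - a s"]) auto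
  qed
  then show ?thesis using assms(2) by simp
qed

text \<open>
  The profiles of the energy method: \<open>H (d)\<close> is the test function and \<open>K (d)\<close> the function to which
  the Sobolev inequality is applied. They are tied by \<open>H' = (K')\<^sup>2\<close>, so that testing with \<open>H (d)\<close>
  produces the square of the gradient of \<open>K (d)\<close>. Continuity and boundedness of \<open>h = K'\<close> make both
  of them admissible for the chain rule.
\<close>

definition admissible :: "(real \<Rightarrow> real) \<Rightarrow> (real \<Rightarrow> real) \<Rightarrow> (real \<Rightarrow> real) \<Rightarrow> bool" where
  "admissible h H K \<longleftrightarrow> continuous_on UNIV h \<and> (\<exists>M. \<forall>t. \<bar>h t\<bar> \<le> M) \<and> H 0 = 0 \<and> K 0 = 0 \<and>
     (\<forall>t. (H has_real_derivative (h t)\<^sup>2) (at t)) \<and> (\<forall>t. (K has_real_derivative h t) (at t))"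

lemma admissible_exists:
  assumes "continuous_on UNIV h" "\<And>t. \<bar>h t\<bar> \<le> M"
  obtains H K where "admissible h H K"
proof -
  have c2: "continuous_on UNIV (\<lambda>t. (h t)\<^sup>2)" by (intro continuous_intros assms(1))
  obtain H where H: "H 0 = 0" "\<And>t. (H has_real_derivative (h t)\<^sup>2) (at t)"
    using primitive_exists[OF c2] by blast
  obtain K where K: "K 0 = 0" "\<And>t. (K has_real_derivative h t) (at t)"
    using primitive_exists[OF assms(1)] by blast
  have "admissible h H K" unfolding admissible_def using H K assms by auto
  then show ?thesis by (rule that)
qed

section \<open>Weak solutions\<close>

lemma (in vector_fields) Holder_Lint:
  fixes f g :: "real^'n \<Rightarrow> real"
  assumes "1 < p" "1 < q" "1 / p + 1 / q = 1" "f \<in> Lp \<Omega> (ereal p)" "g \<in> Lp \<Omega> (ereal q)"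
  shows "integrable (lebesgue_on \<Omega>) (\<lambda>x. f x * g x)"
    and "(LINT x|lebesgue_on \<Omega>. \<bar>f x * g x\<bar>) \<le> Lint \<Omega> p f powr (1 / p) * Lint \<Omega> q g powr (1 / q)"
    and "(LINT x|lebesgue_on \<Omega>. f x * g x) \<le> Lint \<Omega> p f powr (1 / p) * Lint \<Omega> q g powr (1 / q)"
proof -
  have m: "f \<in> borel_measurable (lebesgue_on \<Omega>)" "g \<in> borel_measurable (lebesgue_on \<Omega>)"
    and i: "integrable (lebesgue_on \<Omega>) (\<lambda>x. \<bar>f x\<bar> powr p)" "integrable (lebesgue_on \<Omega>) (\<lambda>x. \<bar>g x\<bar> powr q)"
    using assms(4,5) by (simp_all add: Lp_iff)
  show int: "integrable (lebesgue_on \<Omega>) (\<lambda>x. f x * g x)"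
    by (rule Holder_inequality(1)[OF assms(1-3) m i])
  show *: "(LINT x|lebesgue_on \<Omega>. \<bar>f x * g x\<bar>) \<le> Lint \<Omega> p f powr (1 / p) * Lint \<Omega> q g powr (1 / q)"
    using Holder_inequality(2)[OF assms(1-3) m i] by simp
  have "(LINT x|lebesgue_on \<Omega>. f x * g x) \<le> (LINT x|lebesgue_on \<Omega>. \<bar>f x * g x\<bar>)"
    by (intro integral_mono integrable_abs int) simp
  with * show "(LINT x|lebesgue_on \<Omega>. f x * g x) \<le> Lint \<Omega> p f powr (1 / p) * Lint \<Omega> q g powr (1 / q)" by linarith
qed

locale sobolev_setting = vector_fields \<Omega> X
  for \<Omega> :: "(real^'n) set" and X :: "'m::finite \<Rightarrow> real^'n \<Rightarrow> real^'n" +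
  fixes Q \<alpha> :: real
  assumes Q_gt_2: "2 < Q" and \<alpha>_pos: "0 < \<alpha>"
    and Sobolev: "\<forall>q. 1 \<le> q \<and> q < Q \<longrightarrow> (\<exists>S. Sobolev_ineq \<Omega> X Q q S)"
begin

lemma Sobolev_inequality:
  assumes "1 \<le> q" "q < Q"
  obtains S where "0 < S" "\<And>u G. W0_grad \<Omega> X q u G \<Longrightarrow> u \<in> Lp \<Omega> (ereal (star_exp Q q)) \<and>
     Lint \<Omega> (star_exp Q q) u powr (1 / star_exp Q q) \<le> S * Lint \<Omega> q G powr (1 / q)"
proof -
  obtain S where S: "Sobolev_ineq \<Omega> X Q q S" using Sobolev assms by blast
  show ?thesis
  proof (rule that[of "max S 1"])
    fix u G assume W: "W0_grad \<Omega> X q u G"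
    then have "u \<in> W0 \<Omega> X q" unfolding W0_def by blast
    then have u: "u \<in> Lp \<Omega> (ereal (star_exp Q q))" "Lp_norm \<Omega> (ereal (star_exp Q q)) u \<le> S * W0_norm \<Omega> X q u"
      using S unfolding Sobolev_ineq_def by blast+
    have "S * Lint \<Omega> q G powr (1 / q) \<le> max S 1 * Lint \<Omega> q G powr (1 / q)"
      by (intro mult_right_mono) auto
    with u W0_norm_eq[OF W assms(1)]
    show "u \<in> Lp \<Omega> (ereal (star_exp Q q)) \<and>
     Lint \<Omega> (star_exp Q q) u powr (1 / star_exp Q q) \<le> max S 1 * Lint \<Omega> q G powr (1 / q)"
      by (simp add: Lp_norm_ereal)
  qed simp
qed

text \<open>The Sobolev exponent of \<open>2\<close> and its conjugate exponent.\<close>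

abbreviation two_star :: real where "two_star \<equiv> 2 * Q / (Q - 2)"
abbreviation two_star_conj :: real where "two_star_conj \<equiv> 2 * Q / (Q + 2)"

lemma exponents:
  "1 < two_star_conj" "two_star_conj < 2" "2 < two_star" "1 / two_star_conj + 1 / two_star = 1" "star_exp Q 2 = two_star"
  using Q_gt_2 by (auto simp: field_simps star_exp_def)

text \<open>
  The upper ellipticity bound is quantified away because the constants may depend on \<open>\<alpha>\<close> only. The datum
  lies in the dual of \<open>L\<close> to the Sobolev exponent, so its products with elements of \<open>W\<^sub>0\<^sup>1\<^sup>,\<^sup>2\<close> are integrable.
\<close>

definition solves :: "(real^'n \<Rightarrow> real^'m^'m) \<Rightarrow> (real^'n \<Rightarrow> real) \<Rightarrow> (real^'n \<Rightarrow> real) \<Rightarrow> bool" where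
  "solves A F d \<longleftrightarrow> (\<exists>\<beta>. elliptic \<Omega> \<alpha> \<beta> A) \<and> F \<in> Lp \<Omega> (ereal two_star_conj) \<and> weak_solution \<Omega> X A F d"

lemma solves_W0_grad: "solves A F d \<Longrightarrow> W0_grad \<Omega> X 2 d (Xgrad \<Omega> X d)"
  by (simp add: solves_def weak_solution_def W0_iff)

lemma Lp2_square_integrable:
  fixes G :: "real^'n \<Rightarrow> real^'m"
  shows "G \<in> Lp \<Omega> (ereal 2) \<Longrightarrow> integrable (lebesgue_on \<Omega>) (\<lambda>x. (norm (G x))\<^sup>2)"
  by (simp add: Lp_iff)

lemma matrix_form_eq: "(M *v v) \<bullet> w = (\<Sum>i\<in>UNIV. (\<Sum>j\<in>UNIV. M $ i $ j * v $ j) * w $ i)"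
  for M :: "real^'m^'m"
  by (simp add: matrix_vector_mult_def inner_vec_def)

lemma vec_nth_measurable: "f \<in> borel_measurable N \<Longrightarrow> (\<lambda>x. f x $ i) \<in> borel_measurable N"
  for f :: "'z \<Rightarrow> ('b::euclidean_space)^'k"
  by (rule measurable_compose[of f N borel "\<lambda>v. v $ i"])
     (auto intro!: borel_measurable_continuous_onI continuous_intros)

lemma elliptic_form:
  fixes A :: "real^'n \<Rightarrow> real^'m^'m"
  assumes A: "elliptic \<Omega> \<alpha> \<beta> A" and G: "G \<in> Lp \<Omega> (ereal 2)" and H: "H \<in> Lp \<Omega> (ereal 2)"
  shows "(\<lambda>x. (A x *v G x) \<bullet> H x) \<in> borel_measurable (lebesgue_on \<Omega>)"
    and "integrable (lebesgue_on \<Omega>) (\<lambda>x. (A x *v G x) \<bullet> H x)"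
proof -
  have Am: "A \<in> borel_measurable (lebesgue_on \<Omega>)" using A by (simp add: elliptic_def)
  have Gm: "G \<in> borel_measurable (lebesgue_on \<Omega>)" and Hm: "H \<in> borel_measurable (lebesgue_on \<Omega>)"
    using G H by (auto intro: Lp_borel)
  have Aij: "(\<lambda>x. A x $ i $ j) \<in> borel_measurable (lebesgue_on \<Omega>)" for i j
    by (intro vec_nth_measurable Am)
  have Gi: "(\<lambda>x. G x $ i) \<in> borel_measurable (lebesgue_on \<Omega>)"
    and Hi: "(\<lambda>x. H x $ i) \<in> borel_measurable (lebesgue_on \<Omega>)" for i
    by (intro vec_nth_measurable Gm Hm)+
  show m: "(\<lambda>x. (A x *v G x) \<bullet> H x) \<in> borel_measurable (lebesgue_on \<Omega>)"
    unfolding matrix_form_eq by (intro borel_measurable_sum borel_measurable_times Aij Gi Hi)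
  obtain M where M: "\<And>x i j. x \<in> \<Omega> \<Longrightarrow> \<bar>A x $ i $ j\<bar> \<le> M" using A unfolding elliptic_def by blast
  let ?m = "real CARD('m)"
  have le: "\<bar>(A x *v G x) \<bullet> H x\<bar> \<le> ?m * (?m * max M 0) * ((norm (G x))\<^sup>2 + (norm (H x))\<^sup>2)" if x: "x \<in> \<Omega>" for x
  proof -
    have Mx: "\<bar>A x $ i $ j\<bar> \<le> max M 0" for i j using M[OF x, of i j] by simp
    have "\<bar>(A x *v G x) \<bullet> H x\<bar> \<le> (\<Sum>i\<in>(UNIV::'m set). (\<Sum>j\<in>(UNIV::'m set). max M 0 * norm (G x)) * norm (H x))"
      unfolding matrix_form_eq
    proof (rule order.trans[OF sum_abs], rule sum_mono)
      fix i
      have "\<bar>\<Sum>j\<in>UNIV. A x $ i $ j * G x $ j\<bar> \<le> (\<Sum>j\<in>(UNIV::'m set). max M 0 * norm (G x))"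
      proof (rule order.trans[OF sum_abs], rule sum_mono)
        fix j show "\<bar>A x $ i $ j * G x $ j\<bar> \<le> max M 0 * norm (G x)"
          unfolding abs_mult by (intro mult_mono Mx component_le_norm_cart) auto
      qed
      then show "\<bar>(\<Sum>j\<in>UNIV. A x $ i $ j * G x $ j) * H x $ i\<bar> \<le> (\<Sum>j\<in>(UNIV::'m set). max M 0 * norm (G x)) * norm (H x)"
        unfolding abs_mult by (intro mult_mono component_le_norm_cart sum_nonneg) auto
    qed
    also have "\<dots> = ?m * (?m * max M 0) * (norm (G x) * norm (H x))" by simp
    also have "\<dots> \<le> ?m * (?m * max M 0) * ((norm (G x))\<^sup>2 + (norm (H x))\<^sup>2)"
    proof (rule mult_left_mono)
      have "2 * (norm (G x) * norm (H x)) \<le> (norm (G x))\<^sup>2 + (norm (H x))\<^sup>2"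
        using sum_squares_bound[of "norm (G x)" "norm (H x)"] by simp
      moreover have "0 \<le> norm (G x) * norm (H x)" by simp
      ultimately show "norm (G x) * norm (H x) \<le> (norm (G x))\<^sup>2 + (norm (H x))\<^sup>2" by linarith
    qed simp
    finally show ?thesis .
  qed
  have i: "integrable (lebesgue_on \<Omega>) (\<lambda>x. ?m * (?m * max M 0) * ((norm (G x))\<^sup>2 + (norm (H x))\<^sup>2))"
    by (intro integrable_mult_right Bochner_Integration.integrable_add Lp2_square_integrable G H)
  show "integrable (lebesgue_on \<Omega>) (\<lambda>x. (A x *v G x) \<bullet> H x)"
    by (rule Bochner_Integration.integrable_bound[OF i m], rule AE_I2)
       (use le in \<open>simp add: abs_mult order.trans[OF le abs_ge_self]\<close>)
qed

lemma W0_in_L_two_star: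
  assumes "W0_grad \<Omega> X 2 w G" shows "w \<in> Lp \<Omega> (ereal two_star)"
  using Sobolev_inequality[of 2] Q_gt_2 assms exponents(5) by (metis one_le_numeral)

lemma datum_integrable:
  assumes "F \<in> Lp \<Omega> (ereal two_star_conj)" "W0_grad \<Omega> X 2 w G"
  shows "integrable (lebesgue_on \<Omega>) (\<lambda>x. F x * w x)"
  by (rule Holder_Lint(1)[OF exponents(1) _ exponents(4) assms(1) W0_in_L_two_star[OF assms(2)]])
     (use exponents(3) in simp)

lemma solves_test:
  assumes s: "solves A F d" and W: "W0_grad \<Omega> X 2 w G"
  shows "(LINT x|lebesgue_on \<Omega>. (A x *v Xgrad \<Omega> X d x) \<bullet> G x) = (LINT x|lebesgue_on \<Omega>. F x * w x)"
proof -
  obtain \<beta> where A: "elliptic \<Omega> \<alpha> \<beta> A" using s by (auto simp: solves_def)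
  have w: "w \<in> W0 \<Omega> X 2" using W unfolding W0_def by blast
  have W': "W0_grad \<Omega> X 2 w (Xgrad \<Omega> X w)" and ae: "AE x in lebesgue_on \<Omega>. Xgrad \<Omega> X w x = G x"
    using Xgrad_AE_eq[OF W] by simp_all
  note mem = W0_grad_memD(2)[OF solves_W0_grad[OF s]] W0_grad_memD(2)[OF W] W0_grad_memD(2)[OF W']
  have "(LINT x|lebesgue_on \<Omega>. (A x *v Xgrad \<Omega> X d x) \<bullet> G x)
      = (LINT x|lebesgue_on \<Omega>. (A x *v Xgrad \<Omega> X d x) \<bullet> Xgrad \<Omega> X w x)"
    by (rule integral_cong_AE[OF elliptic_form(1)[OF A mem(1,2)] elliptic_form(1)[OF A mem(1,3)]])
       (use ae in eventually_elim, simp)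
  also have "\<dots> = (LINT x|lebesgue_on \<Omega>. F x * w x)"
    using s w unfolding solves_def weak_solution_def by blast
  finally show ?thesis .
qed

lemma solves_lincomb:
  assumes s: "solves A F u" and t: "solves A F' v"
  shows "solves A (\<lambda>x. a * F x + b * F' x) (\<lambda>x. a * u x + b * v x)"
proof -
  obtain \<beta> where A: "elliptic \<Omega> \<alpha> \<beta> A" using s by (auto simp: solves_def)
  have F: "F \<in> Lp \<Omega> (ereal two_star_conj)" "F' \<in> Lp \<Omega> (ereal two_star_conj)" using s t by (auto simp: solves_def)
  let ?d = "\<lambda>x. a * u x + b * v x"
  have W: "W0_grad \<Omega> X 2 ?d (\<lambda>x. a *\<^sub>R Xgrad \<Omega> X u x + b *\<^sub>R Xgrad \<Omega> X v x)"
    by (rule W0_grad_lincomb[OF solves_W0_grad[OF s] solves_W0_grad[OF t]]) simp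
  note W' = Xgrad_AE_eq[OF W]
  have F'': "(\<lambda>x. a * F x + b * F' x) \<in> Lp \<Omega> (ereal two_star_conj)"
    using Lp_add[OF Lp_scale[OF F(1), of a] Lp_scale[OF F(2), of b]] exponents(1) by simp
  have "(LINT x|lebesgue_on \<Omega>. (A x *v Xgrad \<Omega> X ?d x) \<bullet> Xgrad \<Omega> X w x)
      = (LINT x|lebesgue_on \<Omega>. (a * F x + b * F' x) * w x)" if "w \<in> W0 \<Omega> X 2" for w
  proof -
    have Ww: "W0_grad \<Omega> X 2 w (Xgrad \<Omega> X w)" using that by (simp add: W0_iff)
    have m1: "(\<lambda>x. (A x *v Xgrad \<Omega> X ?d x) \<bullet> Xgrad \<Omega> X w x) \<in> borel_measurable (lebesgue_on \<Omega>)"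
      using W'(2) Ww by (intro elliptic_form(1)[OF A] W0_grad_memD(2)) auto
    have i1: "integrable (lebesgue_on \<Omega>) (\<lambda>x. (A x *v Xgrad \<Omega> X u x) \<bullet> Xgrad \<Omega> X w x)"
      by (rule elliptic_form(2)[OF A W0_grad_memD(2)[OF solves_W0_grad[OF s]] W0_grad_memD(2)[OF Ww]])
    have i2: "integrable (lebesgue_on \<Omega>) (\<lambda>x. (A x *v Xgrad \<Omega> X v x) \<bullet> Xgrad \<Omega> X w x)"
      by (rule elliptic_form(2)[OF A W0_grad_memD(2)[OF solves_W0_grad[OF t]] W0_grad_memD(2)[OF Ww]])
    have "(LINT x|lebesgue_on \<Omega>. (A x *v Xgrad \<Omega> X ?d x) \<bullet> Xgrad \<Omega> X w x)
        = (LINT x|lebesgue_on \<Omega>. a * ((A x *v Xgrad \<Omega> X u x) \<bullet> Xgrad \<Omega> X w x) + b * ((A x *v Xgrad \<Omega> X v x) \<bullet> Xgrad \<Omega> X w x))"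
    proof (rule integral_cong_AE[OF m1])
      show "(\<lambda>x. a * ((A x *v Xgrad \<Omega> X u x) \<bullet> Xgrad \<Omega> X w x) + b * ((A x *v Xgrad \<Omega> X v x) \<bullet> Xgrad \<Omega> X w x)) \<in> borel_measurable (lebesgue_on \<Omega>)"
        using i1 i2 by (intro borel_measurable_integrable Bochner_Integration.integrable_add integrable_mult_right)
      show "AE x in lebesgue_on \<Omega>. (A x *v Xgrad \<Omega> X ?d x) \<bullet> Xgrad \<Omega> X w x
         = a * ((A x *v Xgrad \<Omega> X u x) \<bullet> Xgrad \<Omega> X w x) + b * ((A x *v Xgrad \<Omega> X v x) \<bullet> Xgrad \<Omega> X w x)"
        using W'(1)[OF one_le_numeral]
        by eventually_elim (simp add: matrix_vector_right_distrib matrix_vector_mult_scaleR inner_add_left)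
    qed
    also have "\<dots> = a * (LINT x|lebesgue_on \<Omega>. F x * w x) + b * (LINT x|lebesgue_on \<Omega>. F' x * w x)"
      using i1 i2 solves_test[OF s Ww] solves_test[OF t Ww] by simp
    also have "\<dots> = (LINT x|lebesgue_on \<Omega>. (a * F x + b * F' x) * w x)"
      using datum_integrable[OF F(1) Ww] datum_integrable[OF F(2) Ww] by (simp add: distrib_right mult.assoc)
    finally show ?thesis .
  qed
  moreover have "?d \<in> W0 \<Omega> X 2" using W unfolding W0_def by blast
  ultimately show ?thesis using A F'' unfolding solves_def weak_solution_def by blast
qed

lemma solves_diff: "solves A F u \<Longrightarrow> solves A F' v \<Longrightarrow> solves A (\<lambda>x. F x - F' x) (\<lambda>x. u x - v x)"
  using solves_lincomb[of A F u F' v 1 "-1"] by simp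

lemma solves_scale: "solves A F u \<Longrightarrow> solves A (\<lambda>x. a * F x) (\<lambda>x. a * u x)"
  using solves_lincomb[of A F u F u a 0] by simp

text \<open>
  The energy estimate behind all bounds. Testing with \<open>H(d)\<close>, where \<open>H' = h\<^sup>2\<close>, controls the gradient
  \<open>h(d) Xd\<close> of \<open>K(d)\<close>, where \<open>K' = h\<close>, and the Sobolev inequality then controls \<open>K(d)\<close> itself.
\<close>

lemma energy:
  assumes s: "solves A F d" and ad: "admissible h H K"
  shows "W0_grad \<Omega> X 2 (\<lambda>x. H (d x)) (\<lambda>x. (h (d x))\<^sup>2 *\<^sub>R Xgrad \<Omega> X d x)"
    and "W0_grad \<Omega> X 2 (\<lambda>x. K (d x)) (\<lambda>x. h (d x) *\<^sub>R Xgrad \<Omega> X d x)"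
    and "\<alpha> * Lint \<Omega> 2 (\<lambda>x. h (d x) *\<^sub>R Xgrad \<Omega> X d x) \<le> (LINT x|lebesgue_on \<Omega>. F x * H (d x))"
proof -
  let ?G = "Xgrad \<Omega> X d"
  note W = solves_W0_grad[OF s]
  obtain \<beta> where A: "elliptic \<Omega> \<alpha> \<beta> A" using s by (auto simp: solves_def)
  obtain M where hc: "continuous_on UNIV h" and M: "\<And>t. \<bar>h t\<bar> \<le> M" and H0: "H 0 = 0" and K0: "K 0 = 0"
    and H: "\<And>t. (H has_real_derivative (h t)\<^sup>2) (at t)" and K: "\<And>t. (K has_real_derivative h t) (at t)"
    using ad unfolding admissible_def by blast
  have M2: "\<bar>(h t)\<^sup>2\<bar> \<le> M\<^sup>2" for t using power_mono[OF M[of t], of 2] by simp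
  have h2c: "continuous_on UNIV (\<lambda>t. (h t)\<^sup>2)" by (intro continuous_intros hc)
  show WH: "W0_grad \<Omega> X 2 (\<lambda>x. H (d x)) (\<lambda>x. (h (d x))\<^sup>2 *\<^sub>R ?G x)"
    by (rule W0_grad_chain[OF W one_le_numeral H H0 h2c M2])
  show WK: "W0_grad \<Omega> X 2 (\<lambda>x. K (d x)) (\<lambda>x. h (d x) *\<^sub>R ?G x)"
    by (rule W0_grad_chain[OF W one_le_numeral K K0 hc M])
  have "\<alpha> * Lint \<Omega> 2 (\<lambda>x. h (d x) *\<^sub>R ?G x) = (LINT x|lebesgue_on \<Omega>. \<alpha> * (norm (h (d x) *\<^sub>R ?G x))\<^sup>2)"
    by simp
  also have "\<dots> \<le> (LINT x|lebesgue_on \<Omega>. (A x *v ?G x) \<bullet> ((h (d x))\<^sup>2 *\<^sub>R ?G x))"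
  proof (rule integral_mono)
    show "integrable (lebesgue_on \<Omega>) (\<lambda>x. \<alpha> * (norm (h (d x) *\<^sub>R ?G x))\<^sup>2)"
      by (intro integrable_mult_right Lp2_square_integrable W0_grad_memD(2)[OF WK])
    show "integrable (lebesgue_on \<Omega>) (\<lambda>x. (A x *v ?G x) \<bullet> ((h (d x))\<^sup>2 *\<^sub>R ?G x))"
      by (rule elliptic_form(2)[OF A W0_grad_memD(2)[OF W] W0_grad_memD(2)[OF WH]])
    fix x assume "x \<in> space (lebesgue_on \<Omega>)"
    then have "\<alpha> * (norm (?G x))\<^sup>2 \<le> (A x *v ?G x) \<bullet> ?G x" using A unfolding elliptic_def by simp
    from mult_left_mono[OF this zero_le_power2[of "h (d x)"]]
    show "\<alpha> * (norm (h (d x) *\<^sub>R ?G x))\<^sup>2 \<le> (A x *v ?G x) \<bullet> ((h (d x))\<^sup>2 *\<^sub>R ?G x)"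
      by (simp add: power_mult_distrib mult_ac)
  qed
  also have "\<dots> = (LINT x|lebesgue_on \<Omega>. F x * H (d x))" by (rule solves_test[OF s WH])
  finally show "\<alpha> * Lint \<Omega> 2 (\<lambda>x. h (d x) *\<^sub>R ?G x) \<le> (LINT x|lebesgue_on \<Omega>. F x * H (d x))" .
qed

text \<open>
  The starting point of every estimate below: each of them is a choice of \<open>h\<close> for which the right-hand
  side can be absorbed or is bounded outright.
\<close>

lemma energy_Sobolev:
  obtains S where "0 < S" "\<And>A F d h H K. solves A F d \<Longrightarrow> admissible h H K \<Longrightarrow>
    Lint \<Omega> two_star (\<lambda>x. K (d x)) powr (2 / two_star) \<le> S * (LINT x|lebesgue_on \<Omega>. F x * H (d x))"
proof -
  obtain S where S: "0 < S" "\<And>u G. W0_grad \<Omega> X 2 u G \<Longrightarrow> u \<in> Lp \<Omega> (ereal (star_exp Q 2)) \<and>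
     Lint \<Omega> (star_exp Q 2) u powr (1 / star_exp Q 2) \<le> S * Lint \<Omega> 2 G powr (1 / 2)"
    using Sobolev_inequality[of 2] Q_gt_2 by auto
  show ?thesis
  proof (rule that[of "S\<^sup>2 / \<alpha>"])
    fix A F d h H K assume s: "solves A F d" and ad: "admissible h H K"
    let ?Y = "Lint \<Omega> two_star (\<lambda>x. K (d x))" and ?E = "Lint \<Omega> 2 (\<lambda>x. h (d x) *\<^sub>R Xgrad \<Omega> X d x)"
    have "?Y powr (1 / two_star) \<le> S * ?E powr (1 / 2)"
      using S(2)[OF energy(2)[OF s ad]] unfolding exponents(5) by blast
    then have "(?Y powr (1 / two_star)) powr 2 \<le> (S * ?E powr (1 / 2)) powr 2"
      by (intro powr_mono2) auto
    moreover have "(?Y powr (1 / two_star)) powr 2 = ?Y powr (2 / two_star)"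
      unfolding powr_powr by (simp only: times_divide_eq_left mult_1_left)
    moreover have "(S * ?E powr (1 / 2)) powr 2 = S\<^sup>2 * ?E"
      using S(1) by (simp add: powr_powr powr_mult)
    ultimately have "?Y powr (2 / two_star) \<le> S\<^sup>2 * ?E" by simp
    also have "?E \<le> (LINT x|lebesgue_on \<Omega>. F x * H (d x)) / \<alpha>"
      using energy(3)[OF s ad] \<alpha>_pos by (simp add: field_simps)
    finally show "?Y powr (2 / two_star) \<le> S\<^sup>2 / \<alpha> * (LINT x|lebesgue_on \<Omega>. F x * H (d x))"
      using S(1) by (simp add: mult_left_mono)
  qed (use S(1) \<alpha>_pos in simp)
qed

end

section \<open>Iteration and absorption\<close>

lemma integrable_Fatou:
  fixes f :: "'a \<Rightarrow> real"
  assumes fn: "\<And>n. integrable M (F n)" "\<And>n x. 0 \<le> F n x" "\<And>n. (\<integral>x. F n x \<partial>M) \<le> C"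
    and f: "f \<in> borel_measurable M" "\<And>x. 0 \<le> f x" and lim: "\<And>x. x \<in> space M \<Longrightarrow> (\<lambda>n. F n x) \<longlonglongrightarrow> f x" and C: "0 \<le> C"
  shows "integrable M f" "(\<integral>x. f x \<partial>M) \<le> C"
proof -
  note [measurable] = borel_measurable_integrable[OF fn(1)] f(1)
  have "(\<integral>\<^sup>+x. ennreal (f x) \<partial>M) \<le> (\<integral>\<^sup>+x. liminf (\<lambda>n. ennreal (F n x)) \<partial>M)"
  proof (rule nn_integral_mono)
    fix x assume x: "x \<in> space M"
    have "(\<lambda>n. ennreal (F n x)) \<longlonglongrightarrow> ennreal (f x)" by (rule tendsto_ennrealI[OF lim[OF x]])
    then show "ennreal (f x) \<le> liminf (\<lambda>n. ennreal (F n x))"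
      using lim_imp_Liminf[OF sequentially_bot] by fastforce
  qed
  also have "\<dots> \<le> liminf (\<lambda>n. \<integral>\<^sup>+x. ennreal (F n x) \<partial>M)" by (rule nn_integral_liminf) measurable
  also have "\<dots> \<le> ennreal C"
  proof (rule Liminf_le)
    have "(\<integral>\<^sup>+x. ennreal (F n x) \<partial>M) \<le> ennreal C" for n
      using nn_integral_eq_integral[OF fn(1)[of n]] fn(2)[of n] fn(3)[of n] by (simp add: ennreal_leI)
    then show "\<forall>\<^sub>F n in sequentially. (\<integral>\<^sup>+x. ennreal (F n x) \<partial>M) \<le> ennreal C" by simp
  qed simp
  finally have le: "(\<integral>\<^sup>+x. ennreal (f x) \<partial>M) \<le> ennreal C" .
  show int: "integrable M f"
    by (rule integrableI_bounded) (use le f(2) in \<open>auto simp: le_less_trans\<close>)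
  have "ennreal (\<integral>x. f x \<partial>M) \<le> ennreal C"
    using le nn_integral_eq_integral[OF int] f(2) by simp
  then show "(\<integral>x. f x \<partial>M) \<le> C" using C by simp
qed

text \<open>
  Stampacchia's iteration: the levels \<open>D (1 - 2\<^sup>-\<^sup>j)\<close> are reached with geometrically decreasing
  values of \<open>\<mu>\<close>, because \<open>\<delta> > 1\<close> beats the factors \<open>2\<^sup>a\<^sup>j\<close>.
\<close>

lemma Stampacchia_iteration:
  fixes m B a \<delta> :: real
  assumes "0 < B" "0 < a" "1 < \<delta>"
  obtains D where "0 < D" "\<And>\<mu>. (\<And>k. 0 \<le> \<mu> k) \<Longrightarrow> \<mu> 0 \<le> m \<Longrightarrow> (\<And>k l. k \<le> l \<Longrightarrow> \<mu> l \<le> \<mu> k) \<Longrightarrow>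
    (\<And>k e. 0 \<le> k \<Longrightarrow> 0 < e \<Longrightarrow> \<mu> (k + e) \<le> (B / e) powr a * \<mu> k powr \<delta>) \<Longrightarrow> \<mu> D = (0::real)"
proof -
  define n where "n = max m 1"
  define \<theta> where "\<theta> = 2 powr (- a / (\<delta> - 1))"
  define D where "D = 2 * B * (n powr (\<delta> - 1) / \<theta>) powr (1 / a)"
  have n: "1 \<le> n" "m \<le> n" by (auto simp: n_def)
  have \<theta>: "0 < \<theta>" "\<theta> < 1"
  proof -
    show "0 < \<theta>" by (simp add: \<theta>_def)
    have "- a / (\<delta> - 1) < 0" using assms by (simp add: field_simps)
    then have "2 powr (- a / (\<delta> - 1)) < (2::real) powr 0" by (intro powr_less_mono) auto
    then show "\<theta> < 1" unfolding \<theta>_def by simp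
  qed
  have \<theta>2: "2 powr a * \<theta> powr \<delta> = \<theta>"
  proof -
    have "a + - a / (\<delta> - 1) * \<delta> = - a / (\<delta> - 1)" using assms by (simp add: field_simps)
    then show ?thesis unfolding \<theta>_def by (simp add: powr_powr flip: powr_add)
  qed
  have D: "0 < D" using assms \<theta> n by (simp add: D_def)
  have Dn: "(2 * B / D) powr a * n powr \<delta> = \<theta> * n"
  proof -
    have "2 * B / D = (n powr (\<delta> - 1) / \<theta>) powr (- (1 / a))"
      using assms \<theta> n by (simp add: D_def powr_minus_divide)
    then have "(2 * B / D) powr a = (n powr (\<delta> - 1) / \<theta>) powr (- 1)"
      using assms by (simp add: powr_powr)
    also have "\<dots> = \<theta> / n powr (\<delta> - 1)" using \<theta> n by (simp add: powr_minus_divide)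
    also have "n powr (\<delta> - 1) = n powr \<delta> / n" using n by (simp add: powr_diff)
    finally show ?thesis using n by simp
  qed
  show ?thesis
  proof (rule that[OF D])
    fix \<mu> :: "real \<Rightarrow> real"
    assume \<mu>: "\<And>k. 0 \<le> \<mu> k" "\<mu> 0 \<le> m" "\<And>k l. k \<le> l \<Longrightarrow> \<mu> l \<le> \<mu> k"
      and step: "\<And>k e. 0 \<le> k \<Longrightarrow> 0 < e \<Longrightarrow> \<mu> (k + e) \<le> (B / e) powr a * \<mu> k powr \<delta>"
    have le: "\<mu> (D * (1 - (1 / 2) ^ j)) \<le> n * \<theta> ^ j" for j
    proof (induction j)
      case 0
      then show ?case using \<mu>(2) n by simp
    next
      case (Suc j)
      let ?k = "D * (1 - (1 / 2) ^ j)" and ?e = "D * (1 / 2) ^ Suc j"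
      have k: "0 \<le> ?k" "0 < ?e" using D by (auto simp: power_le_one)
      have "\<mu> (D * (1 - (1 / 2) ^ Suc j)) = \<mu> (?k + ?e)" by (simp add: algebra_simps)
      also have "\<dots> \<le> (B / ?e) powr a * \<mu> ?k powr \<delta>" by (rule step[OF k])
      also have "\<dots> \<le> (B / ?e) powr a * (n * \<theta> ^ j) powr \<delta>"
        using Suc.IH \<mu>(1) assms(3) by (intro mult_left_mono powr_mono2) auto
      also have "B / ?e = (2 * B / D) * 2 ^ j" using D by (simp add: field_simps power_divide)
      also have "((2 * B / D) * 2 ^ j) powr a * (n * \<theta> ^ j) powr \<delta>
          = ((2 * B / D) powr a * n powr \<delta>) * (2 powr a * \<theta> powr \<delta>) ^ j"
      proof -
        have p: "(x ^ j) powr b = (x powr b) ^ j" if "0 < x" for x b :: real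
          using that by (simp add: powr_powr mult.commute flip: powr_realpow)
        show ?thesis
        proof -
          have c: "0 < 2 * B / D" using assms D by simp
          have "((2 * B / D) * 2 ^ j) powr a = (2 * B / D) powr a * (2 powr a) ^ j"
            by (simp only: powr_mult p[of 2] zero_less_numeral)
          moreover have "(n * \<theta> ^ j) powr \<delta> = n powr \<delta> * (\<theta> powr \<delta>) ^ j"
            by (simp only: powr_mult p[OF \<theta>(1)])
          ultimately show ?thesis by (simp add: power_mult_distrib)
        qed
      qed
      also have "\<dots> = n * \<theta> ^ Suc j" unfolding Dn \<theta>2 by simp
      finally show ?case .
    qed
    have "\<mu> D \<le> n * \<theta> ^ j" for j
    proof -
      have "D * (1 - (1 / 2) ^ j) \<le> D" using D by (simp add: mult_le_cancel_left1)
      from \<mu>(3)[OF this] le[of j] show ?thesis by linarith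
    qed
    moreover have "(\<lambda>j. n * \<theta> ^ j) \<longlonglongrightarrow> n * 0"
      using \<theta> by (intro tendsto_mult tendsto_const LIMSEQ_realpow_zero) auto
    ultimately have "\<mu> D \<le> n * 0" by (intro LIMSEQ_le_const) auto
    with \<mu>(1)[of D] show "\<mu> D = 0" by simp
  qed
qed

lemma (in finite_measure) measure_Markov_powr:
  assumes f: "f \<in> borel_measurable M" "integrable M (\<lambda>x. \<bar>f x\<bar> powr q)" and c: "0 < c" "0 < q"
    and S: "S \<in> sets M" "\<And>x. x \<in> S \<Longrightarrow> c \<le> \<bar>f x\<bar>"
  shows "measure M S * c powr q \<le> (\<integral>x. \<bar>f x :: real\<bar> powr q \<partial>M)"
proof -
  have "measure M S * c powr q = (\<integral>x. indicator S x * c powr q \<partial>M)"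
    using S(1) by simp
  also have "\<dots> \<le> (\<integral>x. \<bar>f x\<bar> powr q \<partial>M)"
  proof (rule integral_mono)
    show "integrable M (\<lambda>x. indicator S x * c powr q)" using S(1) by (intro integrable_mult_left integrable_real_indicator) (simp_all add: less_top[symmetric])
    show "indicator S x * c powr q \<le> \<bar>f x\<bar> powr q" for x
      using S(2)[of x] c by (cases "x \<in> S") (auto intro: powr_mono2)
  qed (rule f(2))
  finally show ?thesis .
qed

text \<open>Absorption: a smaller power of \<open>Y\<close> on the right bounds \<open>Y\<close>.\<close>

lemma powr_absorb:
  fixes Y :: real
  assumes "0 \<le> Y" "0 \<le> C" "0 \<le> D" "0 \<le> E" "0 \<le> \<theta>" "\<theta> < \<kappa>"
    and le: "Y powr \<kappa> \<le> C * (D + E * Y) powr \<theta>"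
  shows "Y \<le> max 1 ((C * (D + E) powr \<theta>) powr (1 / (\<kappa> - \<theta>)))"
proof (cases "Y \<le> 1")
  case False
  have "Y powr \<kappa> \<le> C * ((D + E) * Y) powr \<theta>"
  proof (rule order.trans[OF le], rule mult_left_mono[OF powr_mono2])
    have "D * 1 \<le> D * Y" using False assms by (intro mult_left_mono) auto
    then show "D + E * Y \<le> (D + E) * Y" by (simp add: distrib_right)
  qed (use assms in auto)
  also have "\<dots> = C * (D + E) powr \<theta> * Y powr \<theta>" using assms by (simp add: powr_mult)
  finally have "Y powr (\<kappa> - \<theta>) \<le> C * (D + E) powr \<theta>"
    using False by (simp add: powr_diff field_simps)
  then have "(Y powr (\<kappa> - \<theta>)) powr (1 / (\<kappa> - \<theta>)) \<le> (C * (D + E) powr \<theta>) powr (1 / (\<kappa> - \<theta>))"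
    using assms by (intro powr_mono2) auto
  moreover have "(Y powr (\<kappa> - \<theta>)) powr (1 / (\<kappa> - \<theta>)) = Y" using assms by (simp add: powr_powr)
  ultimately show ?thesis by simp
qed simp

section \<open>The one-parameter families of test functions\<close>

lemma admissible_even_abs:
  assumes ad: "admissible h H K" and even: "\<And>t. h (- t) = h t" and pos: "\<And>t. 0 \<le> h t"
  shows "\<bar>H t\<bar> = H \<bar>t\<bar>" "\<bar>K t\<bar> = K \<bar>t\<bar>"
proof -
  have H: "\<And>t. (H has_real_derivative (h t)\<^sup>2) (at t)" "H 0 = 0" and K: "\<And>t. (K has_real_derivative h t) (at t)" "K 0 = 0"
    using ad by (auto simp: admissible_def)
  have odd: "H (- t) = - H t" "K (- t) = - K t" for t
    by (rule primitive_odd[OF H], simp add: even) (rule primitive_odd[OF K even])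
  have "0 \<le> H t" "0 \<le> K t" if "0 \<le> t" for t
    using deriv_compare[OF that, of "\<lambda>_. 0" H "\<lambda>_. 0" "\<lambda>t. (h t)\<^sup>2"] H
      deriv_compare[OF that, of "\<lambda>_. 0" K "\<lambda>_. 0" h] K pos by auto
  then have "0 \<le> H \<bar>t\<bar>" "0 \<le> K \<bar>t\<bar>" by auto
  then show "\<bar>H t\<bar> = H \<bar>t\<bar>" "\<bar>K t\<bar> = K \<bar>t\<bar>"
    by (cases "0 \<le> t"; simp add: odd)+
qed

lemma DERIV_shifted_powr:
  fixes s c :: real
  assumes "0 \<le> s" "c \<noteq> 0"
  shows "((\<lambda>s. ((1 + s) powr c - 1) / c) has_real_derivative (1 + s) powr (c - 1)) (at s)"
  using assms by (auto intro!: derivative_eq_intros)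

text \<open>
  Here \<open>K\<close> is explicit, \<open>1 + \<gamma> \<bar>K t\<bar> = (1 + \<bar>t\<bar>)\<^sup>\<gamma>\<close>, and \<open>H\<close> behaves like the power \<open>2 \<gamma> - 1\<close> of
  \<open>1 + \<bar>t\<bar>\<close>: it grows at a controlled rate for \<open>\<gamma> > 1/2\<close> and is bounded for \<open>\<gamma> < 1/2\<close>.
\<close>

lemma power_family:
  fixes \<gamma> :: real
  assumes \<gamma>: "0 < \<gamma>" "\<gamma> \<le> 1"
  obtains H K where "admissible (\<lambda>t. (1 + \<bar>t\<bar>) powr (\<gamma> - 1)) H K"
    "\<And>t. 1 + \<gamma> * \<bar>K t\<bar> = (1 + \<bar>t\<bar>) powr \<gamma>"
    "\<And>t. 1 / 2 < \<gamma> \<Longrightarrow> \<bar>H t\<bar> \<le> 1 / (2 * \<gamma> - 1) * (1 + \<gamma> * \<bar>K t\<bar>) powr ((2 * \<gamma> - 1) / \<gamma>)"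
    "\<And>t. \<gamma> < 1 / 2 \<Longrightarrow> \<bar>H t\<bar> \<le> 1 / (1 - 2 * \<gamma>)"
proof -
  let ?h = "\<lambda>t::real. (1 + \<bar>t\<bar>) powr (\<gamma> - 1)"
  have bd: "\<bar>?h t\<bar> \<le> 1" for t
  proof -
    have "(1 + \<bar>t\<bar>) powr (\<gamma> - 1) \<le> (1 + \<bar>t\<bar>) powr 0" using \<gamma> by (intro powr_mono) auto
    moreover have "1 + \<bar>t\<bar> \<noteq> 0" using abs_ge_zero[of t] by linarith
    ultimately show ?thesis by simp
  qed
  have c: "continuous_on UNIV ?h" by (intro continuous_intros) (simp add: add_nonneg_eq_0_iff)
  obtain H K where ad: "admissible ?h H K" using admissible_exists[OF c bd] by blast
  have H: "\<And>t. (H has_real_derivative (?h t)\<^sup>2) (at t)" "H 0 = 0" and K: "\<And>t. (K has_real_derivative ?h t) (at t)" "K 0 = 0"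
    using ad by (auto simp: admissible_def)
  have absHK: "\<bar>H t\<bar> = H \<bar>t\<bar>" "\<bar>K t\<bar> = K \<bar>t\<bar>" for t
    by (rule admissible_even_abs[OF ad]; simp)+
  have Kt: "K t = ((1 + t) powr \<gamma> - 1) / \<gamma>" if t: "0 \<le> t" for t
  proof (rule antisym)
    have Kd: "(K has_real_derivative (1 + s) powr (\<gamma> - 1)) (at s)" if "0 \<le> s" for s
      using K(1)[of s] that by simp
    note Pd = DERIV_shifted_powr[OF _ less_imp_neq[OF \<gamma>(1), symmetric]]
    show "K t \<le> ((1 + t) powr \<gamma> - 1) / \<gamma>"
      by (rule deriv_compare[OF t _ Kd Pd]) (simp_all add: K)
    show "((1 + t) powr \<gamma> - 1) / \<gamma> \<le> K t"
      by (rule deriv_compare[OF t _ Pd Kd]) (simp_all add: K)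
  qed
  have KK: "1 + \<gamma> * \<bar>K t\<bar> = (1 + \<bar>t\<bar>) powr \<gamma>" for t
    unfolding absHK using Kt[of "\<bar>t\<bar>"] \<gamma> by simp
  have Ht: "H t \<le> ((1 + t) powr (2 * \<gamma> - 1) - 1) / (2 * \<gamma> - 1)" if t: "0 \<le> t" and g: "\<gamma> \<noteq> 1 / 2" for t
  proof -
    have sq: "(?h s)\<^sup>2 = (1 + s) powr (2 * \<gamma> - 1 - 1)" if "0 \<le> s" for s
    proof -
      have "(?h s)\<^sup>2 = (1 + s) powr ((\<gamma> - 1) + (\<gamma> - 1))" using that by (simp only: power2_eq_square powr_add abs_of_nonneg)
      then show ?thesis by (simp add: algebra_simps)
    qed
    show ?thesis
    proof (rule deriv_compare[OF t, of H "\<lambda>t. ((1 + t) powr (2 * \<gamma> - 1) - 1) / (2 * \<gamma> - 1)" "\<lambda>t. (?h t)\<^sup>2" "\<lambda>t. (1 + t) powr (2 * \<gamma> - 1 - 1)"])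
      show "((\<lambda>t. ((1 + t) powr (2 * \<gamma> - 1) - 1) / (2 * \<gamma> - 1)) has_real_derivative (1 + s) powr (2 * \<gamma> - 1 - 1)) (at s)" if "0 \<le> s" for s
        using DERIV_shifted_powr[OF that, of "2 * \<gamma> - 1"] g by simp
      show "(H has_real_derivative (?h s)\<^sup>2) (at s)" for s by (rule H(1))
      show "(?h s)\<^sup>2 \<le> (1 + s) powr (2 * \<gamma> - 1 - 1)" if "0 \<le> s" for s
        by (rule eq_refl[OF sq[OF that]])
    qed (simp add: H(2))
  qed
  show ?thesis
  proof (rule that[OF ad KK])
    fix t :: real assume g: "1 / 2 < \<gamma>"
    have "H \<bar>t\<bar> \<le> ((1 + \<bar>t\<bar>) powr (2 * \<gamma> - 1) - 1) / (2 * \<gamma> - 1)" using g by (intro Ht) auto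
    also have "\<dots> \<le> (1 + \<bar>t\<bar>) powr (2 * \<gamma> - 1) / (2 * \<gamma> - 1)" using g by (intro divide_right_mono) auto
    also have "(1 + \<bar>t\<bar>) powr (2 * \<gamma> - 1) = (1 + \<gamma> * \<bar>K t\<bar>) powr ((2 * \<gamma> - 1) / \<gamma>)"
      unfolding KK powr_powr using \<gamma> by simp
    finally show "\<bar>H t\<bar> \<le> 1 / (2 * \<gamma> - 1) * (1 + \<gamma> * \<bar>K t\<bar>) powr ((2 * \<gamma> - 1) / \<gamma>)"
      unfolding absHK by simp
  next
    fix t :: real assume g: "\<gamma> < 1 / 2"
    have "H \<bar>t\<bar> \<le> ((1 + \<bar>t\<bar>) powr (2 * \<gamma> - 1) - 1) / (2 * \<gamma> - 1)" using g by (intro Ht) auto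
    also have "\<dots> = (1 - (1 + \<bar>t\<bar>) powr (2 * \<gamma> - 1)) / (1 - 2 * \<gamma>)" using g by (simp add: field_simps)
    also have "\<dots> \<le> 1 / (1 - 2 * \<gamma>)" using g by (intro divide_right_mono) auto
    finally show "\<bar>H t\<bar> \<le> 1 / (1 - 2 * \<gamma>)" unfolding absHK .
  qed
qed

text \<open>
  For \<open>\<gamma> \<ge> 1\<close> the profile has to be truncated to stay bounded. The relation between \<open>H\<close> and \<open>K\<close> survives with
  a constant that does not depend on the level \<open>k\<close>: as \<open>h\<close> is nondecreasing, \<open>H \<le> h K\<close>.
\<close>

lemma truncated_power_family:
  fixes \<gamma> k :: real
  assumes \<gamma>: "1 \<le> \<gamma>" and k: "0 \<le> k"
  obtains H K where "admissible (\<lambda>t. (1 + min \<bar>t\<bar> k) powr (\<gamma> - 1)) H K"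
    "\<And>t. (1 + min \<bar>t\<bar> k) powr \<gamma> \<le> 1 + \<gamma> * \<bar>K t\<bar>"
    "\<And>t. \<bar>H t\<bar> \<le> 1 / \<gamma> * (1 + \<gamma> * \<bar>K t\<bar>) powr ((2 * \<gamma> - 1) / \<gamma>)"
proof -
  let ?h = "\<lambda>t::real. (1 + min \<bar>t\<bar> k) powr (\<gamma> - 1)"
  have bd: "\<bar>?h t\<bar> \<le> (1 + k) powr (\<gamma> - 1)" for t
    using powr_mono2[of "\<gamma> - 1" "1 + min \<bar>t\<bar> k" "1 + k"] \<gamma> k by simp
  have nz: "1 + min \<bar>t\<bar> k \<noteq> 0" for t using k abs_ge_zero[of t] by (simp only: min_def split: if_split) linarith
  have c: "continuous_on UNIV ?h" by (intro continuous_intros ballI) (rule nz)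
  obtain H K where ad: "admissible ?h H K" using admissible_exists[OF c bd] by blast
  have H: "\<And>t. (H has_real_derivative (?h t)\<^sup>2) (at t)" "H 0 = 0" and K: "\<And>t. (K has_real_derivative ?h t) (at t)" "K 0 = 0"
    using ad by (auto simp: admissible_def)
  have absHK: "\<bar>H t\<bar> = H \<bar>t\<bar>" "\<bar>K t\<bar> = K \<bar>t\<bar>" for t
    by (rule admissible_even_abs[OF ad]; simp)+
  have Klow: "((1 + t) powr \<gamma> - 1) / \<gamma> \<le> K t" if t: "0 \<le> t" "t \<le> k" for t
  proof (rule deriv_compare[OF t(1)])
    show "((\<lambda>t. ((1 + t) powr \<gamma> - 1) / \<gamma>) has_real_derivative (1 + s) powr (\<gamma> - 1)) (at s)" if "0 \<le> s" for s
      using that \<gamma> by (intro DERIV_shifted_powr) auto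
    show "(K has_real_derivative (1 + s) powr (\<gamma> - 1)) (at s)" if "0 \<le> s" "s \<le> t" for s
      using K(1)[of s] that t by simp
  qed (simp_all add: K)
  have Kmono: "K s \<le> K t" if "s \<le> t" for s t
    using deriv_compare[OF that, of "\<lambda>_. K s" K "\<lambda>_. 0" ?h] K by simp
  have KK: "(1 + min \<bar>t\<bar> k) powr \<gamma> \<le> 1 + \<gamma> * \<bar>K t\<bar>" for t
  proof -
    have "((1 + min \<bar>t\<bar> k) powr \<gamma> - 1) / \<gamma> \<le> K (min \<bar>t\<bar> k)" using k by (intro Klow) auto
    also have "\<dots> \<le> \<bar>K t\<bar>" unfolding absHK by (rule Kmono) simp
    finally show ?thesis using \<gamma> by (simp add: field_simps)
  qed
  have hmono: "?h s \<le> ?h t" if "0 \<le> s" "s \<le> t" for s t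
    using that \<gamma> k by (intro powr_mono2) auto
  show ?thesis
  proof (rule that[OF ad KK])
    fix t :: real
    let ?u = "\<bar>t\<bar>" and ?Z = "1 + \<gamma> * \<bar>K t\<bar>"
    have Z: "1 \<le> ?Z" using \<gamma> by simp
    have "H ?u \<le> ?h ?u * K ?u"
    proof (rule deriv_compare[of 0 ?u H "\<lambda>s. ?h ?u * K s" "\<lambda>s. (?h s)\<^sup>2" "\<lambda>s. ?h ?u * ?h s"])
      show "((\<lambda>s. ?h ?u * K s) has_real_derivative ?h ?u * ?h s) (at s)" for s by (rule DERIV_cmult[OF K(1)])
      show "(?h s)\<^sup>2 \<le> ?h ?u * ?h s" if "0 \<le> s" "s \<le> ?u" for s
        using hmono[OF that] unfolding power2_eq_square by (intro mult_right_mono) auto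
      show "(H has_real_derivative (?h s)\<^sup>2) (at s)" for s by (rule H(1))
    qed (simp_all add: H(2) K(2))
    also have "\<dots> \<le> ?Z powr ((\<gamma> - 1) / \<gamma>) * (?Z / \<gamma>)"
    proof (rule mult_mono)
      have "((1 + min ?u k) powr \<gamma>) powr ((\<gamma> - 1) / \<gamma>) \<le> ?Z powr ((\<gamma> - 1) / \<gamma>)"
        using \<gamma> KK by (intro powr_mono2) auto
      then show "?h ?u \<le> ?Z powr ((\<gamma> - 1) / \<gamma>)" using \<gamma> by (simp add: powr_powr)
      show "K ?u \<le> ?Z / \<gamma>" using \<gamma> absHK(2)[of t] by (simp add: field_simps)
    qed (use absHK(2)[of t] in auto)
    also have "\<dots> = 1 / \<gamma> * ?Z powr ((\<gamma> - 1) / \<gamma> + 1)" using Z by (simp add: powr_add)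
    also have "(\<gamma> - 1) / \<gamma> + 1 = (2 * \<gamma> - 1) / \<gamma>" using \<gamma> by (simp add: field_simps)
    finally show "\<bar>H t\<bar> \<le> 1 / \<gamma> * ?Z powr ((2 * \<gamma> - 1) / \<gamma>)" unfolding absHK .
  qed
qed

text \<open>
  A continuous substitute for the truncation at level \<open>k\<close>: \<open>h\<close> rises linearly from \<open>0\<close> to \<open>1\<close> between the
  levels \<open>k\<close> and \<open>k + e\<close>. Since \<open>h \<le> 1\<close>, also \<open>H' = h\<^sup>2 \<le> h = K'\<close>.
\<close>

lemma ramp_family:
  fixes k e :: real
  assumes k: "0 \<le> k" and e: "0 < e"
  obtains h H K where "admissible h H K" "\<And>t. \<bar>H t\<bar> \<le> \<bar>K t\<bar>" "\<And>t. \<bar>t\<bar> \<le> k \<Longrightarrow> K t = 0" "\<And>t. k + e \<le> \<bar>t\<bar> \<Longrightarrow> e / 2 \<le> \<bar>K t\<bar>"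
proof -
  define h where "h t = min 1 (max 0 ((\<bar>t\<bar> - k) / e))" for t
  have h01: "0 \<le> h t" "h t \<le> 1" for t by (auto simp: h_def)
  have bd: "\<bar>h t\<bar> \<le> 1" for t using h01[of t] by simp
  have c: "continuous_on UNIV h" unfolding h_def using e by (intro continuous_intros) auto
  obtain H K where ad: "admissible h H K" using admissible_exists[OF c bd] by blast
  have H: "\<And>t. (H has_real_derivative (h t)\<^sup>2) (at t)" "H 0 = 0" and K: "\<And>t. (K has_real_derivative h t) (at t)" "K 0 = 0"
    using ad by (auto simp: admissible_def)
  have absHK: "\<bar>H t\<bar> = H \<bar>t\<bar>" "\<bar>K t\<bar> = K \<bar>t\<bar>" for t
    by (rule admissible_even_abs[OF ad]; simp add: h_def)+
  have Kmono: "K s \<le> K t" if "s \<le> t" for s t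
    using deriv_compare[OF that, of "\<lambda>_. K s" K "\<lambda>_. 0" h] K h01 by simp
  show ?thesis
  proof (rule that[OF ad])
    fix t
    show "\<bar>H t\<bar> \<le> \<bar>K t\<bar>"
      unfolding absHK
    proof (rule deriv_compare[of 0 "\<bar>t\<bar>" H K "\<lambda>s. (h s)\<^sup>2" h])
      show "(h s)\<^sup>2 \<le> h s" for s
        using mult_right_mono[OF h01(2)[of s] h01(1)[of s]] by (simp add: power2_eq_square)
    qed (use H K in auto)
    show "K t = 0" if "\<bar>t\<bar> \<le> k"
    proof -
      have "K \<bar>t\<bar> \<le> 0"
      proof (rule deriv_compare[of 0 "\<bar>t\<bar>" K "\<lambda>_. 0" h "\<lambda>_. 0"])
        show "h s \<le> 0" if "0 \<le> s" "s \<le> \<bar>t\<bar>" for s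
        proof -
          have "(\<bar>s\<bar> - k) / e \<le> 0" using that \<open>\<bar>t\<bar> \<le> k\<close> e by (simp add: divide_le_0_iff)
          then show ?thesis unfolding h_def by simp
        qed
      qed (use K in auto)
      then show ?thesis using absHK(2)[of t] by linarith
    qed
    show "e / 2 \<le> \<bar>K t\<bar>" if "k + e \<le> \<bar>t\<bar>"
    proof -
      have "((k + e) - k)\<^sup>2 / (2 * e) \<le> K (k + e)"
      proof (rule deriv_compare[of k "k + e" "\<lambda>s. (s - k)\<^sup>2 / (2 * e)" K "\<lambda>s. (s - k) / e" h])
        show "((\<lambda>s. (s - k)\<^sup>2 / (2 * e)) has_real_derivative (s - k) / e) (at s)" for s
          using e by (auto intro!: derivative_eq_intros simp: field_simps)
        show "(s - k) / e \<le> h s" if "k \<le> s" "s \<le> k + e" for s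
          using that k e by (auto simp: h_def min_def max_def divide_simps)
        show "(k - k)\<^sup>2 / (2 * e) \<le> K k" using Kmono[OF k] K(2) by simp
      qed (use K e in auto)
      also have "K (k + e) \<le> \<bar>K t\<bar>" unfolding absHK by (rule Kmono[OF that])
      finally show ?thesis using e by (simp add: power2_eq_square)
    qed
  qed
qed

text \<open>
  The profile for data that are merely integrable: \<open>H = arctan\<close> is bounded, while \<open>K = arsinh\<close> is bounded
  below by \<open>arsinh 1\<close> on \<open>{\<bar>t\<bar> \<ge> 1}\<close> and \<open>h\<^sup>2 \<ge> 1/2\<close> on \<open>{\<bar>t\<bar> < 1}\<close>.
\<close>

lemma arctan_family: "admissible (\<lambda>t. 1 / sqrt (1 + t\<^sup>2)) arctan arsinh"
proof -
  have p: "0 < 1 + t\<^sup>2" for t :: real by (simp add: add_pos_nonneg)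
  have "(1 / sqrt (1 + t\<^sup>2))\<^sup>2 = inverse (1 + t\<^sup>2)" for t :: real
    using p[of t] by (simp only: power_divide real_sqrt_pow2 less_imp_le power_one inverse_eq_divide)
  moreover have "(arsinh has_real_derivative 1 / sqrt (1 + t\<^sup>2)) (at t)" for t :: real
    using arsinh_real_has_field_derivative[of t] by (simp add: add.commute)
  moreover have "\<bar>1 / sqrt (1 + t\<^sup>2)\<bar> \<le> 1" for t :: real
    using real_sqrt_le_mono[of 1 "1 + t\<^sup>2"] p[of t] by (simp add: divide_le_eq)
  moreover have "continuous_on UNIV (\<lambda>t::real. 1 / sqrt (1 + t\<^sup>2))"
    using p by (intro continuous_intros) (auto simp: less_imp_neq[THEN not_sym])
  ultimately show ?thesis
    unfolding admissible_def using DERIV_arctan by (auto intro!: exI[of _ 1])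
qed

section \<open>Energy estimates for weak solutions\<close>

text \<open>
  The height \<open>e\<close> at which \<open>g\<close> is split is chosen so that \<open>e\<^sup>q\<^sup>-\<^sup>2 = (b\<^sup>\<gamma>\<^sup>-\<^sup>1)\<^sup>2\<close>.
\<close>

lemma gradient_interpolation:
  fixes b g \<gamma> q :: real
  assumes b: "1 \<le> b" and g: "0 \<le> g" and q: "0 < q" "q < 2"
  shows "g powr q \<le> (b powr (\<gamma> - 1) * g)\<^sup>2 + b powr ((1 - \<gamma>) * (2 * q / (2 - q)))"
proof -
  define e where "e = b powr ((1 - \<gamma>) * (2 / (2 - q)))"
  have "g powr q \<le> e powr q + e powr (q - 2) * g powr 2"
    using b g q by (intro powr_interpolate) (auto simp: e_def)
  also have "e powr q = b powr ((1 - \<gamma>) * (2 * q / (2 - q)))"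
  proof -
    have "(1 - \<gamma>) * (2 / (2 - q)) * q = (1 - \<gamma>) * (2 * q / (2 - q))" by simp
    then show ?thesis by (simp only: e_def powr_powr)
  qed
  also have "e powr (q - 2) = b powr ((\<gamma> - 1) * 2)"
  proof -
    have "(1 - \<gamma>) * (2 / (2 - q)) * (q - 2) = (\<gamma> - 1) * 2" using q by (simp add: field_simps)
    then show ?thesis by (simp add: e_def powr_powr)
  qed
  also have "\<dots> * g powr 2 = (b powr (\<gamma> - 1) * g)\<^sup>2"
    using b g by (simp add: power_mult_distrib powr_power mult.commute)
  finally show ?thesis by (simp add: add.commute)
qed

context sobolev_setting
begin

lemma const_in_Lp: "(\<lambda>_. c :: real) \<in> Lp \<Omega> (ereal q)" "Lint \<Omega> q (\<lambda>_. c :: real) = \<bar>c\<bar> powr q * measure lebesgue \<Omega>"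
proof -
  interpret finite_measure "lebesgue_on \<Omega>" by (rule finite_measure_domain)
  show "(\<lambda>_. c :: real) \<in> Lp \<Omega> (ereal q)" by (simp add: Lp_iff)
  show "Lint \<Omega> q (\<lambda>_. c :: real) = \<bar>c\<bar> powr q * measure lebesgue \<Omega>"
    using lmeasurable_domain by (simp add: measure_restrict_space)
qed

lemma Lp_one_plus:
  fixes w :: "real^'n \<Rightarrow> real"
  assumes w: "w \<in> Lp \<Omega> (ereal q)" and g: "0 \<le> \<gamma>" and q: "0 \<le> q"
  shows "(\<lambda>x. 1 + \<gamma> * \<bar>w x\<bar>) \<in> Lp \<Omega> (ereal q)"
    and "Lint \<Omega> q (\<lambda>x. 1 + \<gamma> * \<bar>w x\<bar>) \<le> 2 powr q * measure lebesgue \<Omega> + 2 powr q * \<gamma> powr q * Lint \<Omega> q w"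
proof -
  have s: "(\<lambda>x. \<gamma> *\<^sub>R norm (w x)) \<in> Lp \<Omega> (ereal q)" by (intro Lp_scale Lp_norm_fun w)
  show "(\<lambda>x. 1 + \<gamma> * \<bar>w x\<bar>) \<in> Lp \<Omega> (ereal q)" using Lp_add[OF const_in_Lp(1)[of 1] s q] by simp
  have sc: "Lint \<Omega> q (\<lambda>x. \<gamma> *\<^sub>R norm (w x)) = \<gamma> powr q * Lint \<Omega> q w"
    using Lint_scale[where \<Omega>=\<Omega> and p=q and c=\<gamma> and f="\<lambda>x. norm (w x)"] g by simp
  have "Lint \<Omega> q (\<lambda>x. 1 + \<gamma> *\<^sub>R norm (w x)) \<le> 2 powr q * (Lint \<Omega> q (\<lambda>_. 1 :: real) + Lint \<Omega> q (\<lambda>x. \<gamma> *\<^sub>R norm (w x)))"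
    by (rule Lint_add_le[OF const_in_Lp(1)[of 1] s q])
  also have "\<dots> = 2 powr q * measure lebesgue \<Omega> + 2 powr q * \<gamma> powr q * Lint \<Omega> q w"
    unfolding sc const_in_Lp(2) by (simp only: abs_one powr_one_eq_one mult_1_left distrib_left mult.assoc)
  finally show "Lint \<Omega> q (\<lambda>x. 1 + \<gamma> * \<bar>w x\<bar>) \<le> 2 powr q * measure lebesgue \<Omega> + 2 powr q * \<gamma> powr q * Lint \<Omega> q w"
    by (simp only: real_scaleR_def real_norm_def)
qed

lemma identity_admissible: "admissible (\<lambda>_. 1) (\<lambda>t. t) (\<lambda>t. t)"
  by (auto simp: admissible_def intro!: exI[of _ 1])

text \<open>
  With \<open>h = 1\<close> the right-hand side of the energy estimate is the pairing of the datum with the solution, which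
  Hoelder's inequality bounds by the Sobolev norm of the solution.
\<close>

lemma W12_estimate:
  assumes B: "0 \<le> B"
  obtains C where "0 \<le> C" "\<And>A F d. solves A F d \<Longrightarrow> Lint \<Omega> two_star_conj F \<le> B \<Longrightarrow> Lint \<Omega> 2 (Xgrad \<Omega> X d) \<le> C"
proof -
  obtain S where S: "0 < S" and es: "\<And>A F d h H K. solves A F d \<Longrightarrow> admissible h H K \<Longrightarrow>
    Lint \<Omega> two_star (\<lambda>x. K (d x)) powr (2 / two_star) \<le> S * (LINT x|lebesgue_on \<Omega>. F x * H (d x))"
    using energy_Sobolev by blast
  let ?b = "B powr (1 / two_star_conj)"
  show ?thesis
  proof (rule that[of "S * ?b\<^sup>2 / \<alpha>"])
    fix A F d assume s: "solves A F d" and F: "Lint \<Omega> two_star_conj F \<le> B"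
    let ?N = "Lint \<Omega> two_star_conj F powr (1 / two_star_conj)" and ?y = "Lint \<Omega> two_star d powr (1 / two_star)"
    have FL: "F \<in> Lp \<Omega> (ereal two_star_conj)" using s by (simp add: solves_def)
    have dL: "d \<in> Lp \<Omega> (ereal two_star)" by (rule W0_in_L_two_star[OF solves_W0_grad[OF s]])
    have Nb: "?N \<le> ?b" using F Q_gt_2 by (intro powr_mono2) auto
    have hol: "(LINT x|lebesgue_on \<Omega>. F x * d x) \<le> ?N * ?y"
      using exponents by (intro Holder_Lint(3) FL dL) auto
    have "?y\<^sup>2 = Lint \<Omega> two_star d powr (2 / two_star)"
      unfolding power2_eq_square powr_add[symmetric] by (simp only: add_divide_distrib[symmetric] one_add_one)
    also have "\<dots> \<le> S * (?N * ?y)"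
      using es[OF s identity_admissible] mult_left_mono[OF hol, of S] S by linarith
    finally have y2: "?y * ?y \<le> (S * ?N) * ?y" by (simp only: power2_eq_square mult.assoc)
    have y: "?y \<le> S * ?N"
    proof (cases "?y = 0")
      case False
      then have "0 < ?y" using powr_ge_zero[of "Lint \<Omega> two_star d" "1 / two_star"] by linarith
      with y2 show ?thesis by (rule mult_right_le_imp_le)
    qed (use S in simp)
    have "\<alpha> * Lint \<Omega> 2 (Xgrad \<Omega> X d) \<le> ?N * ?y"
      using energy(3)[OF s identity_admissible] hol by simp
    also have "\<dots> \<le> ?N * (S * ?N)" by (rule mult_left_mono[OF y]) simp
    also have "\<dots> \<le> ?b * (S * ?b)" using Nb S by (intro mult_mono) auto
    also have "\<dots> = S * ?b\<^sup>2" by (simp only: power2_eq_square mult_ac)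
    finally show "Lint \<Omega> 2 (Xgrad \<Omega> X d) \<le> S * ?b\<^sup>2 / \<alpha>" using \<alpha>_pos by (simp only: pos_le_divide_eq mult.commute)
  qed (use S \<alpha>_pos in simp)
qed

text \<open>
  The estimate for \<open>1 < p < Q/2\<close>: if \<open>H\<close> grows at most like the power of \<open>K\<close> for which
  \<open>\<bar>H\<bar>\<close> to the conjugate exponent of \<open>p\<close> is of the order of \<open>\<bar>K\<bar>\<close> to the Sobolev exponent, the right-hand side of the energy
  estimate is a smaller power of the left-hand side.
\<close>

lemma subcritical_estimate:
  assumes p: "1 < p" "p < Q / 2" and g: "0 < \<gamma>" "two_star * \<gamma> = p / (p - 1) * (2 * \<gamma> - 1)" and c: "0 \<le> c"
  obtains C where "0 \<le> C" "\<And>A F d h H K. solves A F d \<Longrightarrow> F \<in> Lp \<Omega> (ereal p) \<Longrightarrow> Lint \<Omega> p F \<le> 1 \<Longrightarrow>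
     admissible h H K \<Longrightarrow> (\<And>t. \<bar>H t\<bar> \<le> c * (1 + \<gamma> * \<bar>K t\<bar>) powr ((2 * \<gamma> - 1) / \<gamma>)) \<Longrightarrow>
     (\<lambda>x. 1 + \<gamma> * \<bar>K (d x)\<bar>) \<in> Lp \<Omega> (ereal two_star) \<and>
     Lint \<Omega> two_star (\<lambda>x. 1 + \<gamma> * \<bar>K (d x)\<bar>) \<le> C \<and> Lint \<Omega> 2 (\<lambda>x. h (d x) *\<^sub>R Xgrad \<Omega> X d x) \<le> C"
proof -
  obtain S where S: "0 < S" and es: "\<And>A F d h H K. solves A F d \<Longrightarrow> admissible h H K \<Longrightarrow>
    Lint \<Omega> two_star (\<lambda>x. K (d x)) powr (2 / two_star) \<le> S * (LINT x|lebesgue_on \<Omega>. F x * H (d x))"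
    using energy_Sobolev by blast
  define p' where "p' = p / (p - 1)"
  define \<theta> where "\<theta> = 1 / p'"
  define D where "D = 2 powr two_star * measure lebesgue \<Omega>"
  define E where "E = 2 powr two_star * \<gamma> powr two_star"
  define Y0 where "Y0 = max 1 ((S * c * (D + E) powr \<theta>) powr (1 / (2 / two_star - \<theta>)))"
  define V0 where "V0 = D + E * Y0"
  have p': "1 < p'" "1 / p + 1 / p' = 1" using p by (auto simp: p'_def field_simps)
  have ts: "0 < two_star" using exponents by linarith
  have \<theta>: "0 \<le> \<theta>" "\<theta> < 2 / two_star"
  proof -
    show "0 \<le> \<theta>" using p' by (simp add: \<theta>_def)
    show "\<theta> < 2 / two_star" using p Q_gt_2 by (simp add: \<theta>_def p'_def field_simps)
  qed
  have DE: "0 \<le> D" "0 \<le> E" by (auto simp: D_def E_def)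
  have Y0: "0 \<le> Y0" by (simp add: Y0_def)
  have V0: "0 \<le> V0" using DE Y0 by (simp add: V0_def)
  have eq: "(2 * \<gamma> - 1) / \<gamma> * p' = two_star"
  proof -
    have "(2 * \<gamma> - 1) / \<gamma> * p' = p / (p - 1) * (2 * \<gamma> - 1) / \<gamma>" by (simp add: p'_def mult_ac)
    also have "\<dots> = two_star * \<gamma> / \<gamma>" by (simp only: g(2))
    finally show ?thesis using g(1) by simp
  qed
  show ?thesis
  proof (rule that[of "max V0 (c * V0 powr \<theta> / \<alpha>)"])
    fix A F d h H K
    assume s: "solves A F d" and F: "F \<in> Lp \<Omega> (ereal p)" "Lint \<Omega> p F \<le> 1" and ad: "admissible h H K"
      and H: "\<And>t. \<bar>H t\<bar> \<le> c * (1 + \<gamma> * \<bar>K t\<bar>) powr ((2 * \<gamma> - 1) / \<gamma>)"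
    let ?Z = "\<lambda>x. 1 + \<gamma> * \<bar>K (d x)\<bar>" and ?Y = "Lint \<Omega> two_star (\<lambda>x. K (d x))"
    let ?V = "Lint \<Omega> two_star ?Z"
    have KL: "(\<lambda>x. K (d x)) \<in> Lp \<Omega> (ereal two_star)" by (rule W0_in_L_two_star[OF energy(2)[OF s ad]])
    have ZL: "?Z \<in> Lp \<Omega> (ereal two_star)" by (rule Lp_one_plus(1)[OF KL]) (use g ts in auto)
    have V: "?V \<le> D + E * ?Y"
      unfolding D_def E_def by (rule Lp_one_plus(2)[OF KL]) (use g ts in auto)
    have Z1: "1 \<le> ?Z x" for x using g by simp
    have Hp: "\<bar>H (d x)\<bar> powr p' \<le> c powr p' * \<bar>?Z x\<bar> powr two_star" for x
    proof -
      have "\<bar>H (d x)\<bar> powr p' \<le> (c * ?Z x powr ((2 * \<gamma> - 1) / \<gamma>)) powr p'"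
        using H p' by (intro powr_mono2) auto
      also have "\<dots> = c powr p' * ?Z x powr two_star"
        unfolding powr_mult powr_powr eq by (rule refl)
      finally show ?thesis using Z1[of x] by simp
    qed
    have Hm: "(\<lambda>x. H (d x)) \<in> borel_measurable (lebesgue_on \<Omega>)"
      by (rule Lp_borel[OF W0_grad_memD(1)[OF energy(1)[OF s ad]]])
    have ZI: "integrable (lebesgue_on \<Omega>) (\<lambda>x. c powr p' * \<bar>?Z x\<bar> powr two_star)"
      using ZL unfolding Lp_iff by (intro integrable_mult_right) auto
    have HI: "integrable (lebesgue_on \<Omega>) (\<lambda>x. \<bar>H (d x)\<bar> powr p')"
    proof (rule Bochner_Integration.integrable_bound[OF ZI])
      show "(\<lambda>x. \<bar>H (d x)\<bar> powr p') \<in> borel_measurable (lebesgue_on \<Omega>)" using Hm by measurable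
      show "AE x in lebesgue_on \<Omega>. norm (\<bar>H (d x)\<bar> powr p') \<le> norm (c powr p' * \<bar>?Z x\<bar> powr two_star)"
        using Hp by (intro AE_I2) simp
    qed
    have HL: "(\<lambda>x. H (d x)) \<in> Lp \<Omega> (ereal p')" using Hm HI by (simp add: Lp_iff)
    have "Lint \<Omega> p' (\<lambda>x. H (d x)) \<le> (LINT x|lebesgue_on \<Omega>. c powr p' * \<bar>?Z x\<bar> powr two_star)"
      using Hp by (intro integral_mono ZI) (use HI in auto)
    also have "\<dots> = c powr p' * ?V" by simp
    finally have "Lint \<Omega> p' (\<lambda>x. H (d x)) powr \<theta> \<le> (c powr p' * ?V) powr \<theta>"
      using \<theta> by (intro powr_mono2) auto
    also have "\<dots> = c * ?V powr \<theta>" using c p' by (simp add: powr_mult powr_powr \<theta>_def)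
    finally have Hle: "Lint \<Omega> p' (\<lambda>x. H (d x)) powr \<theta> \<le> c * ?V powr \<theta>" .
    have "(LINT x|lebesgue_on \<Omega>. F x * H (d x)) \<le> Lint \<Omega> p F powr (1 / p) * Lint \<Omega> p' (\<lambda>x. H (d x)) powr (1 / p')"
      by (rule Holder_Lint(3)[OF p(1) p' F(1) HL])
    also have "\<dots> \<le> 1 * (c * ?V powr \<theta>)"
    proof (rule mult_mono)
      have "Lint \<Omega> p F powr (1 / p) \<le> 1 powr (1 / p)" using F(2) p by (intro powr_mono2) auto
      then show "Lint \<Omega> p F powr (1 / p) \<le> 1" by simp
    qed (use Hle in \<open>auto simp: \<theta>_def\<close>)
    finally have rhs: "(LINT x|lebesgue_on \<Omega>. F x * H (d x)) \<le> c * ?V powr \<theta>" by simp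
    have "?Y powr (2 / two_star) \<le> S * (c * ?V powr \<theta>)"
      by (rule order.trans[OF es[OF s ad] mult_left_mono[OF rhs]]) (use S in simp)
    also have "\<dots> \<le> S * c * (D + E * ?Y) powr \<theta>"
      unfolding mult.assoc using V \<theta> S c by (intro mult_left_mono powr_mono2) auto
    finally have "?Y \<le> Y0"
      unfolding Y0_def using S c DE \<theta> by (intro powr_absorb) auto
    then have V': "?V \<le> V0" using V mult_left_mono[of ?Y Y0 E] DE by (simp add: V0_def)
    have "\<alpha> * Lint \<Omega> 2 (\<lambda>x. h (d x) *\<^sub>R Xgrad \<Omega> X d x) \<le> c * V0 powr \<theta>"
    proof (rule order.trans[OF energy(3)[OF s ad]], rule order.trans[OF rhs])
      show "c * ?V powr \<theta> \<le> c * V0 powr \<theta>" using V' \<theta> c by (intro mult_left_mono powr_mono2) auto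
    qed
    then have "Lint \<Omega> 2 (\<lambda>x. h (d x) *\<^sub>R Xgrad \<Omega> X d x) \<le> c * V0 powr \<theta> / \<alpha>"
      using \<alpha>_pos by (simp only: pos_le_divide_eq mult.commute)
    with ZL V' show "?Z \<in> Lp \<Omega> (ereal two_star) \<and> ?V \<le> max V0 (c * V0 powr \<theta> / \<alpha>) \<and>
       Lint \<Omega> 2 (\<lambda>x. h (d x) *\<^sub>R Xgrad \<Omega> X d x) \<le> max V0 (c * V0 powr \<theta> / \<alpha>)"
      by (simp add: le_max_iff_disj)
  qed (use V0 in simp)
qed

text \<open>
  For this exponent, \<open>\<bar>d\<bar>\<^sup>\<gamma>\<close> lies in \<open>L\<close> to the Sobolev exponent if and only if \<open>d\<close> lies in \<open>L\<close> to the
  exponent \<open>p\<^sup>*\<^sup>*\<close>, and the balance required by the subcritical estimate holds.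
\<close>

lemma gamma_identity:
  assumes p: "1 < p" "p < Q / 2" and g: "\<gamma> = p * (Q - 2) / (2 * (Q - 2 * p))"
  shows "0 < \<gamma>" "two_star * \<gamma> = dstar_exp Q p" "two_star * \<gamma> = p / (p - 1) * (2 * \<gamma> - 1)"
proof -
  have d: "0 < Q - 2 * p" using p by simp
  show "0 < \<gamma>" using p d Q_gt_2 by (simp add: g)
  show 1: "two_star * \<gamma> = dstar_exp Q p"
    using p d Q_gt_2 by (simp add: g dstar_exp_def divide_simps)
  have "2 * \<gamma> - 1 = Q * (p - 1) / (Q - 2 * p)" using d by (simp add: g field_simps)
  then show "two_star * \<gamma> = p / (p - 1) * (2 * \<gamma> - 1)" unfolding 1 using p d by (simp add: dstar_exp_def)
qed

text \<open>
  Here \<open>\<gamma> \<ge> 1\<close>. The bounds for the truncated powers do not depend on the level of truncation, and Fatou's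
  lemma removes it.
\<close>

lemma Lebesgue_estimate:
  assumes p: "two_star_conj \<le> p" "p < Q / 2"
  obtains C where "0 \<le> C" "\<And>A F d. solves A F d \<Longrightarrow> F \<in> Lp \<Omega> (ereal p) \<Longrightarrow> Lint \<Omega> p F \<le> 1 \<Longrightarrow>
     d \<in> Lp \<Omega> (ereal (dstar_exp Q p)) \<and> Lint \<Omega> (dstar_exp Q p) d \<le> C"
proof -
  have p1: "1 < p" using p exponents by linarith
  define \<gamma> where "\<gamma> = p * (Q - 2) / (2 * (Q - 2 * p))"
  note g = gamma_identity[OF p1 p(2) \<gamma>_def]
  have g1: "1 \<le> \<gamma>" using p Q_gt_2 by (simp add: \<gamma>_def field_simps)
  obtain C where C: "0 \<le> C" and est: "\<And>A F d h H K. solves A F d \<Longrightarrow> F \<in> Lp \<Omega> (ereal p) \<Longrightarrow> Lint \<Omega> p F \<le> 1 \<Longrightarrow>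
     admissible h H K \<Longrightarrow> (\<And>t. \<bar>H t\<bar> \<le> 1 / \<gamma> * (1 + \<gamma> * \<bar>K t\<bar>) powr ((2 * \<gamma> - 1) / \<gamma>)) \<Longrightarrow>
     (\<lambda>x. 1 + \<gamma> * \<bar>K (d x)\<bar>) \<in> Lp \<Omega> (ereal two_star) \<and>
     Lint \<Omega> two_star (\<lambda>x. 1 + \<gamma> * \<bar>K (d x)\<bar>) \<le> C \<and> Lint \<Omega> 2 (\<lambda>x. h (d x) *\<^sub>R Xgrad \<Omega> X d x) \<le> C"
  proof (rule subcritical_estimate[OF p1 p(2) g(1) g(3), of "1 / \<gamma>"])
    show "0 \<le> 1 / \<gamma>" using g1 by simp
  qed blast
  let ?q = "dstar_exp Q p"
  have q: "0 < ?q" unfolding g(2)[symmetric] using g(1) exponents(3) by (intro mult_pos_pos) linarith+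
  show ?thesis
  proof (rule that[OF C])
    fix A F d assume s: "solves A F d" and F: "F \<in> Lp \<Omega> (ereal p)" "Lint \<Omega> p F \<le> 1"
    have dm: "d \<in> borel_measurable (lebesgue_on \<Omega>)" by (rule Lp_borel[OF W0_grad_memD(1)[OF solves_W0_grad[OF s]]])
    have trunc: "integrable (lebesgue_on \<Omega>) (\<lambda>x. min \<bar>d x\<bar> (real n) powr ?q) \<and>
        (LINT x|lebesgue_on \<Omega>. min \<bar>d x\<bar> (real n) powr ?q) \<le> C" for n
    proof -
      obtain H K where ad: "admissible (\<lambda>t. (1 + min \<bar>t\<bar> (real n)) powr (\<gamma> - 1)) H K"
        and K: "\<And>t. (1 + min \<bar>t\<bar> (real n)) powr \<gamma> \<le> 1 + \<gamma> * \<bar>K t\<bar>"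
        and H: "\<And>t. \<bar>H t\<bar> \<le> 1 / \<gamma> * (1 + \<gamma> * \<bar>K t\<bar>) powr ((2 * \<gamma> - 1) / \<gamma>)"
        using truncated_power_family[OF g1, of "real n"] by auto
      let ?Z = "\<lambda>x. 1 + \<gamma> * \<bar>K (d x)\<bar>"
      have Z: "?Z \<in> Lp \<Omega> (ereal two_star)" "Lint \<Omega> two_star ?Z \<le> C"
        using est[OF s F ad H] by auto
      have Zi: "integrable (lebesgue_on \<Omega>) (\<lambda>x. \<bar>?Z x\<bar> powr two_star)" using Z(1) by (simp add: Lp_iff)
      have le: "min \<bar>d x\<bar> (real n) powr ?q \<le> \<bar>?Z x\<bar> powr two_star" for x
      proof -
        have "min \<bar>d x\<bar> (real n) powr ?q \<le> (1 + min \<bar>d x\<bar> (real n)) powr ?q" using q by (intro powr_mono2) auto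
        also have "\<dots> = ((1 + min \<bar>d x\<bar> (real n)) powr \<gamma>) powr two_star"
          unfolding powr_powr g(2)[symmetric] by (simp only: mult.commute)
        also have "\<dots> \<le> \<bar>?Z x\<bar> powr two_star"
          using K[of "d x"] exponents(3) by (intro powr_mono2) auto
        finally show ?thesis .
      qed
      have i: "integrable (lebesgue_on \<Omega>) (\<lambda>x. min \<bar>d x\<bar> (real n) powr ?q)"
      proof (rule Bochner_Integration.integrable_bound[OF Zi])
        show "(\<lambda>x. min \<bar>d x\<bar> (real n) powr ?q) \<in> borel_measurable (lebesgue_on \<Omega>)" using dm by measurable
        show "AE x in lebesgue_on \<Omega>. norm (min \<bar>d x\<bar> (real n) powr ?q) \<le> norm (\<bar>?Z x\<bar> powr two_star)"
          using le by (intro AE_I2) simp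
      qed
      have "(LINT x|lebesgue_on \<Omega>. min \<bar>d x\<bar> (real n) powr ?q) \<le> (LINT x|lebesgue_on \<Omega>. \<bar>?Z x\<bar> powr two_star)"
        by (intro integral_mono i Zi le)
      then show ?thesis using i Z(2) by simp
    qed
    have lim: "(\<lambda>n. min \<bar>d x\<bar> (real n) powr ?q) \<longlonglongrightarrow> \<bar>d x\<bar> powr ?q" for x
    proof (rule tendsto_eventually)
      obtain N where "\<bar>d x\<bar> \<le> real N" using real_arch_simple by blast
      then have "min \<bar>d x\<bar> (real n) = \<bar>d x\<bar>" if "n \<ge> N" for n using that by (simp add: min_def)
      then show "\<forall>\<^sub>F n in sequentially. min \<bar>d x\<bar> (real n) powr ?q = \<bar>d x\<bar> powr ?q"
        by (intro eventually_sequentiallyI[of N]) simp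
    qed
    have m: "(\<lambda>x. \<bar>d x\<bar> powr ?q) \<in> borel_measurable (lebesgue_on \<Omega>)" using dm by measurable
    have fat: "integrable (lebesgue_on \<Omega>) (\<lambda>x. \<bar>d x\<bar> powr ?q)" "(LINT x|lebesgue_on \<Omega>. \<bar>d x\<bar> powr ?q) \<le> C"
      using integrable_Fatou[of "lebesgue_on \<Omega>" "\<lambda>n x. min \<bar>d x\<bar> (real n) powr ?q" C "\<lambda>x. \<bar>d x\<bar> powr ?q"] trunc m lim C
      by auto
    then show "d \<in> Lp \<Omega> (ereal ?q) \<and> Lint \<Omega> ?q d \<le> C" using dm by (simp add: Lp_iff)
  qed
qed

text \<open>From the two integrals that the power family controls to the gradient.\<close>

lemma gradient_from_power_family:
  assumes s: "solves A F d" and \<gamma>: "0 < \<gamma>" and q: "0 < q" "q < 2" "(1 - \<gamma>) * (2 * q / (2 - q)) = two_star * \<gamma>"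
    and ad: "admissible (\<lambda>t. (1 + \<bar>t\<bar>) powr (\<gamma> - 1)) H K" and KK: "\<And>t. 1 + \<gamma> * \<bar>K t\<bar> = (1 + \<bar>t\<bar>) powr \<gamma>"
    and Z: "(\<lambda>x. 1 + \<gamma> * \<bar>K (d x)\<bar>) \<in> Lp \<Omega> (ereal two_star)"
  shows "Lint \<Omega> q (Xgrad \<Omega> X d) \<le> Lint \<Omega> 2 (\<lambda>x. (1 + \<bar>d x\<bar>) powr (\<gamma> - 1) *\<^sub>R Xgrad \<Omega> X d x)
      + Lint \<Omega> two_star (\<lambda>x. 1 + \<gamma> * \<bar>K (d x)\<bar>)"
proof -
  let ?G = "Xgrad \<Omega> X d" and ?W = "\<lambda>x. (1 + \<bar>d x\<bar>) powr (\<gamma> - 1) *\<^sub>R Xgrad \<Omega> X d x" and ?Z = "\<lambda>x. 1 + \<gamma> * \<bar>K (d x)\<bar>"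
  have GL: "?G \<in> Lp \<Omega> (ereal q)"
    using Lp_mono[OF lmeasurable_domain W0_grad_memD(2)[OF solves_W0_grad[OF s]], of q] q by simp
  have Wi: "integrable (lebesgue_on \<Omega>) (\<lambda>x. norm (?W x) powr 2)"
    using W0_grad_memD(2)[OF energy(2)[OF s ad]] unfolding Lp_iff by blast
  have Zi: "integrable (lebesgue_on \<Omega>) (\<lambda>x. norm (?Z x) powr two_star)" using Z unfolding Lp_iff by blast
  have "Lint \<Omega> q ?G \<le> (LINT x|lebesgue_on \<Omega>. norm (?W x) powr 2 + norm (?Z x) powr two_star)"
  proof (rule integral_mono)
    show "norm (?G x) powr q \<le> norm (?W x) powr 2 + norm (?Z x) powr two_star" for x
    proof -
      have "norm (?Z x) powr two_star = (1 + \<bar>d x\<bar>) powr ((1 - \<gamma>) * (2 * q / (2 - q)))"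
        unfolding KK q(3) by (simp add: powr_powr mult.commute)
      moreover have "norm (?W x) powr 2 = ((1 + \<bar>d x\<bar>) powr (\<gamma> - 1) * norm (?G x))\<^sup>2" by simp
      ultimately show ?thesis using gradient_interpolation[of "1 + \<bar>d x\<bar>" "norm (?G x)" q \<gamma>] q by simp
    qed
  qed (use GL Wi Zi in \<open>simp_all add: Lp_iff\<close>)
  also have "\<dots> = Lint \<Omega> 2 ?W + Lint \<Omega> two_star ?Z" by (rule Bochner_Integration.integral_add[OF Wi Zi])
  finally show ?thesis .
qed

text \<open>
  Here \<open>1/2 < \<gamma> \<le> 1\<close>, so the power family applies without truncation, and the exponent of \<open>1 + \<bar>d\<bar>\<close> that the
  gradient costs is exactly the one that the subcritical estimate controls.
\<close>

lemma W1_pstar_estimate: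
  assumes p: "1 < p" "p < two_star_conj"
  obtains C where "0 \<le> C" "\<And>A F d. solves A F d \<Longrightarrow> F \<in> Lp \<Omega> (ereal p) \<Longrightarrow> Lint \<Omega> p F \<le> 1 \<Longrightarrow>
     Lint \<Omega> (star_exp Q p) (Xgrad \<Omega> X d) \<le> C"
proof -
  have pq: "p * (Q + 2) < 2 * Q" using p Q_gt_2 by (simp add: field_simps)
  have p2: "p < Q / 2"
  proof -
    have "2 * p * (Q + 2) < 4 * Q" using pq by simp
    also have "4 * Q \<le> Q * (Q + 2)" using Q_gt_2 by (simp add: algebra_simps mult_left_mono)
    finally have "(2 * p) * (Q + 2) < Q * (Q + 2)" by simp
    then show ?thesis using Q_gt_2 by (simp add: mult_less_cancel_right)
  qed
  define \<gamma> where "\<gamma> = p * (Q - 2) / (2 * (Q - 2 * p))"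
  note g = gamma_identity[OF p(1) p2 \<gamma>_def]
  have dpos: "0 < Q - 2 * p" "0 < Q - p" using p2 p by auto
  have g12: "1 / 2 < \<gamma>" "\<gamma> \<le> 1"
    using p pq dpos Q_gt_2 by (auto simp: \<gamma>_def field_simps)
  define q where "q = star_exp Q p"
  have q: "0 < q" "q < 2" using p pq dpos Q_gt_2 by (auto simp: q_def star_exp_def field_simps)
  have qe: "(1 - \<gamma>) * (2 * q / (2 - q)) = two_star * \<gamma>"
  proof -
    have a: "1 - \<gamma> = (2 * Q - 2 * p - p * Q) / (2 * (Q - 2 * p))" using dpos by (simp add: \<gamma>_def field_simps)
    have b: "2 - q = (2 * Q - 2 * p - p * Q) / (Q - p)" using dpos by (simp add: q_def star_exp_def field_simps)
    have c: "0 < 2 * Q - 2 * p - p * Q" using pq by (simp add: algebra_simps)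
    have "(1 - \<gamma>) * (2 * q / (2 - q)) = p * Q / (Q - 2 * p)"
      unfolding a b using c dpos by (simp add: q_def star_exp_def divide_simps)
    then show ?thesis unfolding g(2) dstar_exp_def .
  qed
  obtain C where C: "0 \<le> C" and est: "\<And>A F d h H K. solves A F d \<Longrightarrow> F \<in> Lp \<Omega> (ereal p) \<Longrightarrow> Lint \<Omega> p F \<le> 1 \<Longrightarrow>
     admissible h H K \<Longrightarrow> (\<And>t. \<bar>H t\<bar> \<le> 1 / (2 * \<gamma> - 1) * (1 + \<gamma> * \<bar>K t\<bar>) powr ((2 * \<gamma> - 1) / \<gamma>)) \<Longrightarrow>
     (\<lambda>x. 1 + \<gamma> * \<bar>K (d x)\<bar>) \<in> Lp \<Omega> (ereal two_star) \<and>
     Lint \<Omega> two_star (\<lambda>x. 1 + \<gamma> * \<bar>K (d x)\<bar>) \<le> C \<and> Lint \<Omega> 2 (\<lambda>x. h (d x) *\<^sub>R Xgrad \<Omega> X d x) \<le> C"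
  proof (rule subcritical_estimate[OF p(1) p2 g(1) g(3), of "1 / (2 * \<gamma> - 1)"])
    show "0 \<le> 1 / (2 * \<gamma> - 1)" using g12 by simp
  qed blast
  obtain H K where ad: "admissible (\<lambda>t. (1 + \<bar>t\<bar>) powr (\<gamma> - 1)) H K"
    and KK: "\<And>t. 1 + \<gamma> * \<bar>K t\<bar> = (1 + \<bar>t\<bar>) powr \<gamma>"
    and H: "\<And>t. \<bar>H t\<bar> \<le> 1 / (2 * \<gamma> - 1) * (1 + \<gamma> * \<bar>K t\<bar>) powr ((2 * \<gamma> - 1) / \<gamma>)"
    using power_family[OF g(1) g12(2)] g12(1) by metis
  show ?thesis
  proof (rule that[of "C + C"])
    fix A F d assume s: "solves A F d" and F: "F \<in> Lp \<Omega> (ereal p)" "Lint \<Omega> p F \<le> 1"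
    note e = est[OF s F ad H]
    have "Lint \<Omega> q (Xgrad \<Omega> X d) \<le> Lint \<Omega> 2 (\<lambda>x. (1 + \<bar>d x\<bar>) powr (\<gamma> - 1) *\<^sub>R Xgrad \<Omega> X d x)
      + Lint \<Omega> two_star (\<lambda>x. 1 + \<gamma> * \<bar>K (d x)\<bar>)"
      using e by (intro gradient_from_power_family[OF s g(1) q qe ad KK]) blast
    also have "\<dots> \<le> C + C" using e by (intro add_mono) auto
    finally show "Lint \<Omega> (star_exp Q p) (Xgrad \<Omega> X d) \<le> C + C" unfolding q_def .
  qed (use C in simp)
qed

end

lemma powr_absorb_half:
  fixes Y a c :: real
  assumes "Y powr (2 / a) \<le> c * Y powr (1 / a)" "0 \<le> c"
  shows "Y powr (1 / a) \<le> c"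
proof (cases "Y powr (1 / a) = 0")
  case False
  then have pos: "0 < Y powr (1 / a)" using powr_ge_zero[of Y "1 / a"] by linarith
  have "Y powr (1 / a) * Y powr (1 / a) = Y powr (2 / a)"
    unfolding powr_add[symmetric] by (simp only: add_divide_distrib[symmetric] one_add_one)
  with assms(1) have "Y powr (1 / a) * Y powr (1 / a) \<le> c * Y powr (1 / a)" by simp
  then show ?thesis using pos by (rule mult_right_le_imp_le)
qed (use assms in simp)

lemma powr_root_cancel:
  fixes y a :: real
  assumes "0 < a" "0 \<le> y"
  shows "(y powr (1 / a)) powr a = y" "(y powr (2 / a)) powr (a / 2) = y"
  using assms by (simp_all add: powr_powr)

context sobolev_setting
begin

lemma Lint_indicator_le:
  fixes F :: "real^'n \<Rightarrow> real"
  assumes F: "F \<in> Lp \<Omega> (ereal p)" "Lint \<Omega> p F \<le> 1" and r: "0 < r" "r < p" and E: "E \<in> sets (lebesgue_on \<Omega>)"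
  shows "Lint \<Omega> r (\<lambda>x. indicator E x * F x) \<le> measure (lebesgue_on \<Omega>) E powr (1 - r / p)"
proof -
  interpret finite_measure "lebesgue_on \<Omega>" by (rule finite_measure_domain)
  let ?f = "\<lambda>x. norm (F x) powr r" and ?g = "indicator E :: real^'n \<Rightarrow> real"
  let ?q = "p / (p - r)"
  have q: "1 < p / r" "1 < ?q" "1 / (p / r) + 1 / ?q = 1" using r by (auto simp: field_simps)
  have Fm: "F \<in> borel_measurable (lebesgue_on \<Omega>)" by (rule Lp_borel[OF F(1)])
  have fp: "norm (?f x) powr (p / r) = norm (F x) powr p" for x using r by (simp add: powr_powr)
  have gp: "norm (?g x) powr ?q = ?g x" for x by (simp add: indicator_def)
  have fm: "?f \<in> borel_measurable (lebesgue_on \<Omega>)" using Fm by measurable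
  have gm: "?g \<in> borel_measurable (lebesgue_on \<Omega>)" using E by (rule borel_measurable_indicator)
  have gi: "integrable (lebesgue_on \<Omega>) ?g" using E by (intro integrable_real_indicator) (simp_all add: less_top[symmetric])
  have fL: "?f \<in> Lp \<Omega> (ereal (p / r))" using F(1) fm unfolding Lp_iff fp by simp
  have gL: "?g \<in> Lp \<Omega> (ereal ?q)" using gm gi unfolding Lp_iff gp by simp
  have eq: "norm (indicator E x * F x) powr r = \<bar>?f x * ?g x\<bar>" for x by (simp add: indicator_def)
  have "Lint \<Omega> r (\<lambda>x. indicator E x * F x) = (LINT x|lebesgue_on \<Omega>. \<bar>?f x * ?g x\<bar>)" unfolding eq ..
  also have "\<dots> \<le> Lint \<Omega> (p / r) ?f powr (1 / (p / r)) * Lint \<Omega> ?q ?g powr (1 / ?q)"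
    by (rule Holder_Lint(2)[OF q fL gL])
  also have "\<dots> = Lint \<Omega> p F powr (1 / (p / r)) * measure (lebesgue_on \<Omega>) E powr (1 / ?q)"
    unfolding fp gp using E sets.sets_into_space[OF E] by (simp add: Int_absorb2)
  also have "\<dots> \<le> 1 * measure (lebesgue_on \<Omega>) E powr (1 / ?q)"
  proof (rule mult_right_mono)
    have "Lint \<Omega> p F powr (1 / (p / r)) \<le> 1 powr (1 / (p / r))" using F(2) r by (intro powr_mono2) auto
    then show "Lint \<Omega> p F powr (1 / (p / r)) \<le> 1" by simp
  qed simp
  also have "1 / ?q = 1 - r / p" using r by (simp add: field_simps)
  finally show ?thesis by simp
qed

text \<open>
  Stampacchia's method. With the ramp between the levels \<open>k\<close> and \<open>k + e\<close>, only the datum on \<open>{\<bar>d\<bar> > k}\<close>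
  enters, and Hoelder's inequality turns this into a power of the measure of that set. The measure of
  \<open>{\<bar>d\<bar> > k + e}\<close> is thus bounded by the power \<open>\<delta>\<close> of the measure of \<open>{\<bar>d\<bar> > k}\<close>, and \<open>\<delta> > 1\<close>
  is the condition \<open>p > Q/2\<close>.
\<close>

lemma sup_estimate:
  assumes p: "Q / 2 < p"
  obtains D where "0 < D" "\<And>A F d. solves A F d \<Longrightarrow> F \<in> Lp \<Omega> (ereal p) \<Longrightarrow> Lint \<Omega> p F \<le> 1 \<Longrightarrow>
     AE x in lebesgue_on \<Omega>. \<bar>d x\<bar> \<le> D"
proof -
  interpret finite_measure "lebesgue_on \<Omega>" by (rule finite_measure_domain)
  obtain S where S: "0 < S" and es: "\<And>A F d h H K. solves A F d \<Longrightarrow> admissible h H K \<Longrightarrow>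
    Lint \<Omega> two_star (\<lambda>x. K (d x)) powr (2 / two_star) \<le> S * (LINT x|lebesgue_on \<Omega>. F x * H (d x))"
    using energy_Sobolev by blast
  let ?a = two_star and ?r = two_star_conj
  define \<delta> where "\<delta> = (1 - ?r / p) / ?r * ?a"
  have a: "0 < ?a" using exponents by linarith
  have p0: "0 < p" using p Q_gt_2 by linarith
  have rp: "?r < p"
  proof -
    have "4 * Q \<le> Q * (Q + 2)" using Q_gt_2 by (simp add: algebra_simps mult_left_mono)
    then have "?r \<le> Q / 2" using Q_gt_2 by (simp add: field_simps)
    then show ?thesis using p by linarith
  qed
  have r0: "0 < ?r" using exponents by linarith
  have \<delta>: "1 < \<delta>"
  proof -
    have "(1 - r / p) / r * a = a / r - a / p" if "0 < r" for r a :: real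
      using that p0 by (simp add: field_simps)
    from this[OF r0] have "\<delta> = ?a / ?r - ?a / p" unfolding \<delta>_def .
    also have "\<dots> = (Q + 2) / (Q - 2) - 2 * Q / ((Q - 2) * p)" using Q_gt_2 by (simp add: divide_simps)
    finally have \<delta>': "\<delta> = (Q + 2) / (Q - 2) - 2 * Q / ((Q - 2) * p)" .
    have "2 * Q / ((Q - 2) * p) < 4 / (Q - 2)" using p p0 Q_gt_2 by (simp add: divide_simps)
    moreover have "(Q + 2) / (Q - 2) = 1 + 4 / (Q - 2)" using Q_gt_2 by (simp add: field_simps)
    ultimately show ?thesis unfolding \<delta>' by linarith
  qed
  have B: "0 < 2 * S" using S by simp
  obtain D where D: "0 < D" and iter: "\<And>\<mu>. (\<And>k. 0 \<le> \<mu> k) \<Longrightarrow> \<mu> 0 \<le> measure (lebesgue_on \<Omega>) \<Omega> \<Longrightarrow> (\<And>k l. k \<le> l \<Longrightarrow> \<mu> l \<le> \<mu> k) \<Longrightarrow>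
    (\<And>k e. 0 \<le> k \<Longrightarrow> 0 < e \<Longrightarrow> \<mu> (k + e) \<le> (2 * S / e) powr ?a * \<mu> k powr \<delta>) \<Longrightarrow> \<mu> D = (0::real)"
    using Stampacchia_iteration[OF B a \<delta>, of "measure (lebesgue_on \<Omega>) \<Omega>"] by blast
  show ?thesis
  proof (rule that[OF D])
    fix A F d assume s: "solves A F d" and F: "F \<in> Lp \<Omega> (ereal p)" "Lint \<Omega> p F \<le> 1"
    have dm [measurable]: "d \<in> borel_measurable (lebesgue_on \<Omega>)" by (rule Lp_borel[OF W0_grad_memD(1)[OF solves_W0_grad[OF s]]])
    let ?E = "\<lambda>k. {x \<in> space (lebesgue_on \<Omega>). k < \<bar>d x\<bar>}"
    let ?\<mu> = "\<lambda>k. measure (lebesgue_on \<Omega>) (?E k)"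
    have Em: "?E k \<in> sets (lebesgue_on \<Omega>)" for k by measurable
    have "?\<mu> D = 0"
    proof (rule iter)
      show "0 \<le> ?\<mu> k" for k by simp
      show "?\<mu> 0 \<le> measure (lebesgue_on \<Omega>) \<Omega>" by (rule finite_measure_mono) auto
      show "?\<mu> l \<le> ?\<mu> k" if "k \<le> l" for k l by (rule finite_measure_mono[OF _ Em]) (use that in auto)
      fix k e :: real assume k: "0 \<le> k" and e: "0 < e"
      obtain h H K where ad: "admissible h H K" and HK: "\<And>t. \<bar>H t\<bar> \<le> \<bar>K t\<bar>"
        and K0: "\<And>t. \<bar>t\<bar> \<le> k \<Longrightarrow> K t = 0" and Ke: "\<And>t. k + e \<le> \<bar>t\<bar> \<Longrightarrow> e / 2 \<le> \<bar>K t\<bar>"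
        using ramp_family[OF k e] by blast
      let ?F = "\<lambda>x. indicator (?E k) x * F x" and ?Y = "Lint \<Omega> ?a (\<lambda>x. K (d x))"
      let ?N = "Lint \<Omega> ?r ?F powr (1 / ?r)"
      have KL: "(\<lambda>x. K (d x)) \<in> Lp \<Omega> (ereal ?a)" by (rule W0_in_L_two_star[OF energy(2)[OF s ad]])
      have FrL: "F \<in> Lp \<Omega> (ereal ?r)" using s by (simp add: solves_def)
      have Fm: "F \<in> borel_measurable (lebesgue_on \<Omega>)" by (rule Lp_borel[OF FrL])
      have F'L: "?F \<in> Lp \<Omega> (ereal ?r)"
      proof (rule Lp_dominated(1)[OF FrL])
        show "?F \<in> borel_measurable (lebesgue_on \<Omega>)"
          by (intro borel_measurable_times borel_measurable_indicator Em Fm)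
        show "norm (?F x) \<le> norm (F x)" for x by (cases "x \<in> ?E k") simp_all
      qed (rule less_imp_le[OF r0])
      have "(LINT x|lebesgue_on \<Omega>. F x * H (d x)) \<le> (LINT x|lebesgue_on \<Omega>. \<bar>?F x * K (d x)\<bar>)"
      proof (rule integral_mono)
        show "integrable (lebesgue_on \<Omega>) (\<lambda>x. F x * H (d x))" by (rule datum_integrable[OF FrL energy(1)[OF s ad]])
        show "integrable (lebesgue_on \<Omega>) (\<lambda>x. \<bar>?F x * K (d x)\<bar>)"
          by (rule integrable_abs[OF datum_integrable[OF F'L energy(2)[OF s ad]]])
        fix x assume x: "x \<in> space (lebesgue_on \<Omega>)"
        show "F x * H (d x) \<le> \<bar>?F x * K (d x)\<bar>"
        proof (cases "x \<in> ?E k")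
          case True
          have "F x * H (d x) \<le> \<bar>F x\<bar> * \<bar>H (d x)\<bar>" using abs_ge_self[of "F x * H (d x)"] by (simp add: abs_mult)
          also have "\<dots> \<le> \<bar>F x\<bar> * \<bar>K (d x)\<bar>" by (intro mult_left_mono HK) simp
          finally show ?thesis using True by (simp add: abs_mult)
        next
          case False
          then have "K (d x) = 0" using x by (intro K0) simp
          then have "H (d x) = 0" using HK[of "d x"] by simp
          then show ?thesis by simp
        qed
      qed
      also have "\<dots> \<le> ?N * ?Y powr (1 / ?a)"
        using exponents by (intro Holder_Lint(2) F'L KL) auto
      finally have "?Y powr (2 / ?a) \<le> S * (?N * ?Y powr (1 / ?a))"
        using es[OF s ad] S mult_left_mono[of "LINT x|lebesgue_on \<Omega>. F x * H (d x)" "?N * ?Y powr (1 / ?a)" S] by linarith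
      then have y: "?Y powr (1 / ?a) \<le> S * ?N"
        using S by (intro powr_absorb_half) (simp_all only: mult.assoc, simp)
      have N: "?N \<le> (?\<mu> k powr (1 - ?r / p)) powr (1 / ?r)"
        by (rule powr_mono2[OF divide_nonneg_nonneg[OF zero_le_one less_imp_le[OF r0]] Lint_nonneg
              Lint_indicator_le[OF F r0 rp Em]])
      have "?Y = (?Y powr (1 / ?a)) powr ?a" by (rule powr_root_cancel(1)[OF a Lint_nonneg, symmetric])
      also have "\<dots> \<le> (S * (?\<mu> k powr (1 - ?r / p)) powr (1 / ?r)) powr ?a"
        by (rule powr_mono2[OF less_imp_le[OF a] powr_ge_zero
              order.trans[OF y mult_left_mono[OF N less_imp_le[OF S]]]])
      also have "\<dots> = S powr ?a * ?\<mu> k powr \<delta>"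
        unfolding powr_mult powr_powr \<delta>_def by simp
      finally have Yle: "?Y \<le> S powr ?a * ?\<mu> k powr \<delta>" .
      have "?\<mu> (k + e) * (e / 2) powr ?a \<le> ?Y"
      proof -
        have "?\<mu> (k + e) * (e / 2) powr ?a \<le> (LINT x|lebesgue_on \<Omega>. \<bar>K (d x)\<bar> powr ?a)"
          by (rule measure_Markov_powr[OF _ _ _ a Em]) (use KL e Ke in \<open>auto simp: Lp_iff\<close>)
        then show ?thesis by simp
      qed
      then have "?\<mu> (k + e) * (e / 2) powr ?a \<le> S powr ?a * ?\<mu> k powr \<delta>" using Yle by (rule order.trans)
      then have "?\<mu> (k + e) \<le> S powr ?a * ?\<mu> k powr \<delta> / (e / 2) powr ?a"
        using e by (subst pos_le_divide_eq) auto
      also have "\<dots> = (S / (e / 2)) powr ?a * ?\<mu> k powr \<delta>" by (simp only: powr_divide times_divide_eq_left)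
      also have "S / (e / 2) = 2 * S / e" by simp
      finally show "?\<mu> (k + e) \<le> (2 * S / e) powr ?a * ?\<mu> k powr \<delta>" .
    qed
    then have "emeasure (lebesgue_on \<Omega>) (?E D) = 0" by (simp add: emeasure_eq_measure)
    then show "AE x in lebesgue_on \<Omega>. \<bar>d x\<bar> \<le> D"
      by (intro AE_I[OF _ _ Em[of D]]) auto
  qed
qed

lemma datum_integrable_L1:
  assumes "solves A F d"
  shows "F \<in> Lp \<Omega> (ereal 1)" "integrable (lebesgue_on \<Omega>) F"
proof -
  have Fr: "F \<in> Lp \<Omega> (ereal two_star_conj)" using assms by (simp add: solves_def)
  show "F \<in> Lp \<Omega> (ereal 1)"
    by (rule Lp_mono[OF lmeasurable_domain Fr zero_le_one less_imp_le[OF exponents(1)]])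
  then show "integrable (lebesgue_on \<Omega>) F"
    by (subst integrable_norm_iff[symmetric]) (auto simp: Lp_iff)
qed

lemma datum_bounded_test:
  assumes s: "solves A F d" and ad: "admissible h H K" and c: "\<And>t. \<bar>H t\<bar> \<le> c"
  shows "(LINT x|lebesgue_on \<Omega>. F x * H (d x)) \<le> c * Lint \<Omega> 1 F"
proof -
  have FrL: "F \<in> Lp \<Omega> (ereal two_star_conj)" using s by (simp add: solves_def)
  have "(LINT x|lebesgue_on \<Omega>. F x * H (d x)) \<le> (LINT x|lebesgue_on \<Omega>. c * norm (F x))"
  proof (rule integral_mono)
    show "integrable (lebesgue_on \<Omega>) (\<lambda>x. F x * H (d x))" by (rule datum_integrable[OF FrL energy(1)[OF s ad]])
    show "integrable (lebesgue_on \<Omega>) (\<lambda>x. c * norm (F x))"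
      by (rule integrable_mult_right) (rule integrable_norm[OF datum_integrable_L1(2)[OF s]])
    show "F x * H (d x) \<le> c * norm (F x)" for x
    proof -
      have "F x * H (d x) \<le> \<bar>F x\<bar> * \<bar>H (d x)\<bar>" using abs_ge_self[of "F x * H (d x)"] by (simp add: abs_mult)
      also have "\<dots> \<le> \<bar>F x\<bar> * c" by (rule mult_left_mono[OF c abs_ge_zero])
      also have "\<dots> = c * norm (F x)" by simp
      finally show ?thesis .
    qed
  qed
  also have "\<dots> = c * Lint \<Omega> 1 F" by simp
  finally show ?thesis .
qed

text \<open>
  With an integrable datum, the exponent of the power family is chosen so small that \<open>H\<close> is bounded
  and just large enough that the gradient is still integrable.
\<close>

lemma W11_estimate:
  obtains C where "0 \<le> C" "\<And>A F d. solves A F d \<Longrightarrow> Lint \<Omega> 1 F \<le> 1 \<Longrightarrow> Lint \<Omega> 1 (Xgrad \<Omega> X d) \<le> C"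
proof -
  obtain S where S: "0 < S" and es: "\<And>A F d h H K. solves A F d \<Longrightarrow> admissible h H K \<Longrightarrow>
    Lint \<Omega> two_star (\<lambda>x. K (d x)) powr (2 / two_star) \<le> S * (LINT x|lebesgue_on \<Omega>. F x * H (d x))"
    using energy_Sobolev by blast
  define \<gamma> where "\<gamma> = (Q - 2) / (2 * (Q - 1))"
  have \<gamma>: "0 < \<gamma>" "\<gamma> < 1 / 2" "\<gamma> \<le> 1" using Q_gt_2 by (auto simp: \<gamma>_def field_simps)
  have ge: "(1 - \<gamma>) * (2 * 1 / (2 - 1)) = two_star * \<gamma>" using Q_gt_2 by (simp add: \<gamma>_def divide_simps)
  define c where "c = 1 / (1 - 2 * \<gamma>)"
  have c: "0 \<le> c" using \<gamma> by (simp add: c_def)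
  obtain H K where ad: "admissible (\<lambda>t. (1 + \<bar>t\<bar>) powr (\<gamma> - 1)) H K"
    and KK: "\<And>t. 1 + \<gamma> * \<bar>K t\<bar> = (1 + \<bar>t\<bar>) powr \<gamma>" and H: "\<And>t. \<bar>H t\<bar> \<le> c"
  proof -
    obtain H K where hk: "admissible (\<lambda>t. (1 + \<bar>t\<bar>) powr (\<gamma> - 1)) H K"
      "\<And>t. 1 + \<gamma> * \<bar>K t\<bar> = (1 + \<bar>t\<bar>) powr \<gamma>"
      "\<And>t. 1 / 2 < \<gamma> \<Longrightarrow> \<bar>H t\<bar> \<le> 1 / (2 * \<gamma> - 1) * (1 + \<gamma> * \<bar>K t\<bar>) powr ((2 * \<gamma> - 1) / \<gamma>)"
      "\<And>t. \<gamma> < 1 / 2 \<Longrightarrow> \<bar>H t\<bar> \<le> 1 / (1 - 2 * \<gamma>)"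
      using power_family[OF \<gamma>(1,3)] by blast
    show ?thesis by (rule that[OF hk(1,2)]) (use hk(4)[OF \<gamma>(2)] in \<open>simp add: c_def\<close>)
  qed
  have a: "0 < two_star" using exponents by linarith
  define V where "V = 2 powr two_star * measure lebesgue \<Omega> + 2 powr two_star * \<gamma> powr two_star * (S * c) powr (two_star / 2)"
  show ?thesis
  proof (rule that[of "c / \<alpha> + V"])
    show "0 \<le> c / \<alpha> + V" using c \<alpha>_pos by (simp add: V_def)
    fix A F d assume s: "solves A F d" and F: "Lint \<Omega> 1 F \<le> 1"
    let ?Y = "Lint \<Omega> two_star (\<lambda>x. K (d x))"
    have rhs: "(LINT x|lebesgue_on \<Omega>. F x * H (d x)) \<le> c"
      using datum_bounded_test[OF s ad H] mult_left_mono[OF F c] by linarith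
    have KL: "(\<lambda>x. K (d x)) \<in> Lp \<Omega> (ereal two_star)" by (rule W0_in_L_two_star[OF energy(2)[OF s ad]])
    have Y2: "?Y powr (2 / two_star) \<le> S * c" using es[OF s ad] mult_left_mono[OF rhs, of S] S by linarith
    have "0 \<le> two_star / 2" by (rule divide_nonneg_nonneg[OF less_imp_le[OF a]]) simp
    from powr_mono2[OF this powr_ge_zero Y2]
    have "(?Y powr (2 / two_star)) powr (two_star / 2) \<le> (S * c) powr (two_star / 2)" .
    moreover have "(?Y powr (2 / two_star)) powr (two_star / 2) = ?Y" by (rule powr_root_cancel(2)[OF a Lint_nonneg])
    ultimately have Y: "?Y \<le> (S * c) powr (two_star / 2)" by simp
    have "Lint \<Omega> two_star (\<lambda>x. 1 + \<gamma> * \<bar>K (d x)\<bar>) \<le> 2 powr two_star * measure lebesgue \<Omega> + 2 powr two_star * \<gamma> powr two_star * ?Y"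
      by (rule Lp_one_plus(2)[OF KL]) (use \<gamma> a in auto)
    also have "\<dots> \<le> V" unfolding V_def by (intro add_left_mono mult_left_mono Y) auto
    finally have V: "Lint \<Omega> two_star (\<lambda>x. 1 + \<gamma> * \<bar>K (d x)\<bar>) \<le> V" .
    have ZL: "(\<lambda>x. 1 + \<gamma> * \<bar>K (d x)\<bar>) \<in> Lp \<Omega> (ereal two_star)"
      by (rule Lp_one_plus(1)[OF KL]) (use \<gamma> a in auto)
    have "\<alpha> * Lint \<Omega> 2 (\<lambda>x. (1 + \<bar>d x\<bar>) powr (\<gamma> - 1) *\<^sub>R Xgrad \<Omega> X d x) \<le> c"
      by (rule order.trans[OF energy(3)[OF s ad] rhs])
    then have "Lint \<Omega> 2 (\<lambda>x. (1 + \<bar>d x\<bar>) powr (\<gamma> - 1) *\<^sub>R Xgrad \<Omega> X d x) \<le> c / \<alpha>"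
      using \<alpha>_pos by (simp only: pos_le_divide_eq mult.commute)
    then show "Lint \<Omega> 1 (Xgrad \<Omega> X d) \<le> c / \<alpha> + V"
      using gradient_from_power_family[OF s \<gamma>(1) _ _ ge ad KK ZL] V by linarith
  qed
qed

text \<open>
  Chebyshev's inequality for \<open>K (d)\<close> on \<open>{\<bar>d\<bar> \<ge> 1}\<close> and for \<open>h (d) G\<close> on \<open>{\<bar>d\<bar> < 1}\<close>, with
  \<open>K = arsinh\<close>.
\<close>

lemma level_estimate:
  obtains C where "0 \<le> C" "\<And>A F d G n. solves A F d \<Longrightarrow> W0_grad \<Omega> X 2 d G \<Longrightarrow> Lint \<Omega> 1 F \<le> n \<Longrightarrow> 
     measure (lebesgue_on \<Omega>) {x \<in> \<Omega>. 1 \<le> \<bar>d x\<bar>} \<le> C * n powr (Q / (Q - 2))"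
    "\<And>A F d G n l. solves A F d \<Longrightarrow> W0_grad \<Omega> X 2 d G \<Longrightarrow> Lint \<Omega> 1 F \<le> n \<Longrightarrow> 0 < l \<Longrightarrow>
     measure (lebesgue_on \<Omega>) {x \<in> \<Omega>. \<bar>d x\<bar> < 1 \<and> l \<le> norm (G x)} \<le> C * (n / l\<^sup>2)"
proof -
  interpret finite_measure "lebesgue_on \<Omega>" by (rule finite_measure_domain)
  obtain S where S: "0 < S" and es: "\<And>A F d h H K. solves A F d \<Longrightarrow> admissible h H K \<Longrightarrow>
    Lint \<Omega> two_star (\<lambda>x. K (d x)) powr (2 / two_star) \<le> S * (LINT x|lebesgue_on \<Omega>. F x * H (d x))"
    using energy_Sobolev by blast
  let ?a = two_star
  have a: "0 < ?a" "?a / 2 = Q / (Q - 2)" using Q_gt_2 by (simp_all add: divide_simps)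
  have ar: "0 < arsinh (1::real)" by simp
  define C1 where "C1 = (S * 2) powr (Q / (Q - 2)) / arsinh 1 powr ?a"
  define C2 where "C2 = 4 / \<alpha>"
  have C12: "0 \<le> C1" "0 \<le> C2" using \<alpha>_pos by (auto simp: C1_def C2_def)
  have at: "\<bar>arctan t\<bar> \<le> 2" for t
    using arctan_bounded[of t] pi_less_4 by linarith
  have rhs: "(LINT x|lebesgue_on \<Omega>. F x * arctan (d x)) \<le> 2 * n" if "solves A F d" "Lint \<Omega> 1 F \<le> n" for A F d n
    using datum_bounded_test[OF that(1) arctan_family at] that(2) by linarith
  show ?thesis
  proof (rule that[of "max C1 C2"])
    show "0 \<le> max C1 C2" using C12 by simp
    fix A F d G n assume s: "solves A F d" and W: "W0_grad \<Omega> X 2 d G" and F: "Lint \<Omega> 1 F \<le> n"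
    have n: "0 \<le> n" using F Lint_nonneg[where \<Omega>=\<Omega> and p=1 and f=F] by linarith
    have dm: "d \<in> borel_measurable (lebesgue_on \<Omega>)" by (rule Lp_borel[OF W0_grad_memD(1)[OF W]])
    let ?Y = "Lint \<Omega> ?a (\<lambda>x. arsinh (d x))"
    let ?E = "{x \<in> space (lebesgue_on \<Omega>). 1 \<le> \<bar>d x\<bar>}"
    have E: "?E \<in> sets (lebesgue_on \<Omega>)" using dm by measurable
    have KL: "(\<lambda>x. arsinh (d x)) \<in> Lp \<Omega> (ereal ?a)" by (rule W0_in_L_two_star[OF energy(2)[OF s arctan_family]])
    have ge: "arsinh 1 \<le> \<bar>arsinh t\<bar>" if "1 \<le> \<bar>t\<bar>" for t :: real
    proof -
      have "\<bar>arsinh t\<bar> = arsinh \<bar>t\<bar>" by (cases "0 \<le> t") (auto simp: abs_if arsinh_minus_real)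
      moreover have "arsinh 1 \<le> arsinh \<bar>t\<bar>"
        using arsinh_less_iff_real[of "\<bar>t\<bar>" 1] that by linarith
      ultimately show ?thesis by simp
    qed
    have "measure (lebesgue_on \<Omega>) ?E * arsinh 1 powr ?a \<le> (LINT x|lebesgue_on \<Omega>. \<bar>arsinh (d x)\<bar> powr ?a)"
      by (rule measure_Markov_powr[OF _ _ ar a(1) E]) (use KL ge in \<open>auto simp: Lp_iff\<close>)
    also have "\<dots> = ?Y" by simp
    also have "?Y \<le> (S * 2) powr (Q / (Q - 2)) * n powr (Q / (Q - 2))"
    proof -
      have Y2: "?Y powr (2 / ?a) \<le> S * (2 * n)" using es[OF s arctan_family] mult_left_mono[OF rhs[OF s F], of S] S by linarith
      have "0 \<le> ?a / 2" by (rule divide_nonneg_nonneg[OF less_imp_le[OF a(1)]]) simp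
      from powr_mono2[OF this powr_ge_zero Y2]
      have "(?Y powr (2 / ?a)) powr (?a / 2) \<le> (S * (2 * n)) powr (?a / 2)" .
      moreover have "(?Y powr (2 / ?a)) powr (?a / 2) = ?Y" by (rule powr_root_cancel(2)[OF a(1) Lint_nonneg])
      ultimately have "?Y \<le> (S * 2 * n) powr (?a / 2)" by (simp only: mult.assoc)
      then show ?thesis unfolding a(2) powr_mult[of "S * 2" n] .
    qed
    finally have "measure (lebesgue_on \<Omega>) ?E \<le> (S * 2) powr (Q / (Q - 2)) * n powr (Q / (Q - 2)) / arsinh 1 powr ?a"
      using ar by (subst pos_le_divide_eq) auto
    also have "\<dots> = C1 * n powr (Q / (Q - 2))" by (simp add: C1_def)
    also have "\<dots> \<le> max C1 C2 * n powr (Q / (Q - 2))" by (intro mult_right_mono) auto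
    finally show "measure (lebesgue_on \<Omega>) {x \<in> \<Omega>. 1 \<le> \<bar>d x\<bar>} \<le> max C1 C2 * n powr (Q / (Q - 2))" by simp
  next
    fix A F d G n and l :: real assume s: "solves A F d" and W: "W0_grad \<Omega> X 2 d G" and F: "Lint \<Omega> 1 F \<le> n" and l: "0 < l"
    have n: "0 \<le> n" using F Lint_nonneg[where \<Omega>=\<Omega> and p=1 and f=F] by linarith
    have dm: "d \<in> borel_measurable (lebesgue_on \<Omega>)" and Gm: "G \<in> borel_measurable (lebesgue_on \<Omega>)"
      using W0_grad_memD[OF W] by (auto intro: Lp_borel)
    let ?h = "\<lambda>t::real. 1 / sqrt (1 + t\<^sup>2)"
    let ?W = "\<lambda>x. ?h (d x) *\<^sub>R G x"
    have ae: "AE x in lebesgue_on \<Omega>. ?h (d x) *\<^sub>R Xgrad \<Omega> X d x = ?W x"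
      using Xgrad_AE_eq(1)[OF W one_le_numeral] by eventually_elim simp
    have Wm: "?W \<in> borel_measurable (lebesgue_on \<Omega>)" using dm Gm by measurable
    note cong = Lp_AE_cong[OF W0_grad_memD(2)[OF energy(2)[OF s arctan_family]] Wm ae]
    let ?E = "{x \<in> space (lebesgue_on \<Omega>). \<bar>d x\<bar> < 1 \<and> l \<le> norm (G x)}"
    have E: "?E \<in> sets (lebesgue_on \<Omega>)" using dm Gm by measurable
    have ge: "l / sqrt 2 \<le> \<bar>norm (?W x)\<bar>" if x: "\<bar>d x\<bar> < 1" "l \<le> norm (G x)" for x
    proof -
      have "(d x)\<^sup>2 \<le> 1" using x(1) by (simp add: abs_square_le_1)
      then have "sqrt (1 + (d x)\<^sup>2) \<le> sqrt 2" by simp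
      moreover have "0 < sqrt (1 + (d x)\<^sup>2)" by (simp add: add_pos_nonneg)
      ultimately have "l / sqrt 2 \<le> norm (G x) / sqrt (1 + (d x)\<^sup>2)" using x(2) l by (intro frac_le) auto
      then show ?thesis by simp
    qed
    have "measure (lebesgue_on \<Omega>) ?E * (l / sqrt 2) powr 2 \<le> (LINT x|lebesgue_on \<Omega>. \<bar>norm (?W x)\<bar> powr 2)"
    proof (rule measure_Markov_powr[OF _ _ _ _ E])
      show "(\<lambda>x. norm (?W x)) \<in> borel_measurable (lebesgue_on \<Omega>)" using Wm by measurable
      show "integrable (lebesgue_on \<Omega>) (\<lambda>x. \<bar>norm (?W x)\<bar> powr 2)" using cong(1) unfolding Lp_iff abs_norm_cancel by blast
      show "l / sqrt 2 \<le> \<bar>norm (?W x)\<bar>" if "x \<in> ?E" for x using that by (intro ge) auto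
    qed (use l in auto)
    also have "\<dots> = Lint \<Omega> 2 (\<lambda>x. ?h (d x) *\<^sub>R Xgrad \<Omega> X d x)" unfolding abs_norm_cancel by (rule cong(2)[symmetric])
    also have "\<dots> \<le> 2 * n / \<alpha>"
      using order.trans[OF energy(3)[OF s arctan_family] rhs[OF s F]] \<alpha>_pos by (subst pos_le_divide_eq) (simp_all only: mult.commute)
    also have "(l / sqrt 2) powr 2 = l\<^sup>2 / 2" using l by (simp add: power_divide)
    finally have "measure (lebesgue_on \<Omega>) ?E \<le> 2 * n / \<alpha> / (l\<^sup>2 / 2)" using l by (subst pos_le_divide_eq) simp_all
    also have "\<dots> = C2 * (n / l\<^sup>2)" by (simp add: C2_def)
    also have "\<dots> \<le> max C1 C2 * (n / l\<^sup>2)" using n by (intro mult_right_mono) auto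
    finally show "measure (lebesgue_on \<Omega>) {x \<in> \<Omega>. \<bar>d x\<bar> < 1 \<and> l \<le> norm (G x)} \<le> max C1 C2 * (n / l\<^sup>2)" by simp
  qed
qed

text \<open>
  Dividing the equation by \<open>t\<close> moves the level \<open>t\<close> to \<open>1\<close>. For the gradient, the set \<open>{\<bar>G\<bar> \<ge> t}\<close> is split
  by a level \<open>k\<close> of \<open>d\<close>.
\<close>

lemma weak_type_estimate:
  obtains C where "0 \<le> C"
    "\<And>A F d G N t. solves A F d \<Longrightarrow> W0_grad \<Omega> X 2 d G \<Longrightarrow> Lint \<Omega> 1 F \<le> N \<Longrightarrow> 0 < t \<Longrightarrow>
     measure (lebesgue_on \<Omega>) {x \<in> \<Omega>. t \<le> \<bar>d x\<bar>} \<le> C * (N / t) powr (Q / (Q - 2))"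
    "\<And>A F d G N t. solves A F d \<Longrightarrow> W0_grad \<Omega> X 2 d G \<Longrightarrow> Lint \<Omega> 1 F \<le> N \<Longrightarrow> 0 < N \<Longrightarrow> 0 < t \<Longrightarrow>
     measure (lebesgue_on \<Omega>) {x \<in> \<Omega>. t \<le> norm (G x)} \<le> C * (N / t) powr (Q / (Q - 1))"
proof -
  interpret finite_measure "lebesgue_on \<Omega>" by (rule finite_measure_domain)
  obtain C where C: "0 \<le> C" and lev1: "\<And>A F d G n. solves A F d \<Longrightarrow> W0_grad \<Omega> X 2 d G \<Longrightarrow> Lint \<Omega> 1 F \<le> n \<Longrightarrow>
     measure (lebesgue_on \<Omega>) {x \<in> \<Omega>. 1 \<le> \<bar>d x\<bar>} \<le> C * n powr (Q / (Q - 2))"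
    and lev2: "\<And>A F d G n l. solves A F d \<Longrightarrow> W0_grad \<Omega> X 2 d G \<Longrightarrow> Lint \<Omega> 1 F \<le> n \<Longrightarrow> 0 < l \<Longrightarrow>
     measure (lebesgue_on \<Omega>) {x \<in> \<Omega>. \<bar>d x\<bar> < 1 \<and> l \<le> norm (G x)} \<le> C * (n / l\<^sup>2)"
    using level_estimate by blast
  have scaled: "solves A (\<lambda>x. 1 / t * F x) (\<lambda>x. 1 / t * d x)" "W0_grad \<Omega> X 2 (\<lambda>x. 1 / t * d x) (\<lambda>x. (1 / t) *\<^sub>R G x)"
      "Lint \<Omega> 1 (\<lambda>x. 1 / t * F x) \<le> N / t"
    if "solves A F d" "W0_grad \<Omega> X 2 d G" "Lint \<Omega> 1 F \<le> N" "0 < t" for A F d G N t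
  proof -
    show "solves A (\<lambda>x. 1 / t * F x) (\<lambda>x. 1 / t * d x)" by (rule solves_scale[OF that(1)])
    show "W0_grad \<Omega> X 2 (\<lambda>x. 1 / t * d x) (\<lambda>x. (1 / t) *\<^sub>R G x)"
      using W0_grad_lincomb[OF that(2) that(2), of "1 / t" 0] by simp
    show "Lint \<Omega> 1 (\<lambda>x. 1 / t * F x) \<le> N / t"
      using Lint_scale[where \<Omega>=\<Omega> and p=1 and c="1 / t" and f=F] that(3,4) by (simp add: divide_right_mono)
  qed
  have first: "measure (lebesgue_on \<Omega>) {x \<in> \<Omega>. t \<le> \<bar>d x\<bar>} \<le> C * (N / t) powr (Q / (Q - 2))"
    if h: "solves A F d" "W0_grad \<Omega> X 2 d G" "Lint \<Omega> 1 F \<le> N" "0 < t" for A F d G N t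
  proof -
    have "{x \<in> \<Omega>. 1 \<le> \<bar>1 / t * d x\<bar>} = {x \<in> \<Omega>. t \<le> \<bar>d x\<bar>}" using h(4) by (auto simp: abs_mult field_simps)
    then show ?thesis using lev1[OF scaled[OF h]] by simp
  qed
  show ?thesis
  proof (rule that[of "2 * C"])
    show "0 \<le> 2 * C" using C by simp
    show "measure (lebesgue_on \<Omega>) {x \<in> \<Omega>. t \<le> \<bar>d x\<bar>} \<le> 2 * C * (N / t) powr (Q / (Q - 2))"
      if "solves A F d" "W0_grad \<Omega> X 2 d G" "Lint \<Omega> 1 F \<le> N" "0 < t" for A F d G N t
      using first[OF that] mult_nonneg_nonneg[OF C powr_ge_zero[of "N / t" "Q / (Q - 2)"]] by linarith
    fix A F d G N t assume s: "solves A F d" and W: "W0_grad \<Omega> X 2 d G" and F: "Lint \<Omega> 1 F \<le> N" and N: "0 < N" and t: "0 < (t::real)"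
    \<comment> \<open>The level \<open>k\<close> at which the two contributions balance.\<close>
    define k where "k = N powr (1 / (Q - 1)) * t powr ((Q - 2) / (Q - 1))"
    have k: "0 < k" using N t by (simp add: k_def)
    have Q1: "0 < Q - 1" "0 < Q - 2" using Q_gt_2 by auto
    have lnk: "ln k = (ln N + (Q - 2) * ln t) / (Q - 1)"
      using N t by (simp add: k_def ln_mult ln_powr add_divide_distrib)
    have e1: "(N / k) powr (Q / (Q - 2)) = (N / t) powr (Q / (Q - 1))"
    proof -
      have "Q / (Q - 2) * (ln N - ln k) = Q / (Q - 1) * (ln N - ln t)"
        unfolding lnk using Q1 by (simp add: divide_simps) (simp add: algebra_simps)
      then show ?thesis using N k t by (simp add: powr_def ln_div)
    qed
    have e2: "N / k / (t / k)\<^sup>2 = (N / t) powr (Q / (Q - 1))"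
    proof -
      have "ln N + ln k - 2 * ln t = Q / (Q - 1) * (ln N - ln t)"
        unfolding lnk using Q1 by (simp add: divide_simps) (simp add: algebra_simps)
      then have "exp (ln N + ln k - 2 * ln t) = (N / t) powr (Q / (Q - 1))" using N t by (simp add: powr_def ln_div)
      moreover have "exp (ln N + ln k - 2 * ln t) = N * k / t\<^sup>2"
        using N k t by (simp add: exp_add exp_diff exp_double)
      ultimately show ?thesis using k t by (simp add: power2_eq_square divide_simps)
    qed
    have dm: "d \<in> borel_measurable (lebesgue_on \<Omega>)" and Gm: "G \<in> borel_measurable (lebesgue_on \<Omega>)"
      using W0_grad_memD[OF W] by (auto intro: Lp_borel)
    let ?E1 = "{x \<in> \<Omega>. k \<le> \<bar>d x\<bar>}" and ?E2 = "{x \<in> \<Omega>. \<bar>d x\<bar> < k \<and> t \<le> norm (G x)}"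
    have "{x \<in> space (lebesgue_on \<Omega>). k \<le> \<bar>d x\<bar>} \<in> sets (lebesgue_on \<Omega>)"
      "{x \<in> space (lebesgue_on \<Omega>). \<bar>d x\<bar> < k \<and> t \<le> norm (G x)} \<in> sets (lebesgue_on \<Omega>)" using dm Gm by measurable
    then have Em: "?E1 \<in> sets (lebesgue_on \<Omega>)" "?E2 \<in> sets (lebesgue_on \<Omega>)" by simp_all
    have "{x \<in> \<Omega>. \<bar>1 / k * d x\<bar> < 1 \<and> t / k \<le> norm ((1 / k) *\<^sub>R G x)} = ?E2"
      using k by (auto simp: abs_mult field_simps)
    then have E2: "measure (lebesgue_on \<Omega>) ?E2 \<le> C * (N / k / (t / k)\<^sup>2)"
      using lev2[OF scaled[OF s W F k], of "t / k"] k t by simp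
    have "measure (lebesgue_on \<Omega>) {x \<in> \<Omega>. t \<le> norm (G x)} \<le> measure (lebesgue_on \<Omega>) (?E1 \<union> ?E2)"
      by (rule finite_measure_mono[OF _ sets.Un[OF Em]]) auto
    also have "\<dots> \<le> measure (lebesgue_on \<Omega>) ?E1 + measure (lebesgue_on \<Omega>) ?E2"
      by (rule measure_Un_le[OF Em])
    also have "\<dots> \<le> 2 * C * (N / t) powr (Q / (Q - 1))"
      using first[OF s W F k] E2 unfolding e1 e2 by linarith
    finally show "measure (lebesgue_on \<Omega>) {x \<in> \<Omega>. t \<le> norm (G x)} \<le> 2 * C * (N / t) powr (Q / (Q - 1))" .
  qed
qed

end

section \<open>Homogeneity and limits\<close>

text \<open>
  Admitting every \<open>s\<close> above the norm \<open>N\<close> of the datum covers data of norm zero, by which one cannot divide.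
\<close>

lemma homogeneity_limit:
  fixes a c N :: real
  assumes "0 \<le> c" "\<And>s. N < s \<Longrightarrow> a \<le> c * s"
  shows "a \<le> c * N"
proof (rule field_le_epsilon)
  fix e :: real assume e: "0 < e"
  have "a \<le> c * (N + e / (c + 1))" using assms e by (intro assms(2)) auto
  also have "\<dots> = c * N + c / (c + 1) * e" by (simp add: distrib_left)
  also have "c / (c + 1) * e \<le> 1 * e" using assms(1) e by (intro mult_right_mono) auto
  finally show "a \<le> c * N + e" by simp
qed

lemma Marcinkiewicz_normI:
  fixes w :: "'a::euclidean_space \<Rightarrow> 'b::euclidean_space"
  assumes \<Omega>: "\<Omega> \<in> sets lebesgue" and w: "w \<in> borel_measurable (lebesgue_on \<Omega>)" and c: "0 \<le> c" and p: "0 < p" and N: "0 \<le> N"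
    and le: "\<And>s t. N < s \<Longrightarrow> 0 < t \<Longrightarrow> measure (lebesgue_on \<Omega>) {x \<in> \<Omega>. t \<le> norm (w x)} \<le> c * (s / t) powr p"
  shows "w \<in> Marcinkiewicz \<Omega> p" "Marcinkiewicz_norm \<Omega> p w \<le> c powr (1 / p) * N"
proof -
  have mem: "c * s powr p \<in> Marcinkiewicz_consts \<Omega> p w" if s: "N < s" for s
  proof -
    have "measure lebesgue {x \<in> \<Omega>. t \<le> norm (w x)} \<le> c * s powr p * t powr (- p)" if t: "0 < t" for t
    proof -
      have "measure lebesgue {x \<in> \<Omega>. t \<le> norm (w x)} = measure (lebesgue_on \<Omega>) {x \<in> \<Omega>. t \<le> norm (w x)}"
        using \<Omega> by (subst measure_restrict_space) auto
      also have "\<dots> \<le> c * (s / t) powr p" by (rule le[OF s t])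
      also have "\<dots> = c * s powr p * t powr (- p)" by (simp add: powr_divide powr_minus_divide)
      finally show ?thesis .
    qed
    then show ?thesis using c unfolding Marcinkiewicz_consts_def by simp
  qed
  have "Marcinkiewicz_consts \<Omega> p w \<noteq> {}" using mem[of "N + 1"] by auto
  note ne = this
  then show "w \<in> Marcinkiewicz \<Omega> p" using w by (simp add: Marcinkiewicz_def)
  have lower: "0 \<le> x" if "x \<in> Marcinkiewicz_consts \<Omega> p w" for x using that by (simp add: Marcinkiewicz_consts_def)
  show "Marcinkiewicz_norm \<Omega> p w \<le> c powr (1 / p) * N"
  proof (rule homogeneity_limit)
    fix s assume s: "N < s"
    have "Inf (Marcinkiewicz_consts \<Omega> p w) \<le> c * s powr p"
      by (rule cInf_lower[OF mem[OF s] bdd_belowI[OF lower]])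
    then have "Inf (Marcinkiewicz_consts \<Omega> p w) powr (1 / p) \<le> (c * s powr p) powr (1 / p)"
      using p cInf_greatest[OF ne lower] by (intro powr_mono2) auto
    also have "\<dots> = c powr (1 / p) * s" using p s N by (simp add: powr_mult powr_powr)
    finally show "Marcinkiewicz_norm \<Omega> p w \<le> c powr (1 / p) * s" by (simp add: Marcinkiewicz_norm_def)
  qed simp
qed

lemma Lp_tendsto_Cauchy:
  fixes F :: "nat \<Rightarrow> 'a::euclidean_space \<Rightarrow> 'b::euclidean_space"
  assumes F: "Lp_tendsto \<Omega> (ereal p) F f" and p: "0 < p" and e: "0 < e"
  shows "\<exists>N. \<forall>m\<ge>N. \<forall>n\<ge>N. Lint \<Omega> p (\<lambda>x. F m x - F n x) < e"
proof -
  have mem: "\<And>n. F n \<in> Lp \<Omega> (ereal p)" "f \<in> Lp \<Omega> (ereal p)"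
    and lim: "(\<lambda>n. Lint \<Omega> p (\<lambda>x. F n x - f x)) \<longlonglongrightarrow> 0"
    using F by (auto simp: Lp_tendsto_iff[OF p])
  have "0 < e / (2 * 2 powr p)" using e by simp
  from order_tendstoD(2)[OF lim this]
  obtain N where N: "\<And>n. N \<le> n \<Longrightarrow> Lint \<Omega> p (\<lambda>x. F n x - f x) < e / (2 * 2 powr p)"
    unfolding eventually_sequentially by blast
  have "Lint \<Omega> p (\<lambda>x. F m x - F n x) < e" if "N \<le> m" "N \<le> n" for m n
  proof -
    have D: "(\<lambda>x. F k x - f x) \<in> Lp \<Omega> (ereal p)" for k using p by (intro Lp_diff mem) simp
    have "Lint \<Omega> p (\<lambda>x. F m x - F n x) \<le> 2 powr p * (Lint \<Omega> p (\<lambda>x. F m x - f x) + Lint \<Omega> p (\<lambda>x. F n x - f x))"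
      using Lint_diff_le[OF D[of m] D[of n]] p by simp
    also have "\<dots> < 2 powr p * (e / (2 * 2 powr p) + e / (2 * 2 powr p))"
      using N[OF that(1)] N[OF that(2)] by (intro mult_strict_left_mono add_strict_mono) auto
    also have "\<dots> = e" by simp
    finally show ?thesis .
  qed
  then show ?thesis by blast
qed

text \<open>
  A norm inequality carries Cauchy sequences over; \<open>x\<close> and \<open>y\<close> stand for powers of the two norms.
\<close>

lemma powr_Cauchy_transfer:
  fixes x :: "nat \<Rightarrow> nat \<Rightarrow> real"
  assumes le: "\<And>m n. y m n powr (1 / q) \<le> c * x m n powr (1 / p)" and nn: "\<And>m n. 0 \<le> x m n" "\<And>m n. 0 \<le> (y m n :: real)"
    and p: "0 < p" "0 < q" "0 \<le> c"
    and x: "\<And>e. 0 < e \<Longrightarrow> \<exists>N. \<forall>m\<ge>N. \<forall>n\<ge>N. x m n < e" and e: "0 < e"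
  shows "\<exists>N. \<forall>m\<ge>N. \<forall>n\<ge>N. y m n < e"
proof -
  define d where "d = (e powr (1 / q) / (c + 1)) powr p"
  have d: "0 < d" using e p by (simp add: d_def)
  obtain N where N: "\<And>m n. N \<le> m \<Longrightarrow> N \<le> n \<Longrightarrow> x m n < d" using x[OF d] by blast
  have "y m n < e" if "N \<le> m" "N \<le> n" for m n
  proof -
    have "x m n powr (1 / p) < d powr (1 / p)" using N[OF that] nn p by (intro powr_less_mono2) auto
    also have "\<dots> = e powr (1 / q) / (c + 1)" using e p by (simp add: d_def powr_powr)
    finally have xl: "(c + 1) * x m n powr (1 / p) < e powr (1 / q)" using p by (simp add: pos_less_divide_eq mult.commute)
    have "y m n powr (1 / q) \<le> (c + 1) * x m n powr (1 / p)"
      by (rule order.trans[OF le]) (simp add: mult_right_mono)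
    then have yl: "y m n powr (1 / q) < e powr (1 / q)" using xl by linarith
    show ?thesis
    proof (rule ccontr)
      assume "\<not> y m n < e"
      then have "e powr (1 / q) \<le> y m n powr (1 / q)" using e p by (intro powr_mono2) auto
      with yl show False by simp
    qed
  qed
  then show ?thesis by blast
qed

text \<open>
  Where \<open>\<bar>w\<bar> \<ge> t\<close>, either \<open>\<bar>W n\<bar> \<ge> t/2\<close> or \<open>\<bar>W n - w\<bar> \<ge> t/2\<close>, and the latter set becomes small by
  Chebyshev's inequality.
\<close>

lemma weak_type_limit:
  fixes w :: "'a::euclidean_space \<Rightarrow> 'b::euclidean_space"
  assumes \<Omega>: "\<Omega> \<in> lmeasurable" and W: "Lp_tendsto \<Omega> (ereal 1) W w" and t: "0 < t"
    and le: "\<forall>\<^sub>F n in sequentially. measure (lebesgue_on \<Omega>) {x \<in> \<Omega>. t / 2 \<le> norm (W n x)} \<le> B"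
  shows "measure (lebesgue_on \<Omega>) {x \<in> \<Omega>. t \<le> norm (w x)} \<le> B"
proof -
  interpret finite_measure "lebesgue_on \<Omega>" using \<Omega> by (rule finite_measure_lebesgue_on)
  have mem: "\<And>n. W n \<in> Lp \<Omega> (ereal 1)" "w \<in> Lp \<Omega> (ereal 1)"
    and lim: "(\<lambda>n. Lint \<Omega> 1 (\<lambda>x. W n x - w x)) \<longlonglongrightarrow> 0"
    using W by (auto simp: Lp_tendsto_iff)
  have wm: "w \<in> borel_measurable (lebesgue_on \<Omega>)" "W n \<in> borel_measurable (lebesgue_on \<Omega>)" for n
    using mem by (auto intro: Lp_borel)
  have bound: "measure (lebesgue_on \<Omega>) {x \<in> \<Omega>. t \<le> norm (w x)} \<le> B + 2 / t * Lint \<Omega> 1 (\<lambda>x. W n x - w x)"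
    if n: "measure (lebesgue_on \<Omega>) {x \<in> \<Omega>. t / 2 \<le> norm (W n x)} \<le> B" for n
  proof -
    let ?E1 = "{x \<in> space (lebesgue_on \<Omega>). t / 2 \<le> norm (W n x)}" and ?E2 = "{x \<in> space (lebesgue_on \<Omega>). t / 2 \<le> norm (W n x - w x)}"
    have E: "?E1 \<in> sets (lebesgue_on \<Omega>)" "?E2 \<in> sets (lebesgue_on \<Omega>)" using wm by measurable
    have D: "(\<lambda>x. W n x - w x) \<in> Lp \<Omega> (ereal 1)" by (rule Lp_diff[OF mem(1) mem(2)]) simp
    have "measure (lebesgue_on \<Omega>) ?E2 * (t / 2) powr 1 \<le> (LINT x|lebesgue_on \<Omega>. \<bar>norm (W n x - w x)\<bar> powr 1)"
    proof (rule measure_Markov_powr[OF _ _ _ _ E(2)])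
      show "(\<lambda>x. norm (W n x - w x)) \<in> borel_measurable (lebesgue_on \<Omega>)" using wm by measurable
      show "integrable (lebesgue_on \<Omega>) (\<lambda>x. \<bar>norm (W n x - w x)\<bar> powr 1)" using D unfolding Lp_iff abs_norm_cancel by blast
    qed (use t in auto)
    then have "measure (lebesgue_on \<Omega>) ?E2 * (t / 2) \<le> Lint \<Omega> 1 (\<lambda>x. W n x - w x)" using t by (simp only: abs_norm_cancel) simp
    then have e2: "measure (lebesgue_on \<Omega>) ?E2 \<le> 2 / t * Lint \<Omega> 1 (\<lambda>x. W n x - w x)" using t by (simp add: field_simps)
    have "t \<le> norm (w x) \<Longrightarrow> t / 2 \<le> norm (W n x) \<or> t / 2 \<le> norm (W n x - w x)" for x
      using norm_triangle_sub[of "w x" "W n x"] norm_minus_commute[of "w x" "W n x"] by linarith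
    then have "{x \<in> \<Omega>. t \<le> norm (w x)} \<subseteq> ?E1 \<union> ?E2" by auto
    then have "measure (lebesgue_on \<Omega>) {x \<in> \<Omega>. t \<le> norm (w x)} \<le> measure (lebesgue_on \<Omega>) (?E1 \<union> ?E2)"
      by (rule finite_measure_mono[OF _ sets.Un[OF E]])
    also have "\<dots> \<le> measure (lebesgue_on \<Omega>) ?E1 + measure (lebesgue_on \<Omega>) ?E2" by (rule measure_Un_le[OF E])
    finally show ?thesis using n e2 by simp
  qed
  have "(\<lambda>n. B + 2 / t * Lint \<Omega> 1 (\<lambda>x. W n x - w x)) \<longlonglongrightarrow> B + 2 / t * 0"
    by (intro tendsto_add tendsto_mult tendsto_const lim)
  then have "measure (lebesgue_on \<Omega>) {x \<in> \<Omega>. t \<le> norm (w x)} \<le> B + 2 / t * 0"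
    by (rule tendsto_lowerbound) (use eventually_mono[OF le bound] in auto)
  then show ?thesis by simp
qed

context sobolev_setting
begin

lemma scaled_datum:
  fixes F :: "real^'n \<Rightarrow> real"
  assumes "0 < p" "Lint \<Omega> p F powr (1 / p) < s"
  shows "0 < s" "Lint \<Omega> p (\<lambda>x. 1 / s * F x) \<le> 1"
proof -
  show s: "0 < s" using assms(2) powr_ge_zero[of "Lint \<Omega> p F" "1 / p"] by linarith
  have "Lint \<Omega> p (\<lambda>x. 1 / s * F x) = (1 / s) powr p * Lint \<Omega> p F"
    using Lint_scale[where \<Omega>=\<Omega> and p=p and c="1 / s" and f=F] s by simp
  also have "Lint \<Omega> p F = (Lint \<Omega> p F powr (1 / p)) powr p" using assms(1) by (simp add: powr_powr)
  also have "(1 / s) powr p * \<dots> \<le> (1 / s) powr p * s powr p"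
    using assms by (intro mult_left_mono powr_mono2) auto
  also have "\<dots> = 1" using s by (simp add: powr_divide)
  finally show "Lint \<Omega> p (\<lambda>x. 1 / s * F x) \<le> 1" .
qed

text \<open>Estimates for data of norm at most one extend to all data by linearity.\<close>

lemma gradient_estimate_homogeneous:
  assumes est: "\<forall>A F d. solves A F d \<longrightarrow> F \<in> Lp \<Omega> (ereal p) \<longrightarrow> Lint \<Omega> p F \<le> 1 \<longrightarrow> Lint \<Omega> q (Xgrad \<Omega> X d) \<le> C"
    and p: "0 < p" "1 \<le> q" "q \<le> 2" and s: "solves A F d" and F: "F \<in> Lp \<Omega> (ereal p)"
  shows "Lint \<Omega> q (Xgrad \<Omega> X d) powr (1 / q) \<le> C powr (1 / q) * Lint \<Omega> p F powr (1 / p)"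
proof (rule homogeneity_limit)
  fix t assume "Lint \<Omega> p F powr (1 / p) < t"
  note t = scaled_datum[OF p(1) this]
  note s' = solves_scale[OF s, of "1 / t"]
  have F': "(\<lambda>x. 1 / t * F x) \<in> Lp \<Omega> (ereal p)" using Lp_scale[OF F, of "1 / t"] by simp
  have W: "W0_grad \<Omega> X q d (Xgrad \<Omega> X d)" by (rule W0_grad_mono[OF solves_W0_grad[OF s]]) (use p in auto)
  have W': "W0_grad \<Omega> X q (\<lambda>x. 1 / t * d x) (\<lambda>x. (1 / t) *\<^sub>R Xgrad \<Omega> X d x)"
    using W0_grad_lincomb[OF W W, of "1 / t" 0] p by simp
  have "Lint \<Omega> q (\<lambda>x. (1 / t) *\<^sub>R Xgrad \<Omega> X d x) = Lint \<Omega> q (Xgrad \<Omega> X (\<lambda>x. 1 / t * d x))"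
    by (rule Lp_AE_cong(2)[OF W0_grad_memD(2)[OF Xgrad_AE_eq(2)[OF W' p(2)]]
        Lp_borel[OF W0_grad_memD(2)[OF W']] Xgrad_AE_eq(1)[OF W' p(2)], symmetric])
  then have "(1 / t) powr q * Lint \<Omega> q (Xgrad \<Omega> X d) \<le> C"
    using est[rule_format, OF s' F' t(2)] Lint_scale[where \<Omega>=\<Omega> and p=q and c="1 / t" and f="Xgrad \<Omega> X d"] t(1) by simp
  then have "((1 / t) powr q * Lint \<Omega> q (Xgrad \<Omega> X d)) powr (1 / q) \<le> C powr (1 / q)"
    using p by (intro powr_mono2) auto
  then have "1 / t * Lint \<Omega> q (Xgrad \<Omega> X d) powr (1 / q) \<le> C powr (1 / q)"
    using p t(1) by (simp only: powr_mult powr_powr) simp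
  then show "Lint \<Omega> q (Xgrad \<Omega> X d) powr (1 / q) \<le> C powr (1 / q) * t"
    using t(1) by (simp add: field_simps)
qed simp

lemma function_estimate_homogeneous:
  assumes est: "\<forall>A F d. solves A F d \<longrightarrow> F \<in> Lp \<Omega> (ereal p) \<longrightarrow> Lint \<Omega> p F \<le> 1 \<longrightarrow> d \<in> Lp \<Omega> (ereal q) \<and> Lint \<Omega> q d \<le> C"
    and p: "0 < p" "0 < q" and s: "solves A F d" and F: "F \<in> Lp \<Omega> (ereal p)"
  shows "d \<in> Lp \<Omega> (ereal q)" "Lint \<Omega> q d powr (1 / q) \<le> C powr (1 / q) * Lint \<Omega> p F powr (1 / p)"
proof -
  have scaled: "0 < t \<and> (\<lambda>x. 1 / t * d x) \<in> Lp \<Omega> (ereal q) \<and> (1 / t) powr q * Lint \<Omega> q d \<le> C"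
    if "Lint \<Omega> p F powr (1 / p) < t" for t
  proof -
    note t = scaled_datum[OF p(1) that]
    note s' = solves_scale[OF s, of "1 / t"]
    have F': "(\<lambda>x. 1 / t * F x) \<in> Lp \<Omega> (ereal p)" using Lp_scale[OF F, of "1 / t"] by simp
    show ?thesis
      using est[rule_format, OF s' F' t(2)] Lint_scale[where \<Omega>=\<Omega> and p=q and c="1 / t" and f=d] t(1) by simp
  qed
  show "d \<in> Lp \<Omega> (ereal q)"
  proof -
    define t where "t = Lint \<Omega> p F powr (1 / p) + 1"
    have t: "0 < t" "(\<lambda>x. 1 / t * d x) \<in> Lp \<Omega> (ereal q)" using scaled[of t] by (auto simp: t_def)
    from Lp_scale[OF t(2), of t] t(1) show ?thesis by simp
  qed
  show "Lint \<Omega> q d powr (1 / q) \<le> C powr (1 / q) * Lint \<Omega> p F powr (1 / p)"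
  proof (rule homogeneity_limit)
    fix t assume "Lint \<Omega> p F powr (1 / p) < t"
    note t = scaled[OF this]
    then have "((1 / t) powr q * Lint \<Omega> q d) powr (1 / q) \<le> C powr (1 / q)"
      using p by (intro powr_mono2) auto
    then have "1 / t * Lint \<Omega> q d powr (1 / q) \<le> C powr (1 / q)"
      using p t by (simp only: powr_mult powr_powr) simp
    then show "Lint \<Omega> q d powr (1 / q) \<le> C powr (1 / q) * t"
      using t by (simp add: field_simps)
  qed simp
qed

text \<open>
  On a set of finite measure the norm of the datum in the dual exponent is controlled by its \<open>L\<^sup>p\<close> norm.
\<close>

lemma W12_estimate_Lp:
  assumes p: "two_star_conj \<le> p"
  obtains C where "0 \<le> C" "\<And>A F d. solves A F d \<Longrightarrow> F \<in> Lp \<Omega> (ereal p) \<Longrightarrow>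
     W0_norm \<Omega> X 2 d \<le> C * Lint \<Omega> p F powr (1 / p)"
proof -
  have r: "0 \<le> two_star_conj" "0 < p" using exponents p by linarith+
  obtain C where C: "0 \<le> C" and est: "\<And>A F d. solves A F d \<Longrightarrow> Lint \<Omega> two_star_conj F \<le> measure lebesgue \<Omega> + 1 \<Longrightarrow> Lint \<Omega> 2 (Xgrad \<Omega> X d) \<le> C"
    using W12_estimate[of "measure lebesgue \<Omega> + 1"] by auto
  have est': "Lint \<Omega> 2 (Xgrad \<Omega> X d) \<le> C" if "solves A F d" "F \<in> Lp \<Omega> (ereal p)" "Lint \<Omega> p F \<le> 1" for A F d
  proof -
    have "Lint \<Omega> two_star_conj F \<le> 1 powr two_star_conj * measure lebesgue \<Omega> + 1 powr (two_star_conj - p) * Lint \<Omega> p F"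
      by (rule Lint_interpolate(2)[OF lmeasurable_domain that(2) r(1) p zero_less_one])
    then have "Lint \<Omega> two_star_conj F \<le> measure lebesgue \<Omega> + 1"
      using that(3) unfolding powr_one_eq_one mult_1_left by linarith
    then show ?thesis by (rule est[OF that(1)])
  qed
  show ?thesis
  proof (rule that[of "C powr (1 / 2)"])
    fix A F d assume s: "solves A F d" and F: "F \<in> Lp \<Omega> (ereal p)"
    have "W0_norm \<Omega> X 2 d = Lint \<Omega> 2 (Xgrad \<Omega> X d) powr (1 / 2)"
      by (rule W0_norm_eq[OF solves_W0_grad[OF s]]) simp
    also have "\<dots> \<le> C powr (1 / 2) * Lint \<Omega> p F powr (1 / p)"
      by (rule gradient_estimate_homogeneous[OF _ r(2) _ _ s F]) (use est' in auto)
    finally show "W0_norm \<Omega> X 2 d \<le> C powr (1 / 2) * Lint \<Omega> p F powr (1 / p)" .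
  qed simp
qed

lemma sup_estimate_homogeneous:
  assumes p: "Q / 2 < p"
  obtains D where "0 \<le> D" "\<And>A F d. solves A F d \<Longrightarrow> F \<in> Lp \<Omega> (ereal p) \<Longrightarrow>
     d \<in> Lp \<Omega> \<infinity> \<and> Lp_norm \<Omega> \<infinity> d \<le> D * Lint \<Omega> p F powr (1 / p)"
proof -
  have p0: "0 < p" using p Q_gt_2 by linarith
  obtain D where D: "0 < D" and est: "\<And>A F d. solves A F d \<Longrightarrow> F \<in> Lp \<Omega> (ereal p) \<Longrightarrow> Lint \<Omega> p F \<le> 1 \<Longrightarrow>
     AE x in lebesgue_on \<Omega>. \<bar>d x\<bar> \<le> D"
    using sup_estimate[OF p] by blast
  show ?thesis
  proof (rule that[of D])
    fix A F d assume s: "solves A F d" and F: "F \<in> Lp \<Omega> (ereal p)"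
    let ?N = "Lint \<Omega> p F powr (1 / p)"
    have dm: "d \<in> borel_measurable (lebesgue_on \<Omega>)" by (rule Lp_borel[OF W0_grad_memD(1)[OF solves_W0_grad[OF s]]])
    have nm: "(\<lambda>x. ereal (norm (d x))) \<in> borel_measurable (lebesgue_on \<Omega>)" using dm by measurable
    have ess: "esssup (lebesgue_on \<Omega>) (\<lambda>x. ereal (norm (d x))) \<le> ereal (D * t) \<and> 0 < t" if "?N < t" for t
    proof -
      note t = scaled_datum[OF p0 that]
      have F': "(\<lambda>x. 1 / t * F x) \<in> Lp \<Omega> (ereal p)" using Lp_scale[OF F, of "1 / t"] by simp
      have "AE x in lebesgue_on \<Omega>. \<bar>1 / t * d x\<bar> \<le> D" by (rule est[OF solves_scale[OF s] F' t(2)])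
      then have "AE x in lebesgue_on \<Omega>. ereal (norm (d x)) \<le> ereal (D * t)"
        by eventually_elim (use t(1) in \<open>simp add: abs_mult field_simps\<close>)
      then show ?thesis using esssup_I[OF nm] t(1) by blast
    qed
    have "esssup (lebesgue_on \<Omega>) (\<lambda>x. ereal (norm (d x))) < \<infinity>"
      using ess[of "?N + 1"] by (metis ereal_infty_less(1) less_add_one not_le top.extremum_uniqueI ereal_less_eq(1) PInfty_neq_ereal(1))
    then have "d \<in> Lp \<Omega> \<infinity>" using dm by (simp add: Lp_def)
    moreover have "Lp_norm \<Omega> \<infinity> d \<le> D * ?N"
    proof (rule homogeneity_limit)
      fix t assume "?N < t"
      note e = ess[OF this]
      have "real_of_ereal (esssup (lebesgue_on \<Omega>) (\<lambda>x. ereal (norm (d x)))) \<le> D * t"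
        using e D by (cases "esssup (lebesgue_on \<Omega>) (\<lambda>x. ereal (norm (d x)))") auto
      then show "Lp_norm \<Omega> \<infinity> d \<le> D * t" by (simp add: Lp_norm_def)
    qed (use D in simp)
    ultimately show "d \<in> Lp \<Omega> \<infinity> \<and> Lp_norm \<Omega> \<infinity> d \<le> D * ?N" ..
  qed (use D in simp)
qed

lemma Linfinity_AE_le:
  fixes F :: "real^'n \<Rightarrow> real"
  assumes F: "F \<in> Lp \<Omega> \<infinity>"
  shows "AE x in lebesgue_on \<Omega>. norm (F x) \<le> max 0 (Lp_norm \<Omega> \<infinity> F)"
proof -
  let ?e = "esssup (lebesgue_on \<Omega>) (\<lambda>x. ereal (norm (F x)))"
  have fin: "?e < \<infinity>" using F by (simp add: Lp_def)
  show ?thesis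
    using esssup_AE[of "\<lambda>x. ereal (norm (F x))" "lebesgue_on \<Omega>"]
  proof eventually_elim
    case (elim x)
    then show ?case using fin unfolding Lp_norm_def by (cases ?e) auto
  qed
qed

lemma Linfinity_diff:
  fixes f g :: "real^'n \<Rightarrow> real"
  assumes f: "f \<in> Lp \<Omega> \<infinity>" and g: "g \<in> Lp \<Omega> \<infinity>"
  shows "(\<lambda>x. f x - g x) \<in> Lp \<Omega> \<infinity>"
proof -
  have m: "f \<in> borel_measurable (lebesgue_on \<Omega>)" "g \<in> borel_measurable (lebesgue_on \<Omega>)"
    using Lp_borel[OF f] Lp_borel[OF g] by blast+
  let ?c = "max 0 (Lp_norm \<Omega> \<infinity> f) + max 0 (Lp_norm \<Omega> \<infinity> g)"
  have nm: "(\<lambda>x. ereal (norm (f x - g x))) \<in> borel_measurable (lebesgue_on \<Omega>)" using m by measurable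
  have "AE x in lebesgue_on \<Omega>. ereal (norm (f x - g x)) \<le> ereal ?c"
    using Linfinity_AE_le[OF f] Linfinity_AE_le[OF g]
  proof eventually_elim
    case (elim x)
    then show ?case using norm_triangle_ineq4[of "f x" "g x"] unfolding ereal_less_eq(3) by linarith
  qed
  from esssup_I[OF nm this]
  have "esssup (lebesgue_on \<Omega>) (\<lambda>x. ereal (norm (f x - g x))) < \<infinity>" by (rule le_less_trans) simp
  then show ?thesis using m by (simp add: Lp_def)
qed

lemma Linfinity_in_Lp:
  fixes F :: "real^'n \<Rightarrow> real"
  assumes F: "F \<in> Lp \<Omega> \<infinity>" and p: "0 < p"
  shows "F \<in> Lp \<Omega> (ereal p)" "Lint \<Omega> p F powr (1 / p) \<le> measure lebesgue \<Omega> powr (1 / p) * Lp_norm \<Omega> \<infinity> F"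
proof -
  interpret finite_measure "lebesgue_on \<Omega>" by (rule finite_measure_domain)
  have m: "F \<in> borel_measurable (lebesgue_on \<Omega>)" by (rule Lp_borel[OF F])
  let ?e = "esssup (lebesgue_on \<Omega>) (\<lambda>x. ereal (norm (F x)))"
  have N: "Lp_norm \<Omega> \<infinity> F = real_of_ereal ?e" by (simp add: Lp_norm_def)
  note ae = Linfinity_AE_le[OF F]
  have aep: "AE x in lebesgue_on \<Omega>. norm (norm (F x) powr p) \<le> max 0 (Lp_norm \<Omega> \<infinity> F) powr p"
    using ae by eventually_elim (use p in \<open>auto intro!: powr_mono2\<close>)
  have pm: "(\<lambda>x. norm (F x) powr p) \<in> borel_measurable (lebesgue_on \<Omega>)" using m by measurable
  have i: "integrable (lebesgue_on \<Omega>) (\<lambda>x. norm (F x) powr p)"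
    by (rule integrable_const_bound[OF aep pm])
  then show "F \<in> Lp \<Omega> (ereal p)" using m by (simp add: Lp_iff)
  show "Lint \<Omega> p F powr (1 / p) \<le> measure lebesgue \<Omega> powr (1 / p) * Lp_norm \<Omega> \<infinity> F"
  proof (cases "measure lebesgue \<Omega> = 0")
    case True
    then have "emeasure (lebesgue_on \<Omega>) (space (lebesgue_on \<Omega>)) = 0"
      using lmeasurable_domain by (simp add: emeasure_restrict_space emeasure_eq_measure2 measure_restrict_space)
    then have "AE x in lebesgue_on \<Omega>. norm (F x) powr p = 0" by (intro AE_I[of _ _ "space (lebesgue_on \<Omega>)"]) auto
    then have "Lint \<Omega> p F = 0" by (rule integral_eq_zero_AE)
    with True show ?thesis by simp
  next
    case False
    have nn: "0 \<le> Lp_norm \<Omega> \<infinity> F"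
    proof (rule ccontr)
      assume "\<not> 0 \<le> Lp_norm \<Omega> \<infinity> F"
      then have neg: "?e < 0" unfolding N by (cases ?e) auto
      have "AE x in lebesgue_on \<Omega>. False"
        using esssup_AE[of "\<lambda>x. ereal (norm (F x))" "lebesgue_on \<Omega>"]
      proof (eventually_elim)
        case (elim x)
        then have "ereal (norm (F x)) < 0" using neg by (rule le_less_trans)
        then show False by simp
      qed
      then have "ae_filter (lebesgue_on \<Omega>) = bot" by (simp only: eventually_False)
      then have "emeasure (lebesgue_on \<Omega>) (space (lebesgue_on \<Omega>)) = 0" by (simp only: ae_filter_eq_bot_iff)
      then have "measure (lebesgue_on \<Omega>) \<Omega> = 0" by (simp add: measure_def)
      then show False using False lmeasurable_domain by (simp add: measure_restrict_space)
    qed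
    have "Lint \<Omega> p F \<le> (LINT x|lebesgue_on \<Omega>. Lp_norm \<Omega> \<infinity> F powr p)"
      using aep nn by (intro integral_mono_AE i) auto
    also have "\<dots> = measure lebesgue \<Omega> * Lp_norm \<Omega> \<infinity> F powr p"
      using lmeasurable_domain by (simp add: measure_restrict_space)
    finally have "Lint \<Omega> p F powr (1 / p) \<le> (measure lebesgue \<Omega> * Lp_norm \<Omega> \<infinity> F powr p) powr (1 / p)"
      using p by (intro powr_mono2) auto
    also have "\<dots> = measure lebesgue \<Omega> powr (1 / p) * Lp_norm \<Omega> \<infinity> F"
      using p nn by (simp add: powr_mult powr_powr)
    finally show ?thesis .
  qed
qed

end

context sobolev_setting
begin

section \<open>Solutions as limits of weak solutions\<close>

lemma truncated_datum:
  fixes f :: "real^'n \<Rightarrow> real"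
  assumes f: "f \<in> Lp \<Omega> (ereal p)" and p: "0 < p" and \<sigma>: "strict_mono \<sigma>"
  shows "0 \<le> r \<Longrightarrow> (\<lambda>x. truncate n (f x)) \<in> Lp \<Omega> (ereal r)" "Lp_tendsto \<Omega> (ereal p) (\<lambda>n x. truncate (\<sigma> n) (f x)) f"
proof -
  interpret finite_measure "lebesgue_on \<Omega>" by (rule finite_measure_domain)
  have fm: "f \<in> borel_measurable (lebesgue_on \<Omega>)" by (rule Lp_borel[OF f])
  have tm: "(\<lambda>x. truncate n (f x)) \<in> borel_measurable (lebesgue_on \<Omega>)" for n
    unfolding truncate_def using fm by measurable
  have bounded: "(\<lambda>x. truncate n (f x)) \<in> Lp \<Omega> (ereal r)" if r: "0 \<le> r" for n r
  proof -
    have le: "norm (truncate n (f x)) \<le> real n" for x by (auto simp: truncate_def)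
    have "integrable (lebesgue_on \<Omega>) (\<lambda>x. norm (truncate n (f x)) powr r)"
    proof (rule integrable_const_bound)
      show "AE x in lebesgue_on \<Omega>. norm (norm (truncate n (f x)) powr r) \<le> real n powr r"
        using powr_mono2[OF r norm_ge_zero le] by (intro AE_I2) simp
      show "(\<lambda>x. norm (truncate n (f x)) powr r) \<in> borel_measurable (lebesgue_on \<Omega>)" using tm[of n] by measurable
    qed
    then show ?thesis using tm[of n] by (simp add: Lp_iff)
  qed
  then show "0 \<le> r \<Longrightarrow> (\<lambda>x. truncate n (f x)) \<in> Lp \<Omega> (ereal r)" .
  show "Lp_tendsto \<Omega> (ereal p) (\<lambda>n x. truncate (\<sigma> n) (f x)) f"
  proof (rule Lp_tendsto_dominated[OF _ f p f])
    show "AE x in lebesgue_on \<Omega>. norm (truncate (\<sigma> n) (f x) - f x) \<le> norm (f x)" for n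
      by (intro AE_I2) (auto simp: truncate_def)
    show "(\<lambda>x. truncate (\<sigma> n) (f x)) \<in> Lp \<Omega> (ereal p)" for n by (rule bounded[OF less_imp_le[OF p]])
    show "AE x in lebesgue_on \<Omega>. (\<lambda>n. truncate (\<sigma> n) (f x)) \<longlonglongrightarrow> f x"
    proof (intro AE_I2 tendsto_eventually)
      fix x
      obtain M where M: "\<bar>f x\<bar> \<le> real M" using real_arch_simple by blast
      have "truncate (\<sigma> n) (f x) = f x" if "M \<le> n" for n
      proof -
        have "M \<le> \<sigma> n" using seq_suble[OF \<sigma>, of n] that by linarith
        then have "\<bar>f x\<bar> \<le> real (\<sigma> n)" using M by linarith
        then show ?thesis by (auto simp: truncate_def)
      qed
      then show "\<forall>\<^sub>F n in sequentially. truncate (\<sigma> n) (f x) = f x"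
        by (intro eventually_sequentiallyI[of M]) simp
    qed
  qed
qed

text \<open>
  Both kinds of solution are \<open>L\<^sup>1\<close> limits of weak solutions whose data converge in \<open>L\<^sup>p\<close>: a weak
  solution is the limit of the constant sequence, the others are limits by construction.
\<close>

lemma solution_sequence:
  assumes A: "elliptic \<Omega> \<alpha> \<beta> A" and f: "f \<in> Lp \<Omega> (ereal p)" and p: "0 < p" and sol: "is_solution \<Omega> X Q A f u"
  obtains F U where "\<And>n. solves A (F n) (U n)" "Lp_tendsto \<Omega> (ereal p) F f" "Lp_tendsto \<Omega> (ereal 1) U u"
proof (cases "f \<in> Lp \<Omega> (ereal two_star_conj)")
  case True
  then have s: "solves A f u" using A sol by (auto simp: solves_def is_solution_def)
  have "u \<in> Lp \<Omega> (ereal 1)"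
    by (rule W0_grad_memD(1)[OF W0_grad_mono[OF solves_W0_grad[OF s]]]) auto
  then show ?thesis
    by (intro that[of "\<lambda>_. f" "\<lambda>_. u"] s Lp_tendsto_const f p zero_less_one)
next
  case False
  then have "approx_solution \<Omega> X Q A f u" using sol by (simp add: is_solution_def)
  then obtain U \<sigma> where U: "\<And>n. weak_solution \<Omega> X A (\<lambda>x. truncate n (f x)) (U n)" and \<sigma>: "strict_mono \<sigma>"
    and lim: "\<And>s. 1 \<le> s \<Longrightarrow> s < Q / (Q - 2) \<Longrightarrow> Lp_tendsto \<Omega> (ereal s) (U \<circ> \<sigma>) u"
    unfolding approx_solution_def by blast
  show ?thesis
  proof (rule that[of "\<lambda>n x. truncate (\<sigma> n) (f x)" "U \<circ> \<sigma>"])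
    show "solves A (\<lambda>x. truncate (\<sigma> n) (f x)) ((U \<circ> \<sigma>) n)" for n
      using A U truncated_datum(1)[OF f p \<sigma>, of two_star_conj] exponents(1) unfolding solves_def o_def by fastforce
    show "Lp_tendsto \<Omega> (ereal p) (\<lambda>n x. truncate (\<sigma> n) (f x)) f" by (rule truncated_datum(2)[OF f p \<sigma>])
    show "Lp_tendsto \<Omega> (ereal 1) (U \<circ> \<sigma>) u" by (rule lim) (use Q_gt_2 in \<open>auto simp: field_simps\<close>)
  qed
qed

text \<open>
  The estimates are linear, so they apply to differences of approximations and make the gradients
  a Cauchy sequence: the limit lies in \<open>W\<^sub>0\<close> and its gradient is the strong limit of the gradients.
\<close>

lemma gradient_limit:
  assumes est: "\<forall>A F d. solves A F d \<longrightarrow> F \<in> Lp \<Omega> (ereal p) \<longrightarrow> Lint \<Omega> p F \<le> 1 \<longrightarrow> Lint \<Omega> q (Xgrad \<Omega> X d) \<le> C"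
    and p: "0 < p" "1 \<le> q" "q \<le> 2"
    and sol: "\<And>n. solves A (F n) (U n)" and F: "Lp_tendsto \<Omega> (ereal p) F f" and U: "Lp_tendsto \<Omega> (ereal 1) U u"
  obtains G where "W0_grad \<Omega> X q u G" "Lp_tendsto \<Omega> (ereal q) (\<lambda>n. Xgrad \<Omega> X (U n)) G"
proof -
  have q: "0 < q" "q < Q" using p Q_gt_2 by auto
  have FL: "F n \<in> Lp \<Omega> (ereal p)" for n using F by (simp add: Lp_tendsto_def)
  have W: "W0_grad \<Omega> X q (U n) (Xgrad \<Omega> X (U n))" for n
    by (rule W0_grad_mono[OF solves_W0_grad[OF sol] q(1) p(3)])
  have WD: "W0_grad \<Omega> X q (\<lambda>x. U m x - U n x) (\<lambda>x. Xgrad \<Omega> X (U m) x - Xgrad \<Omega> X (U n) x)" for m n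
    by (rule W0_grad_diff[OF W W q(1)])
  have grad_le: "Lint \<Omega> q (\<lambda>x. Xgrad \<Omega> X (U m) x - Xgrad \<Omega> X (U n) x) powr (1 / q)
      \<le> C powr (1 / q) * Lint \<Omega> p (\<lambda>x. F m x - F n x) powr (1 / p)" for m n
  proof -
    have "Lint \<Omega> q (\<lambda>x. Xgrad \<Omega> X (U m) x - Xgrad \<Omega> X (U n) x) = Lint \<Omega> q (Xgrad \<Omega> X (\<lambda>x. U m x - U n x))"
      by (rule Lp_AE_cong(2)[OF W0_grad_memD(2)[OF Xgrad_AE_eq(2)[OF WD p(2)]]
        Lp_borel[OF W0_grad_memD(2)[OF WD]] Xgrad_AE_eq(1)[OF WD p(2)], symmetric])
    also have "\<dots> powr (1 / q) \<le> C powr (1 / q) * Lint \<Omega> p (\<lambda>x. F m x - F n x) powr (1 / p)"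
      by (rule gradient_estimate_homogeneous[OF est p solves_diff[OF sol sol] Lp_diff[OF FL FL less_imp_le[OF p(1)]]])
    finally show ?thesis .
  qed
  have cG: "\<exists>N. \<forall>m\<ge>N. \<forall>n\<ge>N. Lint \<Omega> q (\<lambda>x. Xgrad \<Omega> X (U m) x - Xgrad \<Omega> X (U n) x) < e" if "0 < e" for e
    by (rule powr_Cauchy_transfer[OF grad_le Lint_nonneg Lint_nonneg p(1) q(1) powr_ge_zero Lp_tendsto_Cauchy[OF F p(1)] that])
  obtain G where G: "Lp_tendsto \<Omega> (ereal q) (\<lambda>n. Xgrad \<Omega> X (U n)) G"
    using Lp_Cauchy_limit[OF lmeasurable_domain p(2) W0_grad_memD(2)[OF W] cG] by blast
  let ?s = "star_exp Q q"
  have s: "q \<le> ?s" "1 \<le> ?s"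
  proof -
    have "q * (Q - q) \<le> q * Q" using q by (intro mult_left_mono) auto
    then show "q \<le> ?s" using q by (simp add: star_exp_def pos_le_divide_eq)
    then show "1 \<le> ?s" using p by simp
  qed
  obtain S where S: "0 < S" and sob: "\<And>u G. W0_grad \<Omega> X q u G \<Longrightarrow> u \<in> Lp \<Omega> (ereal ?s) \<and>
     Lint \<Omega> ?s u powr (1 / ?s) \<le> S * Lint \<Omega> q G powr (1 / q)"
    using Sobolev_inequality[OF p(2) q(2)] by blast
  have sob1: "U n \<in> Lp \<Omega> (ereal ?s)" for n using sob[OF W] by blast
  have sob2: "Lint \<Omega> ?s (\<lambda>x. U m x - U n x) powr (1 / ?s)
      \<le> S * Lint \<Omega> q (\<lambda>x. Xgrad \<Omega> X (U m) x - Xgrad \<Omega> X (U n) x) powr (1 / q)" for m n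
    using sob[OF WD] by blast
  have s0: "0 < ?s" using s by linarith
  have cU: "\<exists>N. \<forall>m\<ge>N. \<forall>n\<ge>N. Lint \<Omega> ?s (\<lambda>x. U m x - U n x) < e" if "0 < e" for e
    by (rule powr_Cauchy_transfer[OF sob2 Lint_nonneg Lint_nonneg q(1) s0 less_imp_le[OF S] cG that])
  obtain v where v: "Lp_tendsto \<Omega> (ereal ?s) U v"
    using Lp_Cauchy_limit[OF lmeasurable_domain s(2) sob1 cU] by blast
  have v1: "Lp_tendsto \<Omega> (ereal 1) U v" by (rule Lp_tendsto_mono[OF lmeasurable_domain v zero_less_one s(2)])
  have ae: "AE x in lebesgue_on \<Omega>. v x = u x" by (rule Lp_tendsto_unique[OF v1 U zero_less_one])
  have um: "u \<in> borel_measurable (lebesgue_on \<Omega>)" using U by (auto simp: Lp_tendsto_def intro: Lp_borel)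
  have "Lp_tendsto \<Omega> (ereal q) U u"
    by (rule Lp_tendsto_AE_cong[OF Lp_tendsto_mono[OF lmeasurable_domain v q(1) s(1)] q(1) um ae])
  then have "W0_grad \<Omega> X q u G" by (rule W0_grad_closed[OF W q(1) _ G])
  then show ?thesis using G by (rule that)
qed

text \<open>
  The factor \<open>4\<^sup>1\<^sup>/\<^sup>p 2\<close> comes from \<open>(a + b)\<^sup>p \<le> 2\<^sup>p (a\<^sup>p + b\<^sup>p)\<close> with \<open>a\<close> and \<open>b\<close> at most \<open>s\<close>.
\<close>

lemma eventually_datum_le:
  fixes F :: "nat \<Rightarrow> real^'n \<Rightarrow> real"
  assumes F: "Lp_tendsto \<Omega> (ereal p) F f" and p: "0 < p" and s: "Lint \<Omega> p f powr (1 / p) < s"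
  shows "\<forall>\<^sub>F n in sequentially. Lint \<Omega> p (F n) powr (1 / p) \<le> 4 powr (1 / p) * 2 * s"
proof -
  have mem: "\<And>n. F n \<in> Lp \<Omega> (ereal p)" "f \<in> Lp \<Omega> (ereal p)"
    and lim: "(\<lambda>n. Lint \<Omega> p (\<lambda>x. F n x - f x)) \<longlonglongrightarrow> 0"
    using F by (auto simp: Lp_tendsto_iff[OF p])
  have s0: "0 < s" using s powr_ge_zero[of "Lint \<Omega> p f" "1 / p"] by linarith
  have fs: "Lint \<Omega> p f \<le> s powr p"
  proof -
    have "Lint \<Omega> p f = (Lint \<Omega> p f powr (1 / p)) powr p" using p by (simp add: powr_powr)
    also have "\<dots> \<le> s powr p" using s p by (intro powr_mono2) auto
    finally show ?thesis .
  qed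
  have "0 < s powr p" using s0 by simp
  from order_tendstoD(2)[OF lim this] show ?thesis
  proof eventually_elim
    case (elim n)
    have "Lint \<Omega> p (F n) \<le> 2 powr p * (Lint \<Omega> p (\<lambda>x. F n x - f x) + Lint \<Omega> p f)"
      using Lint_add_le[OF Lp_diff[OF mem(1)[of n] mem(2)] mem(2)] p by simp
    also have "\<dots> \<le> 2 powr p * (4 * s powr p)"
    proof (rule mult_left_mono)
      show "Lint \<Omega> p (\<lambda>x. F n x - f x) + Lint \<Omega> p f \<le> 4 * s powr p"
        using elim fs \<open>0 < s powr p\<close> by linarith
    qed simp
    finally have "Lint \<Omega> p (F n) powr (1 / p) \<le> (2 powr p * (4 * s powr p)) powr (1 / p)"
      using p by (intro powr_mono2) auto
    also have "\<dots> = 4 powr (1 / p) * 2 * s"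
      using p s0 by (simp add: powr_mult powr_powr)
    finally show ?case .
  qed
qed

text \<open>
  The difference of two solutions is the limit of the differences of their approximations, which are
  weak solutions with data converging to \<open>f - g\<close>. The estimate holds along this sequence, and the
  gradients converge strongly.
\<close>

lemma intermediate_case:
  assumes p: "1 < p" "p < two_star_conj"
  obtains C where "0 \<le> C" "\<And>A \<beta> f g u v. elliptic \<Omega> \<alpha> \<beta> A \<Longrightarrow> f \<in> Lp \<Omega> (ereal p) \<Longrightarrow> g \<in> Lp \<Omega> (ereal p) \<Longrightarrow>
     is_solution \<Omega> X Q A f u \<Longrightarrow> is_solution \<Omega> X Q A g v \<Longrightarrow>
     (\<lambda>x. u x - v x) \<in> W0 \<Omega> X (star_exp Q p) \<and>
     W0_norm \<Omega> X (star_exp Q p) (\<lambda>x. u x - v x) \<le> C * Lp_norm \<Omega> (ereal p) (\<lambda>x. f x - g x)"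
proof -
  let ?q = "star_exp Q p"
  have p0: "0 < p" using p by simp
  have pQ: "p < Q" "p * (Q + 2) < 2 * Q"
  proof -
    show "p < Q" using p(2) exponents(2) Q_gt_2 by linarith
    show "p * (Q + 2) < 2 * Q" using p(2) Q_gt_2 by (simp add: field_simps)
  qed
  have q: "1 \<le> ?q" "?q \<le> 2"
  proof -
    have "1 * (Q - p) \<le> 1 * Q" using p by simp
    also have "1 * Q \<le> p * Q" by (rule mult_right_mono) (use p Q_gt_2 in simp_all)
    finally have "1 * (Q - p) \<le> p * Q" .
    then show "1 \<le> ?q" using pQ by (simp add: star_exp_def pos_le_divide_eq)
    show "?q \<le> 2" using pQ by (simp add: star_exp_def pos_divide_le_eq) (simp add: algebra_simps)
  qed
  have q0: "0 < ?q" using q by linarith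
  obtain C where C: "0 \<le> C" and est: "\<forall>A F d. solves A F d \<longrightarrow> F \<in> Lp \<Omega> (ereal p) \<longrightarrow> Lint \<Omega> p F \<le> 1 \<longrightarrow>
     Lint \<Omega> ?q (Xgrad \<Omega> X d) \<le> C"
    using W1_pstar_estimate[OF p] by blast
  define c where "c = 2 * C powr (1 / ?q) * (4 powr (1 / p) * 2)"
  show ?thesis
  proof (rule that[of c])
    show "0 \<le> c" by (simp add: c_def)
    fix A \<beta> f g u v
    assume A: "elliptic \<Omega> \<alpha> \<beta> A" and f: "f \<in> Lp \<Omega> (ereal p)" and g: "g \<in> Lp \<Omega> (ereal p)"
      and u: "is_solution \<Omega> X Q A f u" and v: "is_solution \<Omega> X Q A g v"
    obtain F U where F: "\<And>n. solves A (F n) (U n)" "Lp_tendsto \<Omega> (ereal p) F f" "Lp_tendsto \<Omega> (ereal 1) U u"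
      using solution_sequence[OF A f p0 u] by blast
    obtain G V where G: "\<And>n. solves A (G n) (V n)" "Lp_tendsto \<Omega> (ereal p) G g" "Lp_tendsto \<Omega> (ereal 1) V v"
      using solution_sequence[OF A g p0 v] by blast
    note FG = solves_diff[OF F(1) G(1)]
    have lim: "Lp_tendsto \<Omega> (ereal p) (\<lambda>n x. F n x - G n x) (\<lambda>x. f x - g x)" by (rule Lp_tendsto_diff[OF F(2) G(2) p0])
    have limU: "Lp_tendsto \<Omega> (ereal 1) (\<lambda>n x. U n x - V n x) (\<lambda>x. u x - v x)" by (rule Lp_tendsto_diff[OF F(3) G(3)]) simp
    obtain D where D: "W0_grad \<Omega> X ?q (\<lambda>x. u x - v x) D" "Lp_tendsto \<Omega> (ereal ?q) (\<lambda>n. Xgrad \<Omega> X (\<lambda>x. U n x - V n x)) D"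
      using gradient_limit[OF est p0 q FG lim limU] by blast
    have FGL: "(\<lambda>x. F n x - G n x) \<in> Lp \<Omega> (ereal p)" for n using lim by (simp add: Lp_tendsto_def)
    have "W0_norm \<Omega> X ?q (\<lambda>x. u x - v x) \<le> c * Lint \<Omega> p (\<lambda>x. f x - g x) powr (1 / p)"
    proof (rule homogeneity_limit)
      fix s assume s: "Lint \<Omega> p (\<lambda>x. f x - g x) powr (1 / p) < s"
      let ?b = "C powr (1 / ?q) * (4 powr (1 / p) * 2 * s)"
      have s0: "0 < s" by (rule scaled_datum(1)[OF p0 s])
      have "\<forall>\<^sub>F n in sequentially. Lint \<Omega> ?q (Xgrad \<Omega> X (\<lambda>x. U n x - V n x)) \<le> ?b powr ?q"
        using eventually_datum_le[OF lim p0 s]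
      proof eventually_elim
        case (elim n)
        have "Lint \<Omega> ?q (Xgrad \<Omega> X (\<lambda>x. U n x - V n x)) powr (1 / ?q) \<le> C powr (1 / ?q) * Lint \<Omega> p (\<lambda>x. F n x - G n x) powr (1 / p)"
          by (rule gradient_estimate_homogeneous[OF est p0 q FG FGL])
        also have "\<dots> \<le> ?b" by (rule mult_left_mono[OF elim powr_ge_zero])
        finally have "(Lint \<Omega> ?q (Xgrad \<Omega> X (\<lambda>x. U n x - V n x)) powr (1 / ?q)) powr ?q \<le> ?b powr ?q"
          by (rule powr_mono2[OF less_imp_le[OF q0] powr_ge_zero])
        then show ?case unfolding powr_root_cancel(1)[OF q0 Lint_nonneg] .
      qed
      from Lint_limit_le[OF D(2) q0 this] have "Lint \<Omega> ?q D \<le> 2 powr ?q * ?b powr ?q" .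
      then have "Lint \<Omega> ?q D powr (1 / ?q) \<le> (2 powr ?q * ?b powr ?q) powr (1 / ?q)"
        using q0 by (intro powr_mono2) auto
      also have "\<dots> = 2 * ?b"
      proof -
        have "(2 powr r * b powr r) powr (1 / r) = 2 * b" if "0 < r" "0 \<le> b" for r b :: real
          using that by (simp add: powr_mult powr_powr)
        from this[OF q0, of ?b] s0 show ?thesis by simp
      qed
      also have "\<dots> = c * s" by (simp only: c_def mult_ac)
      finally show "W0_norm \<Omega> X ?q (\<lambda>x. u x - v x) \<le> c * s" unfolding W0_norm_eq[OF D(1) q(1)] .
    qed (simp add: c_def)
    moreover have "(\<lambda>x. u x - v x) \<in> W0 \<Omega> X ?q" using D(1) unfolding W0_def by blast
    ultimately show "(\<lambda>x. u x - v x) \<in> W0 \<Omega> X ?q \<and>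
       W0_norm \<Omega> X ?q (\<lambda>x. u x - v x) \<le> c * Lp_norm \<Omega> (ereal p) (\<lambda>x. f x - g x)"
      by (simp only: Lp_norm_ereal)
  qed
qed

text \<open>
  The weak type bounds hold for the differences of the approximations and pass to the limit in measure.
  The strong \<open>L\<^sup>1\<close> limit of the gradients \<open>Xgrad (U n)\<close> is \<open>Xgrad u\<close>, so the difference of the gradients of
  \<open>u\<close> and \<open>v\<close> is itself a limit to which this applies.
\<close>

lemma integrable_case:
  obtains C where "0 \<le> C" "\<And>A \<beta> f g u v. elliptic \<Omega> \<alpha> \<beta> A \<Longrightarrow> f \<in> Lp \<Omega> (ereal 1) \<Longrightarrow> g \<in> Lp \<Omega> (ereal 1) \<Longrightarrow>
     is_solution \<Omega> X Q A f u \<Longrightarrow> is_solution \<Omega> X Q A g v \<Longrightarrow>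
     (\<lambda>x. u x - v x) \<in> Marcinkiewicz \<Omega> (dstar_exp Q 1) \<and>
     Marcinkiewicz_norm \<Omega> (dstar_exp Q 1) (\<lambda>x. u x - v x) \<le> C * Lp_norm \<Omega> (ereal 1) (\<lambda>x. f x - g x) \<and>
     (\<lambda>x. Xgrad \<Omega> X u x - Xgrad \<Omega> X v x) \<in> Marcinkiewicz \<Omega> (star_exp Q 1) \<and>
     Marcinkiewicz_norm \<Omega> (star_exp Q 1) (\<lambda>x. Xgrad \<Omega> X u x - Xgrad \<Omega> X v x) \<le> C * Lp_norm \<Omega> (ereal 1) (\<lambda>x. f x - g x)"
proof -
  obtain C0 where "0 \<le> C0" and est0: "\<And>A F d. solves A F d \<Longrightarrow> Lint \<Omega> 1 F \<le> 1 \<Longrightarrow> Lint \<Omega> 1 (Xgrad \<Omega> X d) \<le> C0"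
    using W11_estimate by blast
  have est: "\<forall>A F d. solves A F d \<longrightarrow> F \<in> Lp \<Omega> (ereal 1) \<longrightarrow> Lint \<Omega> 1 F \<le> 1 \<longrightarrow> Lint \<Omega> 1 (Xgrad \<Omega> X d) \<le> C0"
    using est0 by blast
  obtain C where C: "0 \<le> C" and weak1: "\<And>A F d G N t. solves A F d \<Longrightarrow> W0_grad \<Omega> X 2 d G \<Longrightarrow> Lint \<Omega> 1 F \<le> N \<Longrightarrow> 0 < t \<Longrightarrow>
     measure (lebesgue_on \<Omega>) {x \<in> \<Omega>. t \<le> \<bar>d x\<bar>} \<le> C * (N / t) powr (Q / (Q - 2))"
    and weak2: "\<And>A F d G N t. solves A F d \<Longrightarrow> W0_grad \<Omega> X 2 d G \<Longrightarrow> Lint \<Omega> 1 F \<le> N \<Longrightarrow> 0 < N \<Longrightarrow> 0 < t \<Longrightarrow>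
     measure (lebesgue_on \<Omega>) {x \<in> \<Omega>. t \<le> norm (G x)} \<le> C * (N / t) powr (Q / (Q - 1))"
    using weak_type_estimate by blast
  let ?k1 = "Q / (Q - 2)" and ?k2 = "Q / (Q - 1)"
  have k: "0 < ?k1" "0 < ?k2" "dstar_exp Q 1 = ?k1" "star_exp Q 1 = ?k2"
    using Q_gt_2 by (auto simp: dstar_exp_def star_exp_def)
  \<comment> \<open>The data of the approximations have norm at most \<open>8 s\<close>, and the level is halved in the limit.\<close>
  define c1 where "c1 = C * 16 powr ?k1"
  define c2 where "c2 = C * 16 powr ?k2"
  have c: "0 \<le> c1" "0 \<le> c2" using C by (auto simp: c1_def c2_def)
  have \<Omega>': "\<Omega> \<in> sets lebesgue" using lmeasurable_domain by auto
  show ?thesis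
  proof (rule that[of "c1 powr (1 / ?k1) + c2 powr (1 / ?k2)"])
    show "0 \<le> c1 powr (1 / ?k1) + c2 powr (1 / ?k2)" by simp
    fix A \<beta> f g u v
    assume A: "elliptic \<Omega> \<alpha> \<beta> A" and f: "f \<in> Lp \<Omega> (ereal 1)" and g: "g \<in> Lp \<Omega> (ereal 1)"
      and u: "is_solution \<Omega> X Q A f u" and v: "is_solution \<Omega> X Q A g v"
    obtain F U where F: "\<And>n. solves A (F n) (U n)" "Lp_tendsto \<Omega> (ereal 1) F f" "Lp_tendsto \<Omega> (ereal 1) U u"
      using solution_sequence[OF A f zero_less_one u] by blast
    obtain G V where G: "\<And>n. solves A (G n) (V n)" "Lp_tendsto \<Omega> (ereal 1) G g" "Lp_tendsto \<Omega> (ereal 1) V v"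
      using solution_sequence[OF A g zero_less_one v] by blast
    note FG = solves_diff[OF F(1) G(1)]
    have lim: "Lp_tendsto \<Omega> (ereal 1) (\<lambda>n x. F n x - G n x) (\<lambda>x. f x - g x)" by (rule Lp_tendsto_diff[OF F(2) G(2)]) simp
    have limU: "Lp_tendsto \<Omega> (ereal 1) (\<lambda>n x. U n x - V n x) (\<lambda>x. u x - v x)" by (rule Lp_tendsto_diff[OF F(3) G(3)]) simp
    have grad: "Lp_tendsto \<Omega> (ereal 1) (\<lambda>n. Xgrad \<Omega> X (Y n)) (Xgrad \<Omega> X y)"
      if h: "\<And>n. solves A (H n) (Y n)" "Lp_tendsto \<Omega> (ereal 1) H h" "Lp_tendsto \<Omega> (ereal 1) Y y" for H Y h y
    proof -
      obtain D where D: "W0_grad \<Omega> X 1 y D" "Lp_tendsto \<Omega> (ereal 1) (\<lambda>n. Xgrad \<Omega> X (Y n)) D"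
        using gradient_limit[OF est zero_less_one order.refl one_le_numeral h] by blast
      have ae: "AE x in lebesgue_on \<Omega>. D x = Xgrad \<Omega> X y x"
        using Xgrad_AE_eq(1)[OF D(1) order.refl] by eventually_elim simp
      show ?thesis
        by (rule Lp_tendsto_AE_cong[OF D(2) zero_less_one Lp_borel[OF W0_grad_memD(2)[OF Xgrad_AE_eq(2)[OF D(1) order.refl]]] ae])
    qed
    let ?d = "\<lambda>x. u x - v x" and ?g = "\<lambda>x. Xgrad \<Omega> X u x - Xgrad \<Omega> X v x"
    have limG: "Lp_tendsto \<Omega> (ereal 1) (\<lambda>n x. Xgrad \<Omega> X (U n) x - Xgrad \<Omega> X (V n) x) ?g"
      by (rule Lp_tendsto_diff[OF grad[OF F] grad[OF G] zero_less_one])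
    have W: "W0_grad \<Omega> X 2 (\<lambda>x. U n x - V n x) (\<lambda>x. Xgrad \<Omega> X (U n) x - Xgrad \<Omega> X (V n) x)" for n
      by (rule W0_grad_diff[OF solves_W0_grad[OF F(1)] solves_W0_grad[OF G(1)]]) simp
    have N: "Lp_norm \<Omega> (ereal 1) (\<lambda>x. f x - g x) = Lint \<Omega> 1 (\<lambda>x. f x - g x) powr (1 / 1)" by (rule Lp_norm_ereal)
    have N0: "0 \<le> Lp_norm \<Omega> (ereal 1) (\<lambda>x. f x - g x)" unfolding N by simp
    have ev: "\<forall>\<^sub>F n in sequentially. Lint \<Omega> 1 (\<lambda>x. F n x - G n x) \<le> 8 * s"
      if "Lp_norm \<Omega> (ereal 1) (\<lambda>x. f x - g x) < s" for s
      using eventually_datum_le[OF lim zero_less_one that[unfolded N]] by simp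
    have pw: "C * (8 * s / (t / 2)) powr r = C * 16 powr r * (s / t) powr r" for s t r :: real
    proof -
      have "8 * s / (t / 2) = 16 * (s / t)" by simp
      then show ?thesis by (simp only: powr_mult mult.assoc)
    qed
    have m1: "measure (lebesgue_on \<Omega>) {x \<in> \<Omega>. t \<le> norm (?d x)} \<le> c1 * (s / t) powr ?k1"
      if s: "Lp_norm \<Omega> (ereal 1) (\<lambda>x. f x - g x) < s" and t: "0 < t" for s t
    proof (rule weak_type_limit[OF lmeasurable_domain limU t])
      show "\<forall>\<^sub>F n in sequentially. measure (lebesgue_on \<Omega>) {x \<in> \<Omega>. t / 2 \<le> norm (U n x - V n x)} \<le> c1 * (s / t) powr ?k1"
        using ev[OF s]
      proof eventually_elim
        case (elim n)
        have "0 < t / 2" using t by simp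
        from weak1[OF FG W elim this] show ?case unfolding pw c1_def real_norm_def .
      qed
    qed
    have m2: "measure (lebesgue_on \<Omega>) {x \<in> \<Omega>. t \<le> norm (?g x)} \<le> c2 * (s / t) powr ?k2"
      if s: "Lp_norm \<Omega> (ereal 1) (\<lambda>x. f x - g x) < s" and t: "0 < t" for s t
    proof (rule weak_type_limit[OF lmeasurable_domain limG t])
      show "\<forall>\<^sub>F n in sequentially. measure (lebesgue_on \<Omega>) {x \<in> \<Omega>. t / 2 \<le> norm (Xgrad \<Omega> X (U n) x - Xgrad \<Omega> X (V n) x)} \<le> c2 * (s / t) powr ?k2"
        using ev[OF s]
      proof eventually_elim
        case (elim n)
        have "0 < t / 2" "0 < 8 * s" using t s N0 by auto
        from weak2[OF FG W elim this(2,1)] show ?case unfolding pw c2_def .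
      qed
    qed
    have dm: "?d \<in> borel_measurable (lebesgue_on \<Omega>)" "?g \<in> borel_measurable (lebesgue_on \<Omega>)"
      using limU limG by (auto simp: Lp_tendsto_def intro: Lp_borel)
    let ?N = "Lp_norm \<Omega> (ereal 1) (\<lambda>x. f x - g x)"
    have le: "c1 powr (1 / ?k1) * ?N \<le> (c1 powr (1 / ?k1) + c2 powr (1 / ?k2)) * ?N"
      "c2 powr (1 / ?k2) * ?N \<le> (c1 powr (1 / ?k1) + c2 powr (1 / ?k2)) * ?N"
      using N0 by (intro mult_right_mono; simp)+
    show "?d \<in> Marcinkiewicz \<Omega> (dstar_exp Q 1) \<and>
       Marcinkiewicz_norm \<Omega> (dstar_exp Q 1) ?d \<le> (c1 powr (1 / ?k1) + c2 powr (1 / ?k2)) * ?N \<and>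
       ?g \<in> Marcinkiewicz \<Omega> (star_exp Q 1) \<and>
       Marcinkiewicz_norm \<Omega> (star_exp Q 1) ?g \<le> (c1 powr (1 / ?k1) + c2 powr (1 / ?k2)) * ?N"
      unfolding k(3,4)
      by (intro conjI Marcinkiewicz_normI(1)[OF \<Omega>' dm(1) c(1) k(1) N0 m1] Marcinkiewicz_normI(1)[OF \<Omega>' dm(2) c(2) k(2) N0 m2]
          order.trans[OF Marcinkiewicz_normI(2)[OF \<Omega>' dm(1) c(1) k(1) N0 m1] le(1)]
          order.trans[OF Marcinkiewicz_normI(2)[OF \<Omega>' dm(2) c(2) k(2) N0 m2] le(2)])
  qed
qed

lemma solution_difference_solves:
  assumes "elliptic \<Omega> \<alpha> \<beta> A" "f \<in> Lp \<Omega> (ereal two_star_conj)" "g \<in> Lp \<Omega> (ereal two_star_conj)"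
    "is_solution \<Omega> X Q A f u" "is_solution \<Omega> X Q A g v"
  shows "solves A (\<lambda>x. f x - g x) (\<lambda>x. u x - v x)"
proof (rule solves_diff)
  show "solves A f u" "solves A g v" using assms by (auto simp: solves_def is_solution_def)
qed

lemma supercritical_case:
  assumes p: "ereal (Q / 2) < p"
  obtains C where "0 \<le> C" "\<And>A \<beta> f g u v. elliptic \<Omega> \<alpha> \<beta> A \<Longrightarrow> f \<in> Lp \<Omega> p \<Longrightarrow> g \<in> Lp \<Omega> p \<Longrightarrow>
     is_solution \<Omega> X Q A f u \<Longrightarrow> is_solution \<Omega> X Q A g v \<Longrightarrow>
     (\<lambda>x. u x - v x) \<in> Lp \<Omega> \<infinity> \<and> Lp_norm \<Omega> \<infinity> (\<lambda>x. u x - v x) \<le> C * Lp_norm \<Omega> p (\<lambda>x. f x - g x) \<and>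
     (\<lambda>x. u x - v x) \<in> W0 \<Omega> X 2 \<and> W0_norm \<Omega> X 2 (\<lambda>x. u x - v x) \<le> C * Lp_norm \<Omega> p (\<lambda>x. f x - g x)"
proof -
  have rQ: "two_star_conj \<le> Q / 2"
  proof -
    have "4 * Q \<le> Q * (Q + 2)" using Q_gt_2 by (simp add: algebra_simps mult_left_mono)
    then show ?thesis using Q_gt_2 by (simp add: field_simps)
  qed
  \<comment> \<open>For \<open>p = \<infinity>\<close> the bounds for the finite exponent \<open>Q\<close> suffice.\<close>
  obtain r c where r: "Q / 2 < r" and c: "0 \<le> c"
    and mem: "\<And>F :: real^'n \<Rightarrow> real. F \<in> Lp \<Omega> p \<Longrightarrow> F \<in> Lp \<Omega> (ereal r)"
    and le: "\<And>f g :: real^'n \<Rightarrow> real. f \<in> Lp \<Omega> p \<Longrightarrow> g \<in> Lp \<Omega> p \<Longrightarrow>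
      Lint \<Omega> r (\<lambda>x. f x - g x) powr (1 / r) \<le> c * Lp_norm \<Omega> p (\<lambda>x. f x - g x)"
  proof (cases p)
    case (real r)
    show ?thesis
      by (rule that[of r 1]) (use p real in \<open>auto simp: Lp_norm_ereal\<close>)
  next
    case PInf
    have Q0: "0 < Q" using Q_gt_2 by simp
    show ?thesis
    proof (rule that[of Q "measure lebesgue \<Omega> powr (1 / Q)"])
      show "F \<in> Lp \<Omega> (ereal Q)" if "F \<in> Lp \<Omega> p" for F :: "real^'n \<Rightarrow> real"
        using Linfinity_in_Lp(1)[OF _ Q0] that unfolding PInf .
      show "Lint \<Omega> Q (\<lambda>x. f x - g x) powr (1 / Q) \<le> measure lebesgue \<Omega> powr (1 / Q) * Lp_norm \<Omega> p (\<lambda>x. f x - g x)"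
        if "f \<in> Lp \<Omega> p" "g \<in> Lp \<Omega> p" for f g :: "real^'n \<Rightarrow> real"
        unfolding PInf by (rule Linfinity_in_Lp(2)[OF Linfinity_diff[OF that[unfolded PInf]] Q0])
    qed (use Q0 in auto)
  next
    case MInf
    then show ?thesis using p by simp
  qed
  have r2: "two_star_conj \<le> r" "0 \<le> two_star_conj" using rQ r exponents by linarith+
  obtain D where D: "0 \<le> D" and sup: "\<And>A F d. solves A F d \<Longrightarrow> F \<in> Lp \<Omega> (ereal r) \<Longrightarrow>
     d \<in> Lp \<Omega> \<infinity> \<and> Lp_norm \<Omega> \<infinity> d \<le> D * Lint \<Omega> r F powr (1 / r)"
    using sup_estimate_homogeneous[OF r] by blast
  obtain E where E: "0 \<le> E" and W12: "\<And>A F d. solves A F d \<Longrightarrow> F \<in> Lp \<Omega> (ereal r) \<Longrightarrow>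
     W0_norm \<Omega> X 2 d \<le> E * Lint \<Omega> r F powr (1 / r)"
    using W12_estimate_Lp[OF r2(1)] by blast
  have N: "0 \<le> c * Lp_norm \<Omega> p (\<lambda>x. f x - g x)" if "f \<in> Lp \<Omega> p" "g \<in> Lp \<Omega> p" for f g :: "real^'n \<Rightarrow> real"
    using le[OF that] powr_ge_zero[of "Lint \<Omega> r (\<lambda>x. f x - g x)" "1 / r"] by linarith
  show ?thesis
  proof (rule that[of "(D + E) * c"])
    show "0 \<le> (D + E) * c" using D E c by simp
    fix A \<beta> f g u v
    assume A: "elliptic \<Omega> \<alpha> \<beta> A" and f: "f \<in> Lp \<Omega> p" and g: "g \<in> Lp \<Omega> p"
      and u: "is_solution \<Omega> X Q A f u" and v: "is_solution \<Omega> X Q A g v"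
    let ?d = "\<lambda>x. u x - v x" and ?N = "Lp_norm \<Omega> p (\<lambda>x. f x - g x)"
    have s: "solves A (\<lambda>x. f x - g x) ?d"
      by (rule solution_difference_solves[OF A Lp_mono[OF lmeasurable_domain mem[OF f] r2(2,1)]
            Lp_mono[OF lmeasurable_domain mem[OF g] r2(2,1)] u v])
    have FL: "(\<lambda>x. f x - g x) \<in> Lp \<Omega> (ereal r)"
      by (rule Lp_diff[OF mem[OF f] mem[OF g]]) (use r2 in linarith)
    have bound: "K * Lint \<Omega> r (\<lambda>x. f x - g x) powr (1 / r) \<le> (D + E) * c * ?N" if "0 \<le> K" "K \<le> D + E" for K
    proof -
      have "K * Lint \<Omega> r (\<lambda>x. f x - g x) powr (1 / r) \<le> (D + E) * (c * ?N)"
        using that D E le[OF f g] by (intro mult_mono) auto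
      then show ?thesis by (simp only: mult.assoc)
    qed
    have "?d \<in> W0 \<Omega> X 2" using solves_W0_grad[OF s] by (simp add: W0_iff)
    moreover have "Lp_norm \<Omega> \<infinity> ?d \<le> (D + E) * c * ?N"
      by (rule order.trans[OF conjunct2[OF sup[OF s FL]] bound[OF D]]) (use E in simp)
    moreover have "W0_norm \<Omega> X 2 ?d \<le> (D + E) * c * ?N"
      by (rule order.trans[OF W12[OF s FL] bound[OF E]]) (use D in simp)
    ultimately show "?d \<in> Lp \<Omega> \<infinity> \<and> Lp_norm \<Omega> \<infinity> ?d \<le> (D + E) * c * ?N \<and>
       ?d \<in> W0 \<Omega> X 2 \<and> W0_norm \<Omega> X 2 ?d \<le> (D + E) * c * ?N"
      using sup[OF s FL] by blast
  qed
qed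

lemma subcritical_case:
  assumes p: "two_star_conj \<le> p" "p < Q / 2"
  obtains C where "0 \<le> C" "\<And>A \<beta> f g u v. elliptic \<Omega> \<alpha> \<beta> A \<Longrightarrow> f \<in> Lp \<Omega> (ereal p) \<Longrightarrow> g \<in> Lp \<Omega> (ereal p) \<Longrightarrow>
     is_solution \<Omega> X Q A f u \<Longrightarrow> is_solution \<Omega> X Q A g v \<Longrightarrow>
     (\<lambda>x. u x - v x) \<in> Lp \<Omega> (ereal (dstar_exp Q p)) \<and>
     Lp_norm \<Omega> (ereal (dstar_exp Q p)) (\<lambda>x. u x - v x) \<le> C * Lp_norm \<Omega> (ereal p) (\<lambda>x. f x - g x) \<and>
     (\<lambda>x. u x - v x) \<in> W0 \<Omega> X 2 \<and> W0_norm \<Omega> X 2 (\<lambda>x. u x - v x) \<le> C * Lp_norm \<Omega> (ereal p) (\<lambda>x. f x - g x)"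
proof -
  have r2: "0 \<le> two_star_conj" "0 < p" using p exponents by linarith+
  have q: "0 < dstar_exp Q p" using p r2 Q_gt_2 by (simp add: dstar_exp_def)
  obtain D where D: "0 \<le> D" and leb: "\<forall>A F d. solves A F d \<longrightarrow> F \<in> Lp \<Omega> (ereal p) \<longrightarrow> Lint \<Omega> p F \<le> 1 \<longrightarrow>
     d \<in> Lp \<Omega> (ereal (dstar_exp Q p)) \<and> Lint \<Omega> (dstar_exp Q p) d \<le> D"
    using Lebesgue_estimate[OF p] by blast
  obtain E where E: "0 \<le> E" and W12: "\<And>A F d. solves A F d \<Longrightarrow> F \<in> Lp \<Omega> (ereal p) \<Longrightarrow>
     W0_norm \<Omega> X 2 d \<le> E * Lint \<Omega> p F powr (1 / p)"
    using W12_estimate_Lp[OF p(1)] by blast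
  let ?D = "D powr (1 / dstar_exp Q p)"
  show ?thesis
  proof (rule that[of "?D + E"])
    show "0 \<le> ?D + E" using E by simp
    fix A \<beta> f g u v
    assume A: "elliptic \<Omega> \<alpha> \<beta> A" and f: "f \<in> Lp \<Omega> (ereal p)" and g: "g \<in> Lp \<Omega> (ereal p)"
      and u: "is_solution \<Omega> X Q A f u" and v: "is_solution \<Omega> X Q A g v"
    let ?d = "\<lambda>x. u x - v x" and ?N = "Lint \<Omega> p (\<lambda>x. f x - g x) powr (1 / p)"
    have s: "solves A (\<lambda>x. f x - g x) ?d"
      by (rule solution_difference_solves[OF A Lp_mono[OF lmeasurable_domain f r2(1) p(1)]
            Lp_mono[OF lmeasurable_domain g r2(1) p(1)] u v])
    have FL: "(\<lambda>x. f x - g x) \<in> Lp \<Omega> (ereal p)" by (rule Lp_diff[OF f g less_imp_le[OF r2(2)]])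
    note est = function_estimate_homogeneous[OF leb r2(2) q s FL]
    have bound: "K * ?N \<le> (?D + E) * ?N" if "K \<le> ?D + E" for K using that by (rule mult_right_mono) simp
    have "?d \<in> W0 \<Omega> X 2" using solves_W0_grad[OF s] by (simp add: W0_iff)
    moreover have "Lp_norm \<Omega> (ereal (dstar_exp Q p)) ?d \<le> (?D + E) * ?N"
      unfolding Lp_norm_ereal by (rule order.trans[OF est(2) bound]) (use E in linarith)
    moreover have "W0_norm \<Omega> X 2 ?d \<le> (?D + E) * ?N"
      by (rule order.trans[OF W12[OF s FL] bound]) simp
    ultimately show "?d \<in> Lp \<Omega> (ereal (dstar_exp Q p)) \<and>
       Lp_norm \<Omega> (ereal (dstar_exp Q p)) ?d \<le> (?D + E) * Lp_norm \<Omega> (ereal p) (\<lambda>x. f x - g x) \<and>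
       ?d \<in> W0 \<Omega> X 2 \<and> W0_norm \<Omega> X 2 ?d \<le> (?D + E) * Lp_norm \<Omega> (ereal p) (\<lambda>x. f x - g x)"
      using est(1) unfolding Lp_norm_ereal[of \<Omega> p] by blast
  qed
qed

end

section \<open>The regularity estimates\<close>

theorem corollary7p1:
  fixes \<Omega> :: "(real^'n) set" and X :: "'m::finite \<Rightarrow> real^'n \<Rightarrow> real^'n"
    and Q \<alpha> :: real and p :: ereal
  assumes dim: "CARD('n) \<ge> 2"
    and domain: "open \<Omega>" "bounded \<Omega>"
    and fields: "\<forall>j. locally_Lipschitz_field (X j)"
    and connected: "\<forall>x\<in>\<Omega>. \<forall>y\<in>\<Omega>. \<exists>T>0. \<exists>\<gamma>. subunit_path X T \<gamma> \<and> \<gamma> ` {0..T} \<subseteq> \<Omega> \<and> \<gamma> 0 = x \<and> \<gamma> T = y"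
    and topology: "\<forall>x\<in>\<Omega>. (dX X x \<longlongrightarrow> 0) (at x within \<Omega>)"
    and Q: "Q > 2"
    and doubling: "\<forall>x\<in>\<Omega>. \<forall>r>0. 0 < measure lebesgue (Xball \<Omega> X x (2 * r)) \<and>
       measure lebesgue (Xball \<Omega> X x (2 * r)) \<le> 2 powr Q * measure lebesgue (Xball \<Omega> X x r)"
    and Poincare: "\<exists>C\<^sub>P \<nu>. C\<^sub>P > 0 \<and> \<nu> > 0 \<and> Poincare_ineq \<Omega> X C\<^sub>P \<nu>"
    and Sobolev: "\<forall>q. 1 \<le> q \<and> q < Q \<longrightarrow> (\<exists>S. Sobolev_ineq \<Omega> X Q q S)"
    and \<alpha>: "\<alpha> > 0"
    and p: "p \<ge> 1"
  shows "\<exists>C. \<forall>A \<beta> f g u v.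
    \<alpha> < \<beta> \<and> elliptic \<Omega> \<alpha> \<beta> A \<and> f \<in> Lp \<Omega> p \<and> g \<in> Lp \<Omega> p \<and>
    is_solution \<Omega> X Q A f u \<and> is_solution \<Omega> X Q A g v \<longrightarrow>
    (let r = real_of_ereal p; d = (\<lambda>x. u x - v x); N = Lp_norm \<Omega> p (\<lambda>x. f x - g x) in
      (p > Q / 2 \<longrightarrow>
         d \<in> Lp \<Omega> \<infinity> \<and> Lp_norm \<Omega> \<infinity> d \<le> C * N \<and>
         d \<in> W0 \<Omega> X 2 \<and> W0_norm \<Omega> X 2 d \<le> C * N) \<and>
      (2 * Q / (Q + 2) \<le> p \<and> p < Q / 2 \<longrightarrow>
         d \<in> Lp \<Omega> (dstar_exp Q r) \<and> Lp_norm \<Omega> (dstar_exp Q r) d \<le> C * N \<and>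
         d \<in> W0 \<Omega> X 2 \<and> W0_norm \<Omega> X 2 d \<le> C * N) \<and>
      (1 < p \<and> p < 2 * Q / (Q + 2) \<longrightarrow>
         d \<in> W0 \<Omega> X (star_exp Q r) \<and> W0_norm \<Omega> X (star_exp Q r) d \<le> C * N) \<and>
      (p = 1 \<longrightarrow>
         d \<in> Marcinkiewicz \<Omega> (dstar_exp Q 1) \<and> Marcinkiewicz_norm \<Omega> (dstar_exp Q 1) d \<le> C * N \<and>
         (\<lambda>x. Xgrad \<Omega> X u x - Xgrad \<Omega> X v x) \<in> Marcinkiewicz \<Omega> (star_exp Q 1) \<and>
         Marcinkiewicz_norm \<Omega> (star_exp Q 1) (\<lambda>x. Xgrad \<Omega> X u x - Xgrad \<Omega> X v x) \<le> C * N))"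
proof -
  interpret sobolev_setting \<Omega> X Q \<alpha>
    using domain fields Q \<alpha> Sobolev by unfold_locales
  have rQ: "2 * Q / (Q + 2) < Q / 2"
  proof -
    have "2 * 2 < Q + 2" using Q by simp
    then have "2 * 2 * Q < (Q + 2) * Q" using Q by (intro mult_strict_right_mono) auto
    then show ?thesis using Q by (simp add: field_simps)
  qed
  have r1: "1 < 2 * Q / (Q + 2)" by (rule exponents(1))
  have Q1: "1 < Q / 2" using rQ r1 by linarith
  note order = rQ r1 Q1
  consider (super) "ereal (Q / 2) < p"
    | (sub) r where "p = ereal r" "2 * Q / (Q + 2) \<le> r" "r < Q / 2"
    | (mid) r where "p = ereal r" "1 < r" "r < 2 * Q / (Q + 2)"
    | (one) "p = ereal 1" | (half) "p = ereal (Q / 2)"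
  proof (cases p)
    case (real r)
    then have "1 \<le> r" using p by (simp add: one_ereal_def)
    then consider "Q / 2 < r" | "2 * Q / (Q + 2) \<le> r" "r < Q / 2" | "1 < r" "r < 2 * Q / (Q + 2)" | "r = 1" | "r = Q / 2"
      by linarith
    then show ?thesis using that real by cases auto
  qed (use that p in auto)
  then show ?thesis
  proof cases
    case super
    have np: "\<not> p < ereal (Q / 2)" "\<not> p < ereal (2 * Q / (Q + 2))" "p \<noteq> 1"
    proof -
      show 1: "\<not> p < ereal (Q / 2)" using super by (simp add: not_less less_imp_le)
      have "ereal (2 * Q / (Q + 2)) < ereal (Q / 2)" using rQ by simp
      with 1 show "\<not> p < ereal (2 * Q / (Q + 2))" using order.strict_trans by blast
      have "ereal 1 < ereal (Q / 2)" using Q1 by (simp only: less_ereal.simps)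
      then show "p \<noteq> 1" using 1 unfolding one_ereal_def by auto
    qed
    obtain C where "0 \<le> C" and C: "\<And>A \<beta> f g u v. elliptic \<Omega> \<alpha> \<beta> A \<Longrightarrow> f \<in> Lp \<Omega> p \<Longrightarrow> g \<in> Lp \<Omega> p \<Longrightarrow>
       is_solution \<Omega> X Q A f u \<Longrightarrow> is_solution \<Omega> X Q A g v \<Longrightarrow>
       (\<lambda>x. u x - v x) \<in> Lp \<Omega> \<infinity> \<and> Lp_norm \<Omega> \<infinity> (\<lambda>x. u x - v x) \<le> C * Lp_norm \<Omega> p (\<lambda>x. f x - g x) \<and>
       (\<lambda>x. u x - v x) \<in> W0 \<Omega> X 2 \<and> W0_norm \<Omega> X 2 (\<lambda>x. u x - v x) \<le> C * Lp_norm \<Omega> p (\<lambda>x. f x - g x)"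
      using supercritical_case[OF super] by blast
    show ?thesis
      unfolding Let_def
      by (rule exI[of _ C]) (use C np in \<open>simp only: simp_thms, blast\<close>)
  next
    case (sub r)
    have np: "\<not> ereal (Q / 2) < p" "\<not> p < ereal (2 * Q / (Q + 2))" "p \<noteq> 1" "real_of_ereal p = r"
      using sub order by (auto simp: one_ereal_def)
    obtain C where "0 \<le> C" and C: "\<And>A \<beta> f g u v. elliptic \<Omega> \<alpha> \<beta> A \<Longrightarrow> f \<in> Lp \<Omega> (ereal r) \<Longrightarrow> g \<in> Lp \<Omega> (ereal r) \<Longrightarrow>
       is_solution \<Omega> X Q A f u \<Longrightarrow> is_solution \<Omega> X Q A g v \<Longrightarrow>
       (\<lambda>x. u x - v x) \<in> Lp \<Omega> (ereal (dstar_exp Q r)) \<and>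
       Lp_norm \<Omega> (ereal (dstar_exp Q r)) (\<lambda>x. u x - v x) \<le> C * Lp_norm \<Omega> (ereal r) (\<lambda>x. f x - g x) \<and>
       (\<lambda>x. u x - v x) \<in> W0 \<Omega> X 2 \<and> W0_norm \<Omega> X 2 (\<lambda>x. u x - v x) \<le> C * Lp_norm \<Omega> (ereal r) (\<lambda>x. f x - g x)"
      using subcritical_case[OF sub(2,3)] by blast
    show ?thesis
      unfolding Let_def np(4)
      by (rule exI[of _ C]) (use C[folded sub(1)] np(1-3) in \<open>simp only: simp_thms, blast\<close>)
  next
    case (mid r)
    have np: "\<not> ereal (Q / 2) < p" "\<not> ereal (2 * Q / (Q + 2)) \<le> p" "p \<noteq> 1" "real_of_ereal p = r"
      using mid order by (auto simp: one_ereal_def)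
    obtain C where "0 \<le> C" and C: "\<And>A \<beta> f g u v. elliptic \<Omega> \<alpha> \<beta> A \<Longrightarrow> f \<in> Lp \<Omega> (ereal r) \<Longrightarrow> g \<in> Lp \<Omega> (ereal r) \<Longrightarrow>
       is_solution \<Omega> X Q A f u \<Longrightarrow> is_solution \<Omega> X Q A g v \<Longrightarrow>
       (\<lambda>x. u x - v x) \<in> W0 \<Omega> X (star_exp Q r) \<and>
       W0_norm \<Omega> X (star_exp Q r) (\<lambda>x. u x - v x) \<le> C * Lp_norm \<Omega> (ereal r) (\<lambda>x. f x - g x)"
      using intermediate_case[OF mid(2,3)] by blast
    show ?thesis
      unfolding Let_def np(4)
      by (rule exI[of _ C]) (use C[folded mid(1)] np(1-3) in \<open>simp only: simp_thms, blast\<close>)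
  next
    case one
    have np: "\<not> ereal (Q / 2) < p" "\<not> ereal (2 * Q / (Q + 2)) \<le> p" "\<not> 1 < p"
      using one order by (auto simp: one_ereal_def)
    obtain C where "0 \<le> C" and C: "\<And>A \<beta> f g u v. elliptic \<Omega> \<alpha> \<beta> A \<Longrightarrow> f \<in> Lp \<Omega> (ereal 1) \<Longrightarrow> g \<in> Lp \<Omega> (ereal 1) \<Longrightarrow>
       is_solution \<Omega> X Q A f u \<Longrightarrow> is_solution \<Omega> X Q A g v \<Longrightarrow>
       (\<lambda>x. u x - v x) \<in> Marcinkiewicz \<Omega> (dstar_exp Q 1) \<and>
       Marcinkiewicz_norm \<Omega> (dstar_exp Q 1) (\<lambda>x. u x - v x) \<le> C * Lp_norm \<Omega> (ereal 1) (\<lambda>x. f x - g x) \<and>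
       (\<lambda>x. Xgrad \<Omega> X u x - Xgrad \<Omega> X v x) \<in> Marcinkiewicz \<Omega> (star_exp Q 1) \<and>
       Marcinkiewicz_norm \<Omega> (star_exp Q 1) (\<lambda>x. Xgrad \<Omega> X u x - Xgrad \<Omega> X v x) \<le> C * Lp_norm \<Omega> (ereal 1) (\<lambda>x. f x - g x)"
      using integrable_case by blast
    show ?thesis
      unfolding Let_def
      by (rule exI[of _ C]) (use C[folded one] np in \<open>simp only: simp_thms, blast\<close>)
  next
    case half
    have "\<not> ereal (Q / 2) < p" "\<not> p < ereal (Q / 2)" "\<not> p < ereal (2 * Q / (Q + 2))" "p \<noteq> 1"
      using half order by (auto simp: one_ereal_def)
    then show ?thesis unfolding Let_def by (simp only: simp_thms)
  qed
qed

end
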